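(* Let $K$ be a field, let $S$ be either $K[[x_1,\ldots,x_n]]$ or $K[x_1,\ldots,x_n]$, let $I$ be a proper ideal of $S$ (graded if $S$ is the polynomial ring), and let $\sigma$ be any permutation of the integers $1,\ldots,n$. Then the natural map $$\operatorname{Tor}^S_i(K,S/I)\to\operatorname{Tor}^S_i(K,S/d_\sigma(I))$$ induced by the surjection $S/I\to S/d_\sigma(I)$ is zero for all $i\ge 1$.
   Context: $\mathfrak{n}=(x_1,\ldots,x_n)\subset S$ and $K=S/\mathfrak{n}$. For $f\in\mathfrak{n}$ and $1\le r\le n$ define $$d^r(f)=\frac{f(0,\ldots,0,x_r,\ldots,x_n)-f(0,\ldots,0,x_{r+1},\ldots,x_n)}{x_r}\in S.$$ For a permutation $\sigma$ of $\{1,\ldots,n\}$, let $\sigma$ also denote the $K$-algebra automorphism of $S$ with $x_i\mapsto x_{\sigma(i)}$, and set $d^i_\sigma(f)=\sigma\bigl(d^i(f(x_{\sigma^{-1}(1)},\ldots,x_{\sigma^{-1}(n)}))\bigr)$, i.e. $d^i_\sigma=\sigma\circ d^i\circ\sigma^{-1}$ (the operator $d^i$ taken with respect to the variable order $x_{\sigma(1)},\ldots,x_{\sigma(n)}$). If $I=(f_1,\ldots,f_m)$ is a proper ideal (graded in the polynomial case, so that $I\subset\mathfrak{n}$), then $d_\sigma(I)$ is the ideal of $S$ generated by all $d^i_\sigma(f_j)$, $1\le i\le n$, $1\le j\le m$; it does not depend on the choice of generators of $I$, and $I\subset d_\sigma(I)$. *)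

theory Defs
  imports "HOL-Combinatorics.Permutations" "HOL-Algebra.Ideal" "HOL-Algebra.Module"
begin

section \<open>Power series and polynomials in n variables over a field\<close>

text \<open>
  As in \<open>HOL-Algebra.Indexed_Polynomials\<close>, a monomial is the multiset of its variables and
  a series is its coefficient function; only the variables with index in \<open>{1..n}\<close> may occur.
\<close>

definition power_series_ring :: "nat \<Rightarrow> (nat multiset \<Rightarrow> 'k::field) ring" where
  "power_series_ring n =
     \<lparr>carrier = {f. \<forall>m. f m \<noteq> 0 \<longrightarrow> set_mset m \<subseteq> {1..n}},
      mult = (\<lambda>f g m. \<Sum>a | a \<subseteq># m. f a * g (m - a)),
      one = (\<lambda>m. if m = {#} then 1 else 0),
      zero = (\<lambda>m. 0),
      add = (\<lambda>f g m. f m + g m)\<rparr>"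

definition polynomial_ring :: "nat \<Rightarrow> (nat multiset \<Rightarrow> 'k::field) ring" where
  "polynomial_ring n =
     (power_series_ring n)\<lparr>carrier := {f \<in> carrier (power_series_ring n). finite {m. f m \<noteq> 0}}\<rparr>"

definition var :: "nat \<Rightarrow> nat multiset \<Rightarrow> 'k::field" where
  "var r = (\<lambda>m. if m = {#r#} then 1 else 0)"

definition homogeneous_part :: "nat \<Rightarrow> (nat multiset \<Rightarrow> 'k::field) \<Rightarrow> nat multiset \<Rightarrow> 'k" where
  "homogeneous_part e f = (\<lambda>m. if size m = e then f m else 0)"

definition graded :: "(nat multiset \<Rightarrow> 'k::field) set \<Rightarrow> bool" where
  "graded I \<longleftrightarrow> (\<forall>f\<in>I. \<forall>e. homogeneous_part e f \<in> I)"

text \<open>The series \<open>f(0,\<dots>,0,x\<^sub>r,\<dots>,x\<^sub>n)\<close>.\<close>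

definition zero_below :: "nat \<Rightarrow> (nat multiset \<Rightarrow> 'k::field) \<Rightarrow> nat multiset \<Rightarrow> 'k" where
  "zero_below r f = (\<lambda>m. if \<exists>i\<in>#m. i < r then 0 else f m)"

definition d_op ::
  "(nat multiset \<Rightarrow> 'k::field) ring \<Rightarrow> nat \<Rightarrow> (nat multiset \<Rightarrow> 'k) \<Rightarrow> nat multiset \<Rightarrow> 'k" where
  "d_op S r f =
     (THE g. g \<in> carrier S \<and> var r \<otimes>\<^bsub>S\<^esub> g = zero_below r f \<ominus>\<^bsub>S\<^esub> zero_below (Suc r) f)"

text \<open>The automorphism with \<open>x\<^sub>i \<mapsto> x\<^bsub>\<sigma>(i)\<^esub>\<close>: it moves the coefficient of \<open>m\<close> to \<open>image_mset \<sigma> m\<close>.\<close>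

definition perm_act ::
  "(nat \<Rightarrow> nat) \<Rightarrow> (nat multiset \<Rightarrow> 'k::field) \<Rightarrow> nat multiset \<Rightarrow> 'k" where
  "perm_act \<sigma> f = (\<lambda>m. f (image_mset (inv_into UNIV \<sigma>) m))"

definition d_perm ::
  "(nat multiset \<Rightarrow> 'k::field) ring \<Rightarrow> (nat \<Rightarrow> nat) \<Rightarrow> nat \<Rightarrow>
     (nat multiset \<Rightarrow> 'k) \<Rightarrow> nat multiset \<Rightarrow> 'k" where
  "d_perm S \<sigma> r f = perm_act \<sigma> (d_op S r (perm_act (inv_into UNIV \<sigma>) f))"

text \<open>
  The ideal \<open>d\<^sub>\<sigma>(I)\<close>, formed from a set \<open>F\<close> of generators of \<open>I\<close>. It does not depend on \<open>F\<close>,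
  and \<open>F\<close> is not required to be finite: this includes finite families of generators, and
  taking \<open>F = I\<close> it covers every ideal without appeal to the Noetherian property.
\<close>

definition d_ideal ::
  "(nat multiset \<Rightarrow> 'k::field) ring \<Rightarrow> nat \<Rightarrow> (nat \<Rightarrow> nat) \<Rightarrow>
     (nat multiset \<Rightarrow> 'k) set \<Rightarrow> (nat multiset \<Rightarrow> 'k) set" where
  "d_ideal S n \<sigma> F = Idl\<^bsub>S\<^esub> {d_perm S \<sigma> r f | r f. r \<in> {1..n} \<and> f \<in> F}"

section \<open>Homomorphisms, quotients and free modules\<close>

text \<open>
  The fields \<open>mult\<close> and \<open>one\<close> of the record type \<open>module\<close> have no meaning for a module that is
  not an algebra.
\<close>

definition module_hom ::
  "('a, 'm) ring_scheme \<Rightarrow> ('a, 'b) module \<Rightarrow> ('a, 'c) module \<Rightarrow> ('b \<Rightarrow> 'c) set" where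
  "module_hom R M N =
     {f \<in> carrier M \<rightarrow> carrier N.
        (\<forall>x\<in>carrier M. \<forall>y\<in>carrier M. f (x \<oplus>\<^bsub>M\<^esub> y) = f x \<oplus>\<^bsub>N\<^esub> f y) \<and>
        (\<forall>a\<in>carrier R. \<forall>x\<in>carrier M. f (a \<odot>\<^bsub>M\<^esub> x) = a \<odot>\<^bsub>N\<^esub> f x)}"

definition self_module :: "('a, 'm) ring_scheme \<Rightarrow> ('a, 'a) module" where
  "self_module R =
     \<lparr>carrier = carrier R, mult = mult R, one = one R,
      zero = zero R, add = add R, smult = mult R\<rparr>"

definition quot_module :: "('a, 'b) module \<Rightarrow> 'b set \<Rightarrow> ('a, 'b set) module" where
  "quot_module M H =
     \<lparr>carrier = a_rcosets\<^bsub>M\<^esub> H, mult = undefined, one = undefined, zero = H,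
      add = set_add M, smult = (\<lambda>a X. (\<Union>x\<in>X. H +>\<^bsub>M\<^esub> (a \<odot>\<^bsub>M\<^esub> x)))\<rparr>"

text \<open>The map into \<open>M / H\<close> that a map \<open>\<phi>\<close> into \<open>M\<close> induces on a quotient of its domain.\<close>

definition quot_map :: "('a, 'b) module \<Rightarrow> 'b set \<Rightarrow> ('c \<Rightarrow> 'b) \<Rightarrow> 'c set \<Rightarrow> 'b set" where
  "quot_map M H \<phi> X = the_elem ((\<lambda>x. H +>\<^bsub>M\<^esub> \<phi> x) ` X)"

definition submodule_span :: "('a, 'm) ring_scheme \<Rightarrow> ('a, 'b) module \<Rightarrow> 'b set \<Rightarrow> 'b set" where
  "submodule_span R M X = \<Inter>{H. submodule H R M \<and> X \<subseteq> H}"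

definition free_module :: "('a, 'm) ring_scheme \<Rightarrow> 'c set \<Rightarrow> ('a, 'c \<Rightarrow> 'a) module" where
  "free_module R X =
     \<lparr>carrier = {u. range u \<subseteq> carrier R \<and> finite {x. u x \<noteq> \<zero>\<^bsub>R\<^esub>} \<and> {x. u x \<noteq> \<zero>\<^bsub>R\<^esub>} \<subseteq> X},
      mult = undefined, one = undefined, zero = (\<lambda>x. \<zero>\<^bsub>R\<^esub>),
      add = (\<lambda>u v x. u x \<oplus>\<^bsub>R\<^esub> v x), smult = (\<lambda>a u x. a \<otimes>\<^bsub>R\<^esub> u x)\<rparr>"

definition unit_vec :: "('a, 'm) ring_scheme \<Rightarrow> 'c \<Rightarrow> 'c \<Rightarrow> 'a" where
  "unit_vec R x = (\<lambda>y. if y = x then \<one>\<^bsub>R\<^esub> else \<zero>\<^bsub>R\<^esub>)"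

text \<open>The linear extension to a free module of a map \<open>\<phi>\<close> from the basis into \<open>M\<close>.\<close>

definition lin_ext ::
  "('a, 'm) ring_scheme \<Rightarrow> ('a, 'b) module \<Rightarrow> ('c \<Rightarrow> 'b) \<Rightarrow> ('c \<Rightarrow> 'a) \<Rightarrow> 'b" where
  "lin_ext R M \<phi> u = (\<Oplus>\<^bsub>M\<^esub>x\<in>{x. u x \<noteq> \<zero>\<^bsub>R\<^esub>}. u x \<odot>\<^bsub>M\<^esub> \<phi> x)"

definition is_free :: "('a, 'm) ring_scheme \<Rightarrow> ('a, 'b) module \<Rightarrow> bool" where
  "is_free R M \<longleftrightarrow>
     module R M \<and>
     (\<exists>B \<subseteq> carrier M. bij_betw (lin_ext R M id) (carrier (free_module R B)) (carrier M))"

section \<open>Tensor products\<close>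

definition bilinear_relations ::
  "('a, 'm) ring_scheme \<Rightarrow> ('a, 'b) module \<Rightarrow> ('a, 'c) module \<Rightarrow> ('b \<times> 'c \<Rightarrow> 'a) set" where
  "bilinear_relations R M N =
     (let L = free_module R (carrier M \<times> carrier N); e = unit_vec R in
      {e (x \<oplus>\<^bsub>M\<^esub> x', y) \<ominus>\<^bsub>L\<^esub> (e (x, y) \<oplus>\<^bsub>L\<^esub> e (x', y)) | x x' y.
         x \<in> carrier M \<and> x' \<in> carrier M \<and> y \<in> carrier N} \<union>
      {e (x, y \<oplus>\<^bsub>N\<^esub> y') \<ominus>\<^bsub>L\<^esub> (e (x, y) \<oplus>\<^bsub>L\<^esub> e (x, y')) | x y y'.
         x \<in> carrier M \<and> y \<in> carrier N \<and> y' \<in> carrier N} \<union>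
      {e (a \<odot>\<^bsub>M\<^esub> x, y) \<ominus>\<^bsub>L\<^esub> a \<odot>\<^bsub>L\<^esub> e (x, y) | a x y.
         a \<in> carrier R \<and> x \<in> carrier M \<and> y \<in> carrier N} \<union>
      {e (x, a \<odot>\<^bsub>N\<^esub> y) \<ominus>\<^bsub>L\<^esub> a \<odot>\<^bsub>L\<^esub> e (x, y) | a x y.
         a \<in> carrier R \<and> x \<in> carrier M \<and> y \<in> carrier N})"

definition tensor_kernel ::
  "('a, 'm) ring_scheme \<Rightarrow> ('a, 'b) module \<Rightarrow> ('a, 'c) module \<Rightarrow> ('b \<times> 'c \<Rightarrow> 'a) set" where
  "tensor_kernel R M N =
     submodule_span R (free_module R (carrier M \<times> carrier N)) (bilinear_relations R M N)"

definition tensor ::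
  "('a, 'm) ring_scheme \<Rightarrow> ('a, 'b) module \<Rightarrow> ('a, 'c) module \<Rightarrow> ('a, ('b \<times> 'c \<Rightarrow> 'a) set) module"
  where
  "tensor R M N = quot_module (free_module R (carrier M \<times> carrier N)) (tensor_kernel R M N)"

text \<open>The map \<open>f \<otimes> g\<close> into \<open>M' \<otimes> N'\<close>, given on generators by \<open>x \<otimes> y \<mapsto> f x \<otimes> g y\<close>.\<close>

definition tensor_map ::
  "('a, 'm) ring_scheme \<Rightarrow> ('a, 'b2) module \<Rightarrow> ('a, 'c2) module \<Rightarrow> ('b1 \<Rightarrow> 'b2) \<Rightarrow> ('c1 \<Rightarrow> 'c2) \<Rightarrow>
     ('b1 \<times> 'c1 \<Rightarrow> 'a) set \<Rightarrow> ('b2 \<times> 'c2 \<Rightarrow> 'a) set" where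
  "tensor_map R M' N' f g =
     (let L' = free_module R (carrier M' \<times> carrier N') in
      quot_map L' (tensor_kernel R M' N') (lin_ext R L' (\<lambda>(x, y). unit_vec R (f x, g y))))"

section \<open>Homology and Tor\<close>

text \<open>A complex consists of modules \<open>C i\<close> and differentials \<open>\<delta> i\<close> from \<open>C (Suc i)\<close> to \<open>C i\<close>.\<close>

definition cycles :: "(nat \<Rightarrow> ('a, 'b) module) \<Rightarrow> (nat \<Rightarrow> 'b \<Rightarrow> 'b) \<Rightarrow> nat \<Rightarrow> ('a, 'b) module" where
  "cycles C \<delta> i =
     (case i of 0 \<Rightarrow> C 0 | Suc j \<Rightarrow> (C i)\<lparr>carrier := a_kernel (C i) (C j) (\<delta> j)\<rparr>)"

definition boundaries :: "(nat \<Rightarrow> ('a, 'b) module) \<Rightarrow> (nat \<Rightarrow> 'b \<Rightarrow> 'b) \<Rightarrow> nat \<Rightarrow> 'b set" where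
  "boundaries C \<delta> i = \<delta> i ` carrier (C (Suc i))"

definition homology ::
  "(nat \<Rightarrow> ('a, 'b) module) \<Rightarrow> (nat \<Rightarrow> 'b \<Rightarrow> 'b) \<Rightarrow> nat \<Rightarrow> ('a, 'b set) module" where
  "homology C \<delta> i = quot_module (cycles C \<delta> i) (boundaries C \<delta> i)"

definition free_resolution ::
  "('a, 'm) ring_scheme \<Rightarrow> (nat \<Rightarrow> ('a, 'b) module) \<Rightarrow> (nat \<Rightarrow> 'b \<Rightarrow> 'b) \<Rightarrow> ('b \<Rightarrow> 'c) \<Rightarrow>
     ('a, 'c) module \<Rightarrow> bool" where
  "free_resolution R P \<delta> \<epsilon> M \<longleftrightarrow>
     (\<forall>i. is_free R (P i)) \<and>
     (\<forall>i. \<delta> i \<in> module_hom R (P (Suc i)) (P i)) \<and>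
     \<epsilon> \<in> module_hom R (P 0) M \<and>
     \<epsilon> ` carrier (P 0) = carrier M \<and>
     \<delta> 0 ` carrier (P 1) = a_kernel (P 0) M \<epsilon> \<and>
     (\<forall>i. \<delta> (Suc i) ` carrier (P (Suc (Suc i))) = a_kernel (P (Suc i)) (P i) (\<delta> i))"

definition tensor_diff ::
  "('a, 'm) ring_scheme \<Rightarrow> (nat \<Rightarrow> ('a, 'b) module) \<Rightarrow> (nat \<Rightarrow> 'b \<Rightarrow> 'b) \<Rightarrow> ('a, 'c) module \<Rightarrow>
     nat \<Rightarrow> ('b \<times> 'c \<Rightarrow> 'a) set \<Rightarrow> ('b \<times> 'c \<Rightarrow> 'a) set" where
  "tensor_diff R P \<delta> N i = tensor_map R (P i) N (\<delta> i) id"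

text \<open>
  \<open>Tor\<^sub>i(M, N)\<close> and, for a homomorphism \<open>g\<close> into \<open>N'\<close>, the map \<open>Tor\<^sub>i(M, g)\<close> into \<open>Tor\<^sub>i(M, N')\<close>,
  computed from a free resolution \<open>(P, \<delta>)\<close> of \<open>M\<close>. Instead of choosing a resolution, they take it as a
  parameter; up to canonical isomorphism the result does not depend on it.
\<close>

definition Tor ::
  "('a, 'm) ring_scheme \<Rightarrow> (nat \<Rightarrow> ('a, 'b) module) \<Rightarrow> (nat \<Rightarrow> 'b \<Rightarrow> 'b) \<Rightarrow> ('a, 'c) module \<Rightarrow>
     nat \<Rightarrow> ('a, ('b \<times> 'c \<Rightarrow> 'a) set set) module" where
  "Tor R P \<delta> N i = homology (\<lambda>j. tensor R (P j) N) (tensor_diff R P \<delta> N) i"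

definition Tor_map ::
  "('a, 'm) ring_scheme \<Rightarrow> (nat \<Rightarrow> ('a, 'b) module) \<Rightarrow> (nat \<Rightarrow> 'b \<Rightarrow> 'b) \<Rightarrow> ('a, 'c2) module \<Rightarrow>
     ('c1 \<Rightarrow> 'c2) \<Rightarrow> nat \<Rightarrow> ('b \<times> 'c1 \<Rightarrow> 'a) set set \<Rightarrow> ('b \<times> 'c2 \<Rightarrow> 'a) set set" where
  "Tor_map R P \<delta> N' g i =
     quot_map (cycles (\<lambda>j. tensor R (P j) N') (tensor_diff R P \<delta> N') i)
       (boundaries (\<lambda>j. tensor R (P j) N') (tensor_diff R P \<delta> N') i)
       (tensor_map R (P i) N' id g)"

section \<open>Cyclic modules\<close>

definition cyclic_module :: "'a ring \<Rightarrow> 'a set \<Rightarrow> ('a, 'a set) module" where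
  "cyclic_module S I = quot_module (self_module S) I"

text \<open>For ideals \<open>I \<subseteq> J\<close>, the natural map from \<open>S/I\<close> to \<open>S/J\<close>.\<close>

definition natural_map :: "'a ring \<Rightarrow> 'a set \<Rightarrow> 'a set \<Rightarrow> 'a set" where
  "natural_map S J = quot_map (self_module S) J id"

definition residue_field_module ::
  "(nat multiset \<Rightarrow> 'k::field) ring \<Rightarrow> nat \<Rightarrow>
     (nat multiset \<Rightarrow> 'k, (nat multiset \<Rightarrow> 'k) set) module" where
  "residue_field_module S n = cyclic_module S (Idl\<^bsub>S\<^esub> (var ` {1..n}))"

end

theory Submission
  imports Defs
begin

text \<open>
  Write \<open>y\<^sub>r\<close> for the \<open>r\<close>-th variable in the order given by \<open>\<sigma>\<close> and \<open>D\<^sub>r\<close> for the corresponding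
  operator. On the Koszul complex of \<open>y\<^sub>1, \<dots>, y\<^sub>n\<close> over \<open>S\<close>, the additive (but not \<open>S\<close>-linear) map
  \<open>s (f e\<^sub>T) = (\<Sum>r < Min T. D\<^sub>r f e\<^sub>r \<and> e\<^sub>T)\<close> satisfies \<open>\<partial> s + s \<partial> = id\<close> in positive degrees, so the complex
  resolves the residue field. Since every \<open>D\<^sub>r\<close> maps \<open>I\<close> into \<open>J\<close>, a chain \<open>z\<close> with \<open>\<partial> z\<close> in \<open>I\<close> times the
  complex equals \<open>s (\<partial> z) + \<partial> (s z)\<close>, which is a boundary modulo \<open>J\<close>: cycles modulo \<open>I\<close> become
  boundaries modulo \<open>J\<close>. Comparison maps and a homotopy carry this over to an arbitrary free resolution.
\<close>

section \<open>Modules and quotients\<close>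

text \<open>What makes \<open>s\<close> a contraction is a telescope. If \<open>E t\<close> sets the
  variables before the \<open>t\<close>-th to zero, then \<open>y r\<close> times
  \<open>D r f\<close> is \<open>E r f - E (r+1) f\<close>, so the products with
  \<open>r < t\<close> add up to \<open>f - E t f\<close>. The missing \<open>E t f\<close> is
  exactly what \<open>D t\<close> returns on \<open>y t\<close> times \<open>f\<close>. The obstacle
  is that \<open>D r\<close> is not linear, so knowing it on generators of \<open>I\<close> does not
  settle it on \<open>I\<close>. It obeys the twisted Leibniz rule
  \<open>D r (b a) = E r b D r a + D r b E (r+1) a\<close>, and the last summand lies in
  \<open>J\<close> only if \<open>E (r+1) a\<close> does. That follows by descending from
  \<open>E (n+1) a\<close>, the constant term of \<open>a\<close>; its vanishing is where
  \<open>I\<close> has to be proper, and graded in the polynomial case. For the same reason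
  \<open>s\<close> cannot be moved to another resolution \<open>P\<close>. What moves is its
  consequence: a chain with boundary in \<open>I P\<close> lies in \<open>J P\<close> plus
  boundaries. This statement is stable under linear comparison maps and homotopies. It translates
  into Tor because every element of a tensor product with \<open>S/I\<close> has the form
  \<open>x\<close> tensor \<open>1\<close>, and this is zero exactly when \<open>x\<close> lies in
  \<open>I P\<close>.\<close>

lemma (in abelian_group) minus_self: "x \<in> carrier G \<Longrightarrow> x \<ominus> x = \<zero>"
  by (simp add: a_minus_def r_neg)

lemma (in abelian_group) minus_zero_right: "x \<in> carrier G \<Longrightarrow> x \<ominus> \<zero> = x"
  by (simp add: a_minus_def)

section \<open>Linear maps\<close>

lemma module_hom_closed: "f \<in> module_hom R M N \<Longrightarrow> x \<in> carrier M \<Longrightarrow> f x \<in> carrier N"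
  and module_hom_add: "f \<in> module_hom R M N \<Longrightarrow> x \<in> carrier M \<Longrightarrow> y \<in> carrier M \<Longrightarrow>
    f (x \<oplus>\<^bsub>M\<^esub> y) = f x \<oplus>\<^bsub>N\<^esub> f y"
  and module_hom_smult: "f \<in> module_hom R M N \<Longrightarrow> a \<in> carrier R \<Longrightarrow> x \<in> carrier M \<Longrightarrow>
    f (a \<odot>\<^bsub>M\<^esub> x) = a \<odot>\<^bsub>N\<^esub> f x"
  unfolding module_hom_def by auto

lemma module_homI:
  assumes "\<And>x. x \<in> carrier M \<Longrightarrow> f x \<in> carrier N"
    and "\<And>x y. x \<in> carrier M \<Longrightarrow> y \<in> carrier M \<Longrightarrow> f (x \<oplus>\<^bsub>M\<^esub> y) = f x \<oplus>\<^bsub>N\<^esub> f y"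
    and "\<And>a x. a \<in> carrier R \<Longrightarrow> x \<in> carrier M \<Longrightarrow> f (a \<odot>\<^bsub>M\<^esub> x) = a \<odot>\<^bsub>N\<^esub> f x"
  shows "f \<in> module_hom R M N"
  using assms unfolding module_hom_def by auto

lemma module_hom_compose:
  "f \<in> module_hom R M N \<Longrightarrow> g \<in> module_hom R N L \<Longrightarrow> (\<lambda>x. g (f x)) \<in> module_hom R M L"
  unfolding module_hom_def by (auto simp: Pi_iff)

lemma module_hom_id: "(\<lambda>x. x) \<in> module_hom R M M"
  unfolding module_hom_def by auto

lemma module_hom_zero:
  assumes "module R M" "module R N" "f \<in> module_hom R M N"
  shows "f \<zero>\<^bsub>M\<^esub> = \<zero>\<^bsub>N\<^esub>"
proof -
  interpret M: module R M by fact
  interpret N: module R N by fact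
  have "f (\<zero>\<^bsub>R\<^esub> \<odot>\<^bsub>M\<^esub> \<zero>\<^bsub>M\<^esub>) = \<zero>\<^bsub>R\<^esub> \<odot>\<^bsub>N\<^esub> f \<zero>\<^bsub>M\<^esub>"
    using module_hom_smult[OF assms(3) M.R.zero_closed M.M.zero_closed] .
  then show ?thesis
    using module_hom_closed[OF assms(3)] by simp
qed

lemma module_hom_a_inv:
  assumes "module R M" "module R N" "f \<in> module_hom R M N" "x \<in> carrier M"
  shows "f (\<ominus>\<^bsub>M\<^esub> x) = \<ominus>\<^bsub>N\<^esub> f x"
proof -
  interpret M: module R M by fact
  interpret N: module R N by fact
  have "f (\<ominus>\<^bsub>M\<^esub> x) \<oplus>\<^bsub>N\<^esub> f x = f (\<ominus>\<^bsub>M\<^esub> x \<oplus>\<^bsub>M\<^esub> x)"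
    using module_hom_add[OF assms(3)] assms(4) by simp
  also have "\<dots> = \<zero>\<^bsub>N\<^esub>"
    using assms(4) module_hom_zero[OF assms(1-3)] by (simp add: M.M.l_neg)
  finally show ?thesis
    using module_hom_closed[OF assms(3)] assms(4) by (simp add: N.M.minus_equality)
qed

lemma module_hom_minus:
  assumes "module R M" "module R N" "f \<in> module_hom R M N" "x \<in> carrier M" "y \<in> carrier M"
  shows "f (x \<ominus>\<^bsub>M\<^esub> y) = f x \<ominus>\<^bsub>N\<^esub> f y"
proof -
  interpret M: module R M by fact
  show ?thesis
    using assms module_hom_add[OF assms(3)] module_hom_a_inv[OF assms(1-3)]
    by (simp add: a_minus_def)
qed

lemma module_hom_finsum:
  assumes "module R M" "module R N" "f \<in> module_hom R M N" "g \<in> A \<rightarrow> carrier M"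
  shows "f (\<Oplus>\<^bsub>M\<^esub>x\<in>A. g x) = (\<Oplus>\<^bsub>N\<^esub>x\<in>A. f (g x))"
proof -
  interpret M: module R M by fact
  interpret N: module R N by fact
  note hom = module_hom_closed[OF assms(3)] module_hom_add[OF assms(3)]
  show ?thesis
    using assms(4)
  proof (induction A rule: infinite_finite_induct)
    case (infinite A)
    then show ?case by (simp add: module_hom_zero[OF assms(1-3)])
  next
    case empty
    then show ?case by (simp add: module_hom_zero[OF assms(1-3)])
  next
    case (insert x A)
    then show ?case by (simp add: Pi_iff hom M.M.finsum_closed)
  qed
qed

section \<open>Submodules\<close>

lemma (in module) submodule_iff:
  "submodule H R M \<longleftrightarrow>
     H \<subseteq> carrier M \<and> \<zero>\<^bsub>M\<^esub> \<in> H \<and> (\<forall>x\<in>H. \<forall>y\<in>H. x \<oplus>\<^bsub>M\<^esub> y \<in> H) \<and>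
     (\<forall>a\<in>carrier R. \<forall>x\<in>H. a \<odot>\<^bsub>M\<^esub> x \<in> H)"
  (is "_ \<longleftrightarrow> ?r")
proof
  assume "submodule H R M"
  then show ?r
    using submoduleE[of H] submodule.axioms(1)[of H R M] subgroup.one_closed[of H "add_monoid M"]
    by auto
next
  assume r: ?r
  show "submodule H R M"
  proof (rule submoduleI)
    fix x assume "x \<in> H"
    \<comment> \<open>Negation is multiplication by the scalar -1, so closure under scalars supplies
      it.\<close>
    then have "\<ominus>\<^bsub>M\<^esub> x = (\<ominus> \<one>) \<odot>\<^bsub>M\<^esub> x"
      using r by (subst smult_l_minus) auto
    then show "\<ominus>\<^bsub>M\<^esub> x \<in> H"
      using r \<open>x \<in> H\<close> by simp
  qed (use r in auto)
qed

lemma (in module) submodule_zero: "submodule {\<zero>\<^bsub>M\<^esub>} R M"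
  unfolding submodule_iff by auto

lemma submodule_image:
  assumes "module R M" "module R N" "f \<in> module_hom R M N"
  shows "submodule (f ` carrier M) R N"
proof -
  interpret M: module R M by fact
  interpret N: module R N by fact
  show ?thesis
    unfolding N.submodule_iff
  proof (intro conjI ballI)
    show "f ` carrier M \<subseteq> carrier N"
      using module_hom_closed[OF assms(3)] by auto
    show "\<zero>\<^bsub>N\<^esub> \<in> f ` carrier M"
      using module_hom_zero[OF assms] by (metis M.M.zero_closed imageI)
    show "x \<oplus>\<^bsub>N\<^esub> y \<in> f ` carrier M" if "x \<in> f ` carrier M" "y \<in> f ` carrier M" for x y
      using that by (auto simp flip: module_hom_add[OF assms(3)])
    show "a \<odot>\<^bsub>N\<^esub> x \<in> f ` carrier M" if "a \<in> carrier R" "x \<in> f ` carrier M" for a x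
      using that by (auto simp flip: module_hom_smult[OF assms(3)])
  qed
qed

lemma submodule_vimage:
  assumes "module R M" "module R N" "f \<in> module_hom R M N" "submodule H R N"
  shows "submodule {x \<in> carrier M. f x \<in> H} R M"
proof -
  interpret M: module R M by fact
  interpret N: module R N by fact
  show ?thesis
    using assms(4) module_hom_zero[OF assms(1-3)] module_hom_add[OF assms(3)]
      module_hom_smult[OF assms(3)]
    unfolding N.submodule_iff M.submodule_iff by auto
qed

lemma submodule_submodule_span:
  assumes "module R M" "X \<subseteq> carrier M"
  shows "submodule (submodule_span R M X) R M"
proof -
  interpret M: module R M by fact
  let ?C = "{H. submodule H R M \<and> X \<subseteq> H}"
  \<comment> \<open>The family must have a member inside \<open>carrier M\<close>; an empty
    intersection would be the whole type.\<close>
  have "carrier M \<in> ?C"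
    using M.carrier_is_submodule assms(2) by simp
  then have "\<Inter>?C \<subseteq> carrier M"
    by blast
  then show ?thesis
    unfolding submodule_span_def M.submodule_iff[of "\<Inter>?C"] by (auto simp: M.submodule_iff)
qed

lemma submodule_span_superset: "X \<subseteq> submodule_span R M X"
  unfolding submodule_span_def by blast

lemma submodule_span_minimal: "submodule H R M \<Longrightarrow> X \<subseteq> H \<Longrightarrow> submodule_span R M X \<subseteq> H"
  unfolding submodule_span_def by blast

lemma submodule_abelian_subgroup:
  assumes "module R M" "submodule H R M"
  shows "abelian_subgroup H M"
proof -
  interpret M: module R M by fact
  show ?thesis
    using assms(2) by (intro abelian_subgroupI3 additive_subgroupI submodule.axioms(1)
      M.M.abelian_group_axioms)
qed

section \<open>Cosets, quotient modules and induced maps\<close>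

lemma coset_eq_iff:
  assumes "module R M" "submodule H R M" "x \<in> carrier M" "y \<in> carrier M"
  shows "H +>\<^bsub>M\<^esub> x = H +>\<^bsub>M\<^esub> y \<longleftrightarrow> x \<ominus>\<^bsub>M\<^esub> y \<in> H"
proof -
  interpret M: module R M by fact
  interpret H: abelian_subgroup H M
    using submodule_abelian_subgroup[OF assms(1,2)] .
  show ?thesis
    using H.a_rcos_module[OF assms(4,3)] H.a_repr_independence'[OF _ assms(4)]
      H.a_rcos_self[OF assms(3)] unfolding a_minus_def by auto
qed

lemma coset_eq_self_iff:
  assumes "module R M" "submodule H R M" "x \<in> carrier M"
  shows "H +>\<^bsub>M\<^esub> x = H \<longleftrightarrow> x \<in> H"
proof -
  interpret M: module R M by fact
  interpret H: abelian_subgroup H M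
    using submodule_abelian_subgroup[OF assms(1,2)] .
  show ?thesis
    using H.a_rcos_const H.a_rcos_self[OF assms(3)] by auto
qed

lemma quot_module_sel [simp]:
  "zero (quot_module M H) = H"
  "add (quot_module M H) = set_add M"
  "carrier (quot_module M H) = (\<lambda>x. H +>\<^bsub>M\<^esub> x) ` carrier M"
  by (auto simp: quot_module_def A_RCOSETS_def')

text \<open>Scalar multiplication on the quotient is a union over all representatives. Any two of
  them differ by an element of \<open>H\<close>, and so do their multiples, hence the union is over
  a single coset.\<close>

lemma quot_module_smult:
  assumes "module R M" "submodule H R M" "a \<in> carrier R" "x \<in> carrier M"
  shows "a \<odot>\<^bsub>quot_module M H\<^esub> (H +>\<^bsub>M\<^esub> x) = H +>\<^bsub>M\<^esub> (a \<odot>\<^bsub>M\<^esub> x)"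
proof -
  interpret M: module R M by fact
  interpret H: abelian_subgroup H M
    using submodule_abelian_subgroup[OF assms(1,2)] .
  have "H +>\<^bsub>M\<^esub> (a \<odot>\<^bsub>M\<^esub> y) = H +>\<^bsub>M\<^esub> (a \<odot>\<^bsub>M\<^esub> x)" if y: "y \<in> H +>\<^bsub>M\<^esub> x" for y
  proof -
    have yc: "y \<in> carrier M"
      using H.a_elemrcos_carrier[OF assms(4) y] .
    have "y \<ominus>\<^bsub>M\<^esub> x \<in> H"
      using H.a_rcos_module[OF assms(4) yc] y unfolding a_minus_def by simp
    then have "a \<odot>\<^bsub>M\<^esub> (y \<ominus>\<^bsub>M\<^esub> x) \<in> H"
      using assms(2,3) M.submodule_iff by auto
    then have "a \<odot>\<^bsub>M\<^esub> y \<ominus>\<^bsub>M\<^esub> a \<odot>\<^bsub>M\<^esub> x \<in> H"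
      using assms(3,4) yc by (simp add: a_minus_def M.smult_r_distr M.smult_r_minus)
    then show ?thesis
      using coset_eq_iff[OF assms(1,2)] assms(3,4) yc by simp
  qed
  moreover have "x \<in> H +>\<^bsub>M\<^esub> x"
    using H.a_rcos_self[OF assms(4)] .
  ultimately have "(\<Union>y\<in>H +>\<^bsub>M\<^esub> x. H +>\<^bsub>M\<^esub> (a \<odot>\<^bsub>M\<^esub> y)) = H +>\<^bsub>M\<^esub> (a \<odot>\<^bsub>M\<^esub> x)"
    by blast
  then show ?thesis
    by (simp add: quot_module_def)
qed

lemma module_quot_module:
  assumes "module R M" "submodule H R M"
  shows "module R (quot_module M H)"
proof -
  interpret M: module R M by fact
  interpret H: abelian_subgroup H M
    using submodule_abelian_subgroup[OF assms] .
  note sum = H.a_rcos_sum and sm = quot_module_smult[OF assms]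
  have zero: "H +>\<^bsub>M\<^esub> \<zero>\<^bsub>M\<^esub> = H"
    using H.a_rcos_const[OF H.zero_closed] .
  show ?thesis
  proof (rule moduleI)
    show "abelian_group (quot_module M H)"
    proof (rule abelian_groupI)
      show "\<zero>\<^bsub>quot_module M H\<^esub> \<in> carrier (quot_module M H)"
        using zero by auto
      fix X assume X: "X \<in> carrier (quot_module M H)"
      then obtain x where x: "x \<in> carrier M" "X = H +>\<^bsub>M\<^esub> x" by auto
      show "\<zero>\<^bsub>quot_module M H\<^esub> \<oplus>\<^bsub>quot_module M H\<^esub> X = X"
        using sum[OF M.M.zero_closed x(1)] x zero by simp
      have "(H +>\<^bsub>M\<^esub> (\<ominus>\<^bsub>M\<^esub> x)) \<oplus>\<^bsub>quot_module M H\<^esub> X = \<zero>\<^bsub>quot_module M H\<^esub>"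
        using x sum zero by (simp add: M.M.l_neg)
      then show "\<exists>Y\<in>carrier (quot_module M H). Y \<oplus>\<^bsub>quot_module M H\<^esub> X = \<zero>\<^bsub>quot_module M H\<^esub>"
        using x by auto
    qed (auto simp: sum M.M.a_ac)
  qed (auto simp: sum sm M.smult_l_distr M.smult_r_distr M.smult_assoc1 intro: M.R.cring_axioms)
qed

lemma coset_map_hom:
  assumes "module R M" "submodule H R M"
  shows "(\<lambda>x. H +>\<^bsub>M\<^esub> x) \<in> module_hom R M (quot_module M H)"
proof -
  interpret M: module R M by fact
  interpret H: abelian_subgroup H M
    using submodule_abelian_subgroup[OF assms] .
  show ?thesis
    by (rule module_homI) (auto simp: H.a_rcos_sum quot_module_smult[OF assms])
qed

text \<open>\<open>quot_map\<close> takes \<open>the_elem\<close> of an image and has a meaning only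
  if that image is a singleton. Sending \<open>H\<close> into \<open>K\<close> guarantees it,
  because the values at two representatives then differ by an element of \<open>K\<close>.\<close>

lemma quot_map_coset:
  assumes "module R M" "submodule H R M" "module R N" "submodule K R N"
    and "\<phi> \<in> module_hom R M N" "\<And>x. x \<in> H \<Longrightarrow> \<phi> x \<in> K" "x \<in> carrier M"
  shows "quot_map N K \<phi> (H +>\<^bsub>M\<^esub> x) = K +>\<^bsub>N\<^esub> \<phi> x"
proof -
  interpret M: module R M by fact
  interpret N: module R N by fact
  interpret H: abelian_subgroup H M
    using submodule_abelian_subgroup[OF assms(1,2)] .
  have "K +>\<^bsub>N\<^esub> \<phi> y = K +>\<^bsub>N\<^esub> \<phi> x" if y: "y \<in> H +>\<^bsub>M\<^esub> x" for y
  proof -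
    have yc: "y \<in> carrier M"
      using H.a_elemrcos_carrier[OF assms(7) y] .
    have "y \<ominus>\<^bsub>M\<^esub> x \<in> H"
      using H.a_rcos_module[OF assms(7) yc] y unfolding a_minus_def by simp
    then have "\<phi> y \<ominus>\<^bsub>N\<^esub> \<phi> x \<in> K"
      using assms(6)[of "y \<ominus>\<^bsub>M\<^esub> x"] module_hom_minus[OF assms(1,3,5) yc assms(7)] by simp
    then show ?thesis
      using coset_eq_iff[OF assms(3,4)] module_hom_closed[OF assms(5)] yc assms(7) by simp
  qed
  moreover have "x \<in> H +>\<^bsub>M\<^esub> x"
    using H.a_rcos_self[OF assms(7)] .
  ultimately have "(\<lambda>y. K +>\<^bsub>N\<^esub> \<phi> y) ` (H +>\<^bsub>M\<^esub> x) = {K +>\<^bsub>N\<^esub> \<phi> x}"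
    by blast
  then show ?thesis
    by (simp add: quot_map_def)
qed

lemma quot_map_hom:
  assumes "module R M" "submodule H R M" "module R N" "submodule K R N"
    and "\<phi> \<in> module_hom R M N" "\<And>x. x \<in> H \<Longrightarrow> \<phi> x \<in> K"
  shows "quot_map N K \<phi> \<in> module_hom R (quot_module M H) (quot_module N K)"
proof -
  interpret M: module R M by fact
  interpret N: module R N by fact
  interpret H: abelian_subgroup H M
    using submodule_abelian_subgroup[OF assms(1,2)] .
  interpret K: abelian_subgroup K N
    using submodule_abelian_subgroup[OF assms(3,4)] .
  note c = quot_map_coset[OF assms]
  show ?thesis
    by (rule module_homI)
       (auto simp: c H.a_rcos_sum K.a_rcos_sum module_hom_add[OF assms(5)] module_hom_closed[OF assms(5)]
         quot_module_smult[OF assms(1,2)] quot_module_smult[OF assms(3,4)] module_hom_smult[OF assms(5)])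
qed

lemma module_self_module:
  assumes "cring R"
  shows "module R (self_module R)"
proof -
  interpret R: cring R by fact
  have "abelian_group (self_module R)"
    by (rule abelian_groupI)
       (auto simp: self_module_def R.a_ac intro: bexI[of _ "\<ominus>\<^bsub>R\<^esub> x" for x] R.l_neg)
  then show ?thesis
    by (intro moduleI) (auto simp: self_module_def R.l_distr R.r_distr R.m_assoc assms)
qed

lemma submodule_self_module:
  assumes "cring R" "ideal I R"
  shows "submodule I R (self_module R)"
proof -
  interpret R: cring R by fact
  interpret I: ideal I R by fact
  interpret M: module R "self_module R" by (rule module_self_module) fact
  show ?thesis
    unfolding M.submodule_iff by (auto simp: self_module_def I.I_l_closed I.a_closed)
qed

section \<open>Free modules\<close>

lemma free_module_sel [simp]:
  "zero (free_module R X) = (\<lambda>x. \<zero>\<^bsub>R\<^esub>)"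
  "u \<oplus>\<^bsub>free_module R X\<^esub> v = (\<lambda>x. u x \<oplus>\<^bsub>R\<^esub> v x)"
  "a \<odot>\<^bsub>free_module R X\<^esub> u = (\<lambda>x. a \<otimes>\<^bsub>R\<^esub> u x)"
  by (auto simp: free_module_def)

lemma mem_free_module:
  "u \<in> carrier (free_module R X) \<longleftrightarrow>
     (\<forall>x. u x \<in> carrier R) \<and> finite {x. u x \<noteq> \<zero>\<^bsub>R\<^esub>} \<and> {x. u x \<noteq> \<zero>\<^bsub>R\<^esub>} \<subseteq> X"
  by (auto simp: free_module_def)

lemma free_module_outside: "u \<in> carrier (free_module R X) \<Longrightarrow> x \<notin> X \<Longrightarrow> u x = \<zero>\<^bsub>R\<^esub>"
  unfolding mem_free_module by auto

lemma module_free_module: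
  assumes "cring R"
  shows "module R (free_module R X)"
proof -
  interpret R: cring R by fact
  have add: "(\<lambda>x. u x \<oplus>\<^bsub>R\<^esub> v x) \<in> carrier (free_module R X)"
    if "u \<in> carrier (free_module R X)" "v \<in> carrier (free_module R X)" for u v
  proof -
    have "{x. u x \<oplus>\<^bsub>R\<^esub> v x \<noteq> \<zero>\<^bsub>R\<^esub>} \<subseteq> {x. u x \<noteq> \<zero>\<^bsub>R\<^esub>} \<union> {x. v x \<noteq> \<zero>\<^bsub>R\<^esub>}"
      by auto
    then show ?thesis
      using that unfolding mem_free_module by (auto intro: finite_subset)
  qed
  have smult: "(\<lambda>x. a \<otimes>\<^bsub>R\<^esub> u x) \<in> carrier (free_module R X)"
    if "u \<in> carrier (free_module R X)" "a \<in> carrier R" for u a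
  proof -
    have "{x. a \<otimes>\<^bsub>R\<^esub> u x \<noteq> \<zero>\<^bsub>R\<^esub>} \<subseteq> {x. u x \<noteq> \<zero>\<^bsub>R\<^esub>}"
      using that by auto
    then show ?thesis
      using that unfolding mem_free_module by (auto intro: finite_subset)
  qed
  have neg: "(\<lambda>x. \<ominus>\<^bsub>R\<^esub> u x) \<in> carrier (free_module R X)"
    if "u \<in> carrier (free_module R X)" for u
  proof -
    have "{x. \<ominus>\<^bsub>R\<^esub> u x \<noteq> \<zero>\<^bsub>R\<^esub>} \<subseteq> {x. u x \<noteq> \<zero>\<^bsub>R\<^esub>}"
      by auto
    then show ?thesis
      using that unfolding mem_free_module by (auto intro: finite_subset)
  qed
  have "abelian_group (free_module R X)"
  proof (rule abelian_groupI)
    fix u assume u: "u \<in> carrier (free_module R X)"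
    then show "\<exists>v\<in>carrier (free_module R X). v \<oplus>\<^bsub>free_module R X\<^esub> u = \<zero>\<^bsub>free_module R X\<^esub>"
      by (intro bexI[OF _ neg[OF u]]) (auto simp: mem_free_module R.l_neg)
  qed (use add in \<open>auto simp: mem_free_module R.a_ac\<close>)
  then show ?thesis
    by (intro moduleI)
       (use smult in \<open>auto simp: assms mem_free_module R.l_distr R.r_distr R.m_assoc\<close>)
qed

lemma unit_vec_closed:
  assumes "cring R" "x \<in> X"
  shows "unit_vec R x \<in> carrier (free_module R X)"
proof -
  interpret R: cring R by fact
  have "{y. unit_vec R x y \<noteq> \<zero>\<^bsub>R\<^esub>} \<subseteq> {x}"
    by (auto simp: unit_vec_def)
  then show ?thesis
    using assms(2) unfolding mem_free_module by (auto simp: unit_vec_def intro: finite_subset)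
qed

lemma finsum_free_module:
  assumes "cring R" "f \<in> A \<rightarrow> carrier (free_module R X)"
  shows "(\<Oplus>\<^bsub>free_module R X\<^esub>a\<in>A. f a) y = (\<Oplus>\<^bsub>R\<^esub>a\<in>A. f a y)"
proof -
  interpret R: cring R by fact
  interpret F: module R "free_module R X" by (rule module_free_module) fact
  show ?thesis
    using assms(2)
  proof (induction A rule: infinite_finite_induct)
    case (insert a A)
    then show ?case
      by (simp add: Pi_iff mem_free_module F.M.finsum_insert)
  qed auto
qed

text \<open>The sum in \<open>lin_ext\<close> runs over the support of \<open>u\<close> and so
  changes its index set with \<open>u\<close>. A common finite index set is what comparing
  \<open>u\<close>, \<open>v\<close> and their sum requires.\<close>

lemma lin_ext_superset:
  assumes "module R M" "\<phi> \<in> A \<rightarrow> carrier M" "finite A" "\<And>x. x \<in> A \<Longrightarrow> u x \<in> carrier R"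
    and "{x. u x \<noteq> \<zero>\<^bsub>R\<^esub>} \<subseteq> A"
  shows "lin_ext R M \<phi> u = (\<Oplus>\<^bsub>M\<^esub>x\<in>A. u x \<odot>\<^bsub>M\<^esub> \<phi> x)"
proof -
  interpret M: module R M by fact
  have "(\<Oplus>\<^bsub>M\<^esub>x\<in>A. u x \<odot>\<^bsub>M\<^esub> \<phi> x) = (\<Oplus>\<^bsub>M\<^esub>x\<in>{x. u x \<noteq> \<zero>\<^bsub>R\<^esub>}. u x \<odot>\<^bsub>M\<^esub> \<phi> x)"
    using assms by (intro M.M.add.finprod_mono_neutral_cong_left[symmetric]) (auto simp: Pi_iff)
  then show ?thesis
    by (simp add: lin_ext_def)
qed

lemma lin_ext_hom:
  assumes "module R M" "\<phi> \<in> X \<rightarrow> carrier M"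
  shows "lin_ext R M \<phi> \<in> module_hom R (free_module R X) M"
proof -
  interpret M: module R M by fact
  have cr: "cring R" by (rule M.R.cring_axioms)
  interpret F: module R "free_module R X" by (rule module_free_module) fact
  have ext: "lin_ext R M \<phi> u = (\<Oplus>\<^bsub>M\<^esub>x\<in>A. u x \<odot>\<^bsub>M\<^esub> \<phi> x)"
    if "u \<in> carrier (free_module R X)" "finite A" "{x. u x \<noteq> \<zero>\<^bsub>R\<^esub>} \<subseteq> A" "A \<subseteq> X" for u A
    using that assms by (intro lin_ext_superset) (auto simp: mem_free_module)
  show ?thesis
  proof (rule module_homI)
    fix u assume u: "u \<in> carrier (free_module R X)"
    then show "lin_ext R M \<phi> u \<in> carrier M"
      unfolding lin_ext_def using assms by (intro M.M.finsum_closed) (auto simp: mem_free_module)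
    fix a assume a: "a \<in> carrier R"
    let ?A = "{x. u x \<noteq> \<zero>\<^bsub>R\<^esub>}"
    have "lin_ext R M \<phi> (a \<odot>\<^bsub>free_module R X\<^esub> u)
        = (\<Oplus>\<^bsub>M\<^esub>x\<in>?A. (a \<otimes>\<^bsub>R\<^esub> u x) \<odot>\<^bsub>M\<^esub> \<phi> x)"
      using u a F.smult_closed[OF a u] by (subst ext[where A = ?A]) (auto simp: mem_free_module)
    also have "\<dots> = (\<Oplus>\<^bsub>M\<^esub>x\<in>?A. a \<odot>\<^bsub>M\<^esub> (u x \<odot>\<^bsub>M\<^esub> \<phi> x))"
      using u a assms(2)
      by (intro M.M.finsum_cong') (auto simp: mem_free_module Pi_iff subset_iff intro!: M.smult_assoc1)
    also have "\<dots> = a \<odot>\<^bsub>M\<^esub> lin_ext R M \<phi> u"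
      unfolding lin_ext_def
      using u a assms(2) by (intro M.finsum_smult_ldistr[symmetric]) (auto simp: mem_free_module)
    finally show "lin_ext R M \<phi> (a \<odot>\<^bsub>free_module R X\<^esub> u) = a \<odot>\<^bsub>M\<^esub> lin_ext R M \<phi> u" .
  next
    fix u v assume u: "u \<in> carrier (free_module R X)" and v: "v \<in> carrier (free_module R X)"
    let ?A = "{x. u x \<noteq> \<zero>\<^bsub>R\<^esub>} \<union> {x. v x \<noteq> \<zero>\<^bsub>R\<^esub>}"
    have "lin_ext R M \<phi> (u \<oplus>\<^bsub>free_module R X\<^esub> v) = (\<Oplus>\<^bsub>M\<^esub>x\<in>?A. (u x \<oplus>\<^bsub>R\<^esub> v x) \<odot>\<^bsub>M\<^esub> \<phi> x)"
      using u v F.M.a_closed[OF u v] by (subst ext[where A = ?A]) (auto simp: mem_free_module)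
    also have "\<dots> = (\<Oplus>\<^bsub>M\<^esub>x\<in>?A. u x \<odot>\<^bsub>M\<^esub> \<phi> x \<oplus>\<^bsub>M\<^esub> v x \<odot>\<^bsub>M\<^esub> \<phi> x)"
      using u v assms(2)
      by (intro M.M.finsum_cong') (auto simp: mem_free_module Pi_iff subset_iff intro!: M.smult_l_distr)
    also have "\<dots> = (\<Oplus>\<^bsub>M\<^esub>x\<in>?A. u x \<odot>\<^bsub>M\<^esub> \<phi> x) \<oplus>\<^bsub>M\<^esub> (\<Oplus>\<^bsub>M\<^esub>x\<in>?A. v x \<odot>\<^bsub>M\<^esub> \<phi> x)"
      using u v assms(2)
      by (intro M.M.finsum_addf) (auto simp: mem_free_module Pi_iff subset_iff)
    also have "\<dots> = lin_ext R M \<phi> u \<oplus>\<^bsub>M\<^esub> lin_ext R M \<phi> v"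
      using u v ext[OF u, of ?A] ext[OF v, of ?A] by (simp add: mem_free_module)
    finally show "lin_ext R M \<phi> (u \<oplus>\<^bsub>free_module R X\<^esub> v) = lin_ext R M \<phi> u \<oplus>\<^bsub>M\<^esub> lin_ext R M \<phi> v" .
  qed
qed

lemma lin_ext_unit_vec:
  assumes "module R M" "\<phi> x \<in> carrier M"
  shows "lin_ext R M \<phi> (unit_vec R x) = \<phi> x"
proof -
  interpret M: module R M by fact
  have "lin_ext R M \<phi> (unit_vec R x) = (\<Oplus>\<^bsub>M\<^esub>y\<in>{x}. unit_vec R x y \<odot>\<^bsub>M\<^esub> \<phi> y)"
    using assms by (intro lin_ext_superset) (auto simp: unit_vec_def)
  also have "\<dots> = \<phi> x"
    using assms by (simp add: unit_vec_def)
  finally show ?thesis .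
qed

lemma lin_ext_unit_vec_self:
  assumes "cring R" "u \<in> carrier (free_module R X)"
  shows "lin_ext R (free_module R X) (unit_vec R) u = u"
proof
  fix y
  interpret R: cring R by fact
  interpret F: module R "free_module R X" by (rule module_free_module) fact
  \<comment> \<open>Adding \<open>y\<close> to the support ensures that the \<open>y\<close>-th term
    occurs even when \<open>u y\<close> vanishes.\<close>
  let ?A = "insert y {x. u x \<noteq> \<zero>\<^bsub>R\<^esub>}"
  have u: "u x \<in> carrier R" "finite ?A" for x
    using assms(2) by (auto simp: mem_free_module)
  show "lin_ext R (free_module R X) (unit_vec R) u y = u y"
  proof (cases "y \<in> X")
    case True
    have AX: "?A \<subseteq> X"
      using assms(2) True by (auto simp: mem_free_module)
    have U: "unit_vec R x \<in> carrier (free_module R X)" if "x \<in> ?A" for x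
      using that AX by (intro unit_vec_closed[OF assms(1)]) (rule subsetD)
    have "lin_ext R (free_module R X) (unit_vec R) u
        = (\<Oplus>\<^bsub>free_module R X\<^esub>x\<in>?A. u x \<odot>\<^bsub>free_module R X\<^esub> unit_vec R x)"
      using u U by (intro lin_ext_superset F.module_axioms) auto
    from fun_cong[OF this, of y] have "lin_ext R (free_module R X) (unit_vec R) u y
        = (\<Oplus>\<^bsub>free_module R X\<^esub>x\<in>?A. u x \<odot>\<^bsub>free_module R X\<^esub> unit_vec R x) y" .
    also have "\<dots> = (\<Oplus>\<^bsub>R\<^esub>x\<in>?A. (u x \<odot>\<^bsub>free_module R X\<^esub> unit_vec R x) y)"
      by (intro finsum_free_module assms(1) Pi_I F.smult_closed u U)
    also have "\<dots> = (\<Oplus>\<^bsub>R\<^esub>x\<in>?A. if y = x then u x else \<zero>\<^bsub>R\<^esub>)"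
      using u by (intro R.finsum_cong') (auto simp: unit_vec_def)
    also have "\<dots> = u y"
      using u by (subst R.add.finprod_singleton) auto
    finally show ?thesis .
  next
    case False
    have "lin_ext R (free_module R X) (unit_vec R) u \<in> carrier (free_module R X)"
      by (rule module_hom_closed[OF lin_ext_hom[OF F.module_axioms] assms(2)])
         (use unit_vec_closed[OF assms(1)] in auto)
    from free_module_outside[OF this False] free_module_outside[OF assms(2) False]
    show ?thesis
      by simp
  qed
qed

lemma module_hom_lin_ext:
  assumes "module R M" "module R N" "f \<in> module_hom R M N"
    and "u \<in> carrier (free_module R X)" "\<phi> \<in> X \<rightarrow> carrier M"
  shows "f (lin_ext R M \<phi> u) = lin_ext R N (\<lambda>x. f (\<phi> x)) u"
proof -
  interpret M: module R M by fact
  interpret N: module R N by fact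
  have "u x \<odot>\<^bsub>M\<^esub> \<phi> x \<in> carrier M" if "u x \<noteq> \<zero>\<^bsub>R\<^esub>" for x
    using that assms(4,5) by (auto simp: mem_free_module)
  then have "f (lin_ext R M \<phi> u) = (\<Oplus>\<^bsub>N\<^esub>x\<in>{x. u x \<noteq> \<zero>\<^bsub>R\<^esub>}. f (u x \<odot>\<^bsub>M\<^esub> \<phi> x))"
    unfolding lin_ext_def by (intro module_hom_finsum[OF assms(1-3)]) auto
  also have "\<dots> = lin_ext R N (\<lambda>x. f (\<phi> x)) u"
    unfolding lin_ext_def
    using assms(4,5) module_hom_closed[OF assms(3)] module_hom_smult[OF assms(3)]
    by (intro N.M.finsum_cong') (auto simp: mem_free_module Pi_iff subset_iff)
  finally show ?thesis .
qed

lemma free_module_hom_eqI: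
  assumes "module R M" "f \<in> module_hom R (free_module R X) M" "u \<in> carrier (free_module R X)"
  shows "f u = lin_ext R M (\<lambda>x. f (unit_vec R x)) u"
proof -
  interpret M: module R M by fact
  have F: "module R (free_module R X)"
    by (rule module_free_module) (rule M.R.cring_axioms)
  have "f (lin_ext R (free_module R X) (unit_vec R) u) = lin_ext R M (\<lambda>x. f (unit_vec R x)) u"
    by (rule module_hom_lin_ext[OF F assms(1-3)]) (use unit_vec_closed M.R.cring_axioms in auto)
  then show ?thesis
    using lin_ext_unit_vec_self[OF M.R.cring_axioms assms(3)] by simp
qed

text \<open>\<open>is_free\<close> wants a basis inside the module itself, so the index set
  \<open>X\<close> is replaced by the set of unit vectors, and coefficient functions are reindexed
  along \<open>unit_vec R\<close>.\<close>

lemma is_free_free_module: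
  fixes X :: "'c set"
  assumes "cring R"
  shows "is_free R (free_module R X)"
proof -
  interpret R: cring R by fact
  let ?F = "free_module R X" and ?B = "unit_vec R ` X"
  have F: "module R ?F" by (rule module_free_module) fact
  have B: "?B \<subseteq> carrier ?F" using unit_vec_closed[OF assms] by auto
  show ?thesis
  \<comment> \<open>Over the zero ring all unit vectors coincide and the reindexing is not
    injective; there every free module is a single point.\<close>
  proof (cases "\<one>\<^bsub>R\<^esub> = \<zero>\<^bsub>R\<^esub>")
    case True
    then have "carrier R = {\<zero>\<^bsub>R\<^esub>}" by (simp add: R.one_zeroD)
    then have triv: "carrier (free_module R Y) = {\<lambda>x. \<zero>\<^bsub>R\<^esub>}" for Y :: "'z set"
      by (auto simp: mem_free_module)
    have "lin_ext R ?F id (\<lambda>x. \<zero>\<^bsub>R\<^esub>) = (\<lambda>x. \<zero>\<^bsub>R\<^esub>)"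
      by (simp add: lin_ext_def abelian_monoid.finsum_empty module.axioms[OF F]
        abelian_group.axioms)
    then have "bij_betw (lin_ext R ?F id) (carrier (free_module R ?B)) (carrier ?F)"
      unfolding triv by (simp add: bij_betw_def)
    then show ?thesis
      unfolding is_free_def using F B by blast
  next
    case False
    then have inj: "unit_vec R x = unit_vec R y \<longleftrightarrow> x = y" for x y :: 'c
      by (auto simp: unit_vec_def fun_eq_iff)
    \<comment> \<open>The inverse of the linear extension: the coefficient at the unit vector of
      \<open>x\<close> is \<open>u x\<close>.\<close>
    define g where "g u = (\<lambda>b. if b \<in> ?B then u (THE x. b = unit_vec R x) else \<zero>\<^bsub>R\<^esub>)" for u
    have g: "g u (unit_vec R x) = u x" if "u \<in> carrier ?F" for u x
      using free_module_outside[OF that, of x] inj by (auto simp: g_def image_iff)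
    have gF: "g u \<in> carrier (free_module R ?B)" if u: "u \<in> carrier ?F" for u
    proof -
      have supp: "{b. g u b \<noteq> \<zero>\<^bsub>R\<^esub>} \<subseteq> unit_vec R ` {x. u x \<noteq> \<zero>\<^bsub>R\<^esub>}"
      proof
        fix b assume b: "b \<in> {b. g u b \<noteq> \<zero>\<^bsub>R\<^esub>}"
        then obtain x where "b = unit_vec R x"
          by (auto simp: g_def split: if_splits)
        then show "b \<in> unit_vec R ` {x. u x \<noteq> \<zero>\<^bsub>R\<^esub>}"
          using b g[OF u] by simp
      qed
      moreover have "finite (unit_vec R ` {x. u x \<noteq> \<zero>\<^bsub>R\<^esub>})"
        and "unit_vec R ` {x. u x \<noteq> \<zero>\<^bsub>R\<^esub>} \<subseteq> ?B"
        using u by (auto simp: mem_free_module)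
      moreover have "g u b \<in> carrier R" for b
        using u by (simp add: g_def mem_free_module)
      ultimately show ?thesis
        unfolding mem_free_module by (meson finite_subset subset_trans)
    qed
    have w_supp: "{x. w (unit_vec R x) \<noteq> \<zero>\<^bsub>R\<^esub>} = unit_vec R -` {b. w b \<noteq> \<zero>\<^bsub>R\<^esub>}" for w
      by auto
    have val: "lin_ext R ?F id w = (\<lambda>x. w (unit_vec R x))" if w: "w \<in> carrier (free_module R ?B)" for w
    proof -
      let ?u = "\<lambda>x. w (unit_vec R x)"
      have supp: "{b. w b \<noteq> \<zero>\<^bsub>R\<^esub>} = unit_vec R ` {x. ?u x \<noteq> \<zero>\<^bsub>R\<^esub>}"
        using w by (auto simp: mem_free_module)
      have fin: "finite {x. ?u x \<noteq> \<zero>\<^bsub>R\<^esub>}"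
        using w inj unfolding w_supp by (intro finite_vimageI) (auto simp: mem_free_module inj_def)
      have "?u \<in> carrier ?F"
        using w fin by (auto simp: mem_free_module inj subset_iff image_iff)
      then have "?u = lin_ext R ?F (unit_vec R) ?u"
        by (rule lin_ext_unit_vec_self[OF assms, symmetric])
      also have "\<dots> = lin_ext R ?F id w"
      proof -
        interpret F: module R ?F by fact
        show ?thesis
          unfolding lin_ext_def supp
        proof (subst F.M.finsum_reindex)
          show "(\<lambda>b. w b \<odot>\<^bsub>?F\<^esub> id b) \<in> unit_vec R ` {x. w (unit_vec R x) \<noteq> \<zero>\<^bsub>R\<^esub>} \<rightarrow> carrier ?F"
          proof
            fix b assume "b \<in> unit_vec R ` {x. w (unit_vec R x) \<noteq> \<zero>\<^bsub>R\<^esub>}"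
            then have "b \<in> ?B"
              unfolding supp[symmetric] using w by (auto simp: mem_free_module)
            then have "b \<in> carrier ?F" and "w b \<in> carrier R"
              using B w by (blast, simp add: mem_free_module)
            then show "w b \<odot>\<^bsub>?F\<^esub> id b \<in> carrier ?F"
              unfolding id_apply by (intro F.smult_closed)
          qed
        qed (simp_all add: inj_on_def inj)
      qed
      finally show ?thesis by simp
    qed
    have "bij_betw (lin_ext R ?F id) (carrier (free_module R ?B)) (carrier ?F)"
    proof (rule bij_betwI[where g = g])
      show "lin_ext R ?F id \<in> carrier (free_module R ?B) \<rightarrow> carrier ?F"
        using B by (intro Pi_I module_hom_closed[OF lin_ext_hom[OF F]]) (auto simp: subset_iff)
      show "g \<in> carrier ?F \<rightarrow> carrier (free_module R ?B)"
        using gF by blast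
      show "g (lin_ext R ?F id w) = w" if "w \<in> carrier (free_module R ?B)" for w
      proof
        fix b
        show "g (lin_ext R ?F id w) b = w b"
        proof (cases "b \<in> ?B")
          case True
          then show ?thesis
            using inj by (auto simp: val[OF that] g_def)
        next
          case False
          then show ?thesis
            using free_module_outside[OF that False] by (simp add: g_def)
        qed
      qed
      show "lin_ext R ?F id (g u) = u" if u: "u \<in> carrier ?F" for u
        using gF[OF u] by (simp add: val g[OF u])
    qed
    then show ?thesis
      unfolding is_free_def using F B by blast
  qed
qed

text \<open>Projectivity: choose preimages under \<open>g\<close> on a basis and extend linearly.
  The map \<open>g\<close> need only hit the image of \<open>f\<close>, which is the form in which
  exactness of a resolution delivers it.\<close>

lemma is_free_lift:
  assumes "is_free R F" "module R M" "module R N" "g \<in> module_hom R M N" "f \<in> module_hom R F N"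
    and "\<And>x. x \<in> carrier F \<Longrightarrow> f x \<in> g ` carrier M"
  shows "\<exists>h \<in> module_hom R F M. \<forall>x\<in>carrier F. g (h x) = f x"
proof -
  have F: "module R F" using assms(1) by (simp add: is_free_def)
  interpret F: module R F by fact
  obtain B where B: "B \<subseteq> carrier F"
    and bij: "bij_betw (lin_ext R F id) (carrier (free_module R B)) (carrier F)"
    using assms(1) unfolding is_free_def by blast
  let ?B = "free_module R B"
  have FB: "module R ?B" by (rule module_free_module) (rule F.R.cring_axioms)
  interpret FB: module R ?B by fact
  let ?l = "lin_ext R F id"
  \<comment> \<open>The coordinate map of the basis. It is linear because it inverts the linear
    bijection \<open>?l\<close>.\<close>
  define c where "c = inv_into (carrier ?B) ?l"
  have l: "?l \<in> module_hom R ?B F" by (rule lin_ext_hom[OF F]) (use B in auto)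
  have c: "c x \<in> carrier ?B" "?l (c x) = x" if "x \<in> carrier F" for x
    using bij_betw_apply[OF bij_betw_inv_into[OF bij] that] bij_betw_inv_into_right[OF bij that]
    unfolding c_def by auto
  have cl: "c (?l u) = u" if "u \<in> carrier ?B" for u
    using bij_betw_inv_into_left[OF bij that] unfolding c_def .
  have chom: "c \<in> module_hom R F ?B"
  proof (rule module_homI)
    fix x y assume x: "x \<in> carrier F" and y: "y \<in> carrier F"
    have "?l (c x \<oplus>\<^bsub>?B\<^esub> c y) = x \<oplus>\<^bsub>F\<^esub> y"
      using module_hom_add[OF l c(1)[OF x] c(1)[OF y]] c x y by simp
    then show "c (x \<oplus>\<^bsub>F\<^esub> y) = c x \<oplus>\<^bsub>?B\<^esub> c y"
      using cl[OF FB.M.a_closed[OF c(1)[OF x] c(1)[OF y]]] by simp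
  next
    fix a x assume a: "a \<in> carrier R" and x: "x \<in> carrier F"
    have "?l (a \<odot>\<^bsub>?B\<^esub> c x) = a \<odot>\<^bsub>F\<^esub> x"
      using module_hom_smult[OF l a c(1)[OF x]] c x by simp
    then show "c (a \<odot>\<^bsub>F\<^esub> x) = a \<odot>\<^bsub>?B\<^esub> c x"
      using cl[OF FB.smult_closed[OF a c(1)[OF x]]] by simp
  qed (use c in auto)
  define \<psi> where "\<psi> b = (SOME m. m \<in> carrier M \<and> g m = f b)" for b
  have \<psi>: "\<psi> b \<in> carrier M" "g (\<psi> b) = f b" if "b \<in> B" for b
  proof -
    have "\<exists>m. m \<in> carrier M \<and> g m = f b"
      using assms(6)[of b] that B by (metis imageE subsetD)
    then have "\<psi> b \<in> carrier M \<and> g (\<psi> b) = f b"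
      unfolding \<psi>_def by (rule someI_ex)
    then show "\<psi> b \<in> carrier M" "g (\<psi> b) = f b" by auto
  qed
  have \<psi>h: "lin_ext R M \<psi> \<in> module_hom R ?B M"
    using \<psi> by (intro lin_ext_hom assms(2)) auto
  have "g (lin_ext R M \<psi> (c x)) = f x" if x: "x \<in> carrier F" for x
  proof -
    have "g (lin_ext R M \<psi> (c x)) = lin_ext R N (\<lambda>b. g (\<psi> b)) (c x)"
      using \<psi> c(1)[OF x] by (intro module_hom_lin_ext[OF assms(2-4)]) auto
    also have "\<dots> = lin_ext R N (\<lambda>b. f (id b)) (c x)"
      unfolding lin_ext_def
    proof (rule abelian_monoid.finsum_cong')
      show "abelian_monoid N" using assms(3) by (simp add: module_def abelian_group_def)
      show "(\<lambda>b. c x b \<odot>\<^bsub>N\<^esub> f (id b)) \<in> {b. c x b \<noteq> \<zero>\<^bsub>R\<^esub>} \<rightarrow> carrier N"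
        using c(1)[OF x] B module_hom_closed[OF assms(5)] module.smult_closed[OF assms(3)]
        by (auto simp: mem_free_module subset_iff)
    qed (use \<psi> c(1)[OF x] in \<open>auto simp: mem_free_module subset_iff\<close>)
    also have "\<dots> = f (?l (c x))"
      using B c(1)[OF x] by (intro module_hom_lin_ext[symmetric] F assms(3,5)) auto
    finally show ?thesis using c x by simp
  qed
  then show ?thesis
    using module_hom_compose[OF chom \<psi>h] by (intro bexI[of _ "\<lambda>x. lin_ext R M \<psi> (c x)"]) auto
qed

lemma submodule_finsum:
  assumes "module R M" "submodule H R M" "f \<in> A \<rightarrow> H"
  shows "(\<Oplus>\<^bsub>M\<^esub>x\<in>A. f x) \<in> H"
proof -
  interpret M: module R M by fact
  have H: "H \<subseteq> carrier M" "\<zero>\<^bsub>M\<^esub> \<in> H" "\<And>x y. x \<in> H \<Longrightarrow> y \<in> H \<Longrightarrow> x \<oplus>\<^bsub>M\<^esub> y \<in> H"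
    using assms(2) unfolding M.submodule_iff by auto
  show ?thesis
    using assms(3)
  proof (induction A rule: infinite_finite_induct)
    case (insert x A)
    then have "f \<in> A \<rightarrow> carrier M" "f x \<in> carrier M"
      using H(1) by auto
    then show ?case
      using insert H(3) by (simp add: M.M.finsum_insert)
  qed (use H in auto)
qed

lemma lin_ext_in_submodule:
  assumes "module R M" "submodule H R M" "\<phi> \<in> X \<rightarrow> H" "u \<in> carrier (free_module R X)"
  shows "lin_ext R M \<phi> u \<in> H"
proof -
  interpret M: module R M by fact
  have "\<And>a x. a \<in> carrier R \<Longrightarrow> x \<in> H \<Longrightarrow> a \<odot>\<^bsub>M\<^esub> x \<in> H"
    using assms(2) unfolding M.submodule_iff by auto
  then show ?thesis
    unfolding lin_ext_def using assms(3,4)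
    by (intro submodule_finsum[OF assms(1,2)]) (auto simp: mem_free_module Pi_iff subset_iff)
qed

text \<open>The submodule usually written \<open>I M\<close>. It will turn out to be the kernel of
  the map from \<open>M\<close> to its tensor product with \<open>R/I\<close>, so vanishing in the
  tensor product can be expressed inside \<open>M\<close>.\<close>

definition ideal_times :: "('a, 'm) ring_scheme \<Rightarrow> 'a set \<Rightarrow> ('a, 'b) module \<Rightarrow> 'b set" where
  "ideal_times R I M = submodule_span R M {a \<odot>\<^bsub>M\<^esub> x | a x. a \<in> I \<and> x \<in> carrier M}"

lemma submodule_ideal_times:
  assumes "module R M" "I \<subseteq> carrier R"
  shows "submodule (ideal_times R I M) R M"
proof -
  interpret M: module R M by fact
  show ?thesis
    unfolding ideal_times_def using assms by (intro submodule_submodule_span) auto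
qed

lemma ideal_timesI: "a \<in> I \<Longrightarrow> x \<in> carrier M \<Longrightarrow> a \<odot>\<^bsub>M\<^esub> x \<in> ideal_times R I M"
  unfolding ideal_times_def by (rule subsetD[OF submodule_span_superset]) auto

text \<open>The preimage of \<open>I N\<close> is a submodule that contains the generating products.
  This is why linear comparison maps and homotopies respect congruences modulo an ideal.\<close>

lemma ideal_times_hom:
  assumes "module R M" "module R N" "f \<in> module_hom R M N" "I \<subseteq> carrier R" "x \<in> ideal_times R I M"
  shows "f x \<in> ideal_times R I N"
proof -
  let ?H = "{x \<in> carrier M. f x \<in> ideal_times R I N}"
  interpret M: module R M by fact
  have "submodule ?H R M"
    by (rule submodule_vimage[OF assms(1-3) submodule_ideal_times[OF assms(2,4)]])
  moreover have "{a \<odot>\<^bsub>M\<^esub> x | a x. a \<in> I \<and> x \<in> carrier M} \<subseteq> ?H"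
    using assms(4) module_hom_smult[OF assms(3)] module_hom_closed[OF assms(3)]
    by (auto simp: ideal_timesI subset_iff)
  ultimately have "ideal_times R I M \<subseteq> ?H"
    unfolding ideal_times_def by (rule submodule_span_minimal)
  then show ?thesis
    using assms(5) by blast
qed

section \<open>Tensor products\<close>

definition pure_tensor ::
  "('a, 'm) ring_scheme \<Rightarrow> ('a, 'b) module \<Rightarrow> ('a, 'c) module \<Rightarrow> 'b \<Rightarrow> 'c \<Rightarrow> ('b \<times> 'c \<Rightarrow> 'a) set"
  where "pure_tensor R M N x y =
    tensor_kernel R M N +>\<^bsub>free_module R (carrier M \<times> carrier N)\<^esub> unit_vec R (x, y)"

lemma bilinear_relations_subset:
  assumes "module R M" "module R N"
  shows "bilinear_relations R M N \<subseteq> carrier (free_module R (carrier M \<times> carrier N))"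
proof -
  interpret M: module R M by fact
  interpret N: module R N by fact
  let ?L = "free_module R (carrier M \<times> carrier N)"
  interpret L: module R ?L by (rule module_free_module) (rule M.R.cring_axioms)
  have "unit_vec R (x, y) \<in> carrier ?L" if "x \<in> carrier M" "y \<in> carrier N" for x y
    using that by (intro unit_vec_closed M.R.cring_axioms) auto
  then show ?thesis
    unfolding bilinear_relations_def Let_def
    by (auto simp del: free_module_sel intro!: L.M.minus_closed)
qed

lemma submodule_tensor_kernel:
  assumes "module R M" "module R N"
  shows "submodule (tensor_kernel R M N) R (free_module R (carrier M \<times> carrier N))"
  unfolding tensor_kernel_def
  using assms by (intro submodule_submodule_span module_free_module bilinear_relations_subset)
    (auto simp: module_def)

lemma module_tensor:
  assumes "module R M" "module R N"
  shows "module R (tensor R M N)"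
  unfolding tensor_def
  using assms by (intro module_quot_module submodule_tensor_kernel module_free_module)
    (auto simp: module_def)

text \<open>The universal property of the tensor product in the form used below. The elements killed
  by a linear extension form a submodule, so bilinearity has to be checked on the defining relations
  alone.\<close>

lemma lin_ext_tensor_kernel:
  assumes "module R M" "module R N" "module R Q"
    and \<beta>: "\<And>x y. x \<in> carrier M \<Longrightarrow> y \<in> carrier N \<Longrightarrow> \<beta> x y \<in> carrier Q"
    and "\<And>x x' y. x \<in> carrier M \<Longrightarrow> x' \<in> carrier M \<Longrightarrow> y \<in> carrier N \<Longrightarrow>
      \<beta> (x \<oplus>\<^bsub>M\<^esub> x') y = \<beta> x y \<oplus>\<^bsub>Q\<^esub> \<beta> x' y"
    and "\<And>x y y'. x \<in> carrier M \<Longrightarrow> y \<in> carrier N \<Longrightarrow> y' \<in> carrier N \<Longrightarrow>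
      \<beta> x (y \<oplus>\<^bsub>N\<^esub> y') = \<beta> x y \<oplus>\<^bsub>Q\<^esub> \<beta> x y'"
    and "\<And>a x y. a \<in> carrier R \<Longrightarrow> x \<in> carrier M \<Longrightarrow> y \<in> carrier N \<Longrightarrow>
      \<beta> (a \<odot>\<^bsub>M\<^esub> x) y = a \<odot>\<^bsub>Q\<^esub> \<beta> x y"
    and "\<And>a x y. a \<in> carrier R \<Longrightarrow> x \<in> carrier M \<Longrightarrow> y \<in> carrier N \<Longrightarrow>
      \<beta> x (a \<odot>\<^bsub>N\<^esub> y) = a \<odot>\<^bsub>Q\<^esub> \<beta> x y"
    and u: "u \<in> tensor_kernel R M N"
  shows "lin_ext R Q (\<lambda>(x, y). \<beta> x y) u = \<zero>\<^bsub>Q\<^esub>"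
proof -
  interpret M: module R M by fact
  interpret N: module R N by fact
  interpret Q: module R Q by fact
  let ?L = "free_module R (carrier M \<times> carrier N)" and ?f = "lin_ext R Q (\<lambda>(x, y). \<beta> x y)"
  interpret L: module R ?L by (rule module_free_module) (rule M.R.cring_axioms)
  have f: "?f \<in> module_hom R ?L Q"
    using \<beta> by (intro lin_ext_hom assms(3)) auto
  note minus = module_hom_minus[OF L.module_axioms assms(3) f]
    and hom = module_hom_add[OF f] module_hom_smult[OF f]
  have e: "unit_vec R (x, y) \<in> carrier ?L" if "x \<in> carrier M" "y \<in> carrier N" for x y
    using that by (intro unit_vec_closed M.R.cring_axioms) auto
  have fe: "?f (unit_vec R (x, y)) = \<beta> x y" if "x \<in> carrier M" "y \<in> carrier N" for x y
    using that \<beta> by (subst lin_ext_unit_vec[OF assms(3)]) auto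
  have minus_self: "z \<ominus>\<^bsub>Q\<^esub> z = \<zero>\<^bsub>Q\<^esub>" if "z \<in> carrier Q" for z
    using that by (simp add: a_minus_def Q.M.r_neg)
  let ?H = "{u \<in> carrier ?L. ?f u \<in> {\<zero>\<^bsub>Q\<^esub>}}"
  have "submodule ?H R ?L"
    by (rule submodule_vimage[OF L.module_axioms assms(3) f Q.submodule_zero])
  moreover have "bilinear_relations R M N \<subseteq> ?H"
  proof
    fix r assume r: "r \<in> bilinear_relations R M N"
    then have "?f r = \<zero>\<^bsub>Q\<^esub>"
      unfolding bilinear_relations_def Let_def
      by (elim UnE CollectE exE conjE)
         (simp_all del: free_module_sel add: minus hom e fe assms minus_self)
    then show "r \<in> ?H"
      using r bilinear_relations_subset[OF assms(1,2)] by auto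
  qed
  ultimately have "tensor_kernel R M N \<subseteq> ?H"
    unfolding tensor_kernel_def by (rule submodule_span_minimal)
  then show ?thesis
    using u by blast
qed

context
  fixes R :: "('a, 'm) ring_scheme" and M :: "('a, 'b) module" and N :: "('a, 'c) module"
  assumes M: "module R M" and N: "module R N"
begin

private abbreviation (input) "L \<equiv> free_module R (carrier M \<times> carrier N)"
private abbreviation (input) "K \<equiv> tensor_kernel R M N"
private abbreviation (input) "T \<equiv> tensor R M N"
private abbreviation (input) "pt \<equiv> pure_tensor R M N"

interpretation M: module R M by (rule M)
interpretation N: module R N by (rule N)
interpretation L: module R L by (rule module_free_module) (rule M.R.cring_axioms)
interpretation T: module R T by (rule module_tensor[OF M N])

lemma submodule_K: "submodule K R L" by (rule submodule_tensor_kernel[OF M N])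

lemma unit_vec_pair_closed: "x \<in> carrier M \<Longrightarrow> y \<in> carrier N \<Longrightarrow> unit_vec R (x, y) \<in> carrier L"
  by (intro unit_vec_closed M.R.cring_axioms) auto

lemma tensor_coset_hom: "(\<lambda>u. K +>\<^bsub>L\<^esub> u) \<in> module_hom R L T"
  unfolding tensor_def by (rule coset_map_hom[OF L.module_axioms submodule_K])

lemma tensor_coset_eqI:
  assumes "u \<in> carrier L" "v \<in> carrier L" "u \<ominus>\<^bsub>L\<^esub> v \<in> bilinear_relations R M N"
  shows "K +>\<^bsub>L\<^esub> u = K +>\<^bsub>L\<^esub> v"
proof -
  have "u \<ominus>\<^bsub>L\<^esub> v \<in> K"
    unfolding tensor_kernel_def using assms(3) by (rule subsetD[OF submodule_span_superset])
  then show ?thesis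
    by (simp only: coset_eq_iff[OF L.module_axioms submodule_K assms(1,2)])
qed

lemma pure_tensor_closed: "x \<in> carrier M \<Longrightarrow> y \<in> carrier N \<Longrightarrow> pt x y \<in> carrier T"
  unfolding pure_tensor_def
  by (rule module_hom_closed[OF tensor_coset_hom unit_vec_pair_closed])

lemma pure_tensor_add_left:
  assumes "x \<in> carrier M" "x' \<in> carrier M" "y \<in> carrier N"
  shows "pt (x \<oplus>\<^bsub>M\<^esub> x') y = pt x y \<oplus>\<^bsub>T\<^esub> pt x' y"
proof -
  have "pt (x \<oplus>\<^bsub>M\<^esub> x') y = K +>\<^bsub>L\<^esub> (unit_vec R (x, y) \<oplus>\<^bsub>L\<^esub> unit_vec R (x', y))"
    unfolding pure_tensor_def using assms
    by (intro tensor_coset_eqI L.M.a_closed unit_vec_pair_closed M.M.a_closed)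
       (auto simp: bilinear_relations_def Let_def simp del: free_module_sel)
  then show ?thesis
    unfolding pure_tensor_def
    by (simp only: module_hom_add[OF tensor_coset_hom] unit_vec_pair_closed assms)
qed

lemma pure_tensor_add_right:
  assumes "x \<in> carrier M" "y \<in> carrier N" "y' \<in> carrier N"
  shows "pt x (y \<oplus>\<^bsub>N\<^esub> y') = pt x y \<oplus>\<^bsub>T\<^esub> pt x y'"
proof -
  have "pt x (y \<oplus>\<^bsub>N\<^esub> y') = K +>\<^bsub>L\<^esub> (unit_vec R (x, y) \<oplus>\<^bsub>L\<^esub> unit_vec R (x, y'))"
    unfolding pure_tensor_def using assms
    by (intro tensor_coset_eqI L.M.a_closed unit_vec_pair_closed N.M.a_closed)
       (auto simp: bilinear_relations_def Let_def simp del: free_module_sel)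
  then show ?thesis
    unfolding pure_tensor_def
    by (simp only: module_hom_add[OF tensor_coset_hom] unit_vec_pair_closed assms)
qed

lemma pure_tensor_smult_left:
  assumes "a \<in> carrier R" "x \<in> carrier M" "y \<in> carrier N"
  shows "pt (a \<odot>\<^bsub>M\<^esub> x) y = a \<odot>\<^bsub>T\<^esub> pt x y"
proof -
  have "pt (a \<odot>\<^bsub>M\<^esub> x) y = K +>\<^bsub>L\<^esub> (a \<odot>\<^bsub>L\<^esub> unit_vec R (x, y))"
    unfolding pure_tensor_def using assms
    by (intro tensor_coset_eqI L.smult_closed unit_vec_pair_closed M.smult_closed)
       (auto simp: bilinear_relations_def Let_def simp del: free_module_sel)
  then show ?thesis
    unfolding pure_tensor_def
    by (simp only: module_hom_smult[OF tensor_coset_hom] unit_vec_pair_closed assms)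
qed

lemma pure_tensor_smult_right:
  assumes "a \<in> carrier R" "x \<in> carrier M" "y \<in> carrier N"
  shows "pt x (a \<odot>\<^bsub>N\<^esub> y) = a \<odot>\<^bsub>T\<^esub> pt x y"
proof -
  have "pt x (a \<odot>\<^bsub>N\<^esub> y) = K +>\<^bsub>L\<^esub> (a \<odot>\<^bsub>L\<^esub> unit_vec R (x, y))"
    unfolding pure_tensor_def using assms
    by (intro tensor_coset_eqI L.smult_closed unit_vec_pair_closed N.smult_closed)
       (auto simp: bilinear_relations_def Let_def simp del: free_module_sel)
  then show ?thesis
    unfolding pure_tensor_def
    by (simp only: module_hom_smult[OF tensor_coset_hom] unit_vec_pair_closed assms)
qed

lemma pure_tensor_hom:
  "y \<in> carrier N \<Longrightarrow> (\<lambda>x. pt x y) \<in> module_hom R M T"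
  by (rule module_homI) (simp_all add: pure_tensor_closed pure_tensor_add_left pure_tensor_smult_left)

text \<open>Each element is the coset of a linear combination of unit vectors, hence a linear
  combination of pure tensors; so pure tensors generate.\<close>

lemma tensor_subset_submodule:
  assumes "submodule H R T" "\<And>x y. x \<in> carrier M \<Longrightarrow> y \<in> carrier N \<Longrightarrow> pt x y \<in> H"
  shows "carrier T \<subseteq> H"
proof
  fix t assume "t \<in> carrier T"
  then obtain u where u: "u \<in> carrier L" "t = K +>\<^bsub>L\<^esub> u"
    unfolding tensor_def by auto
  then have "t = lin_ext R T (\<lambda>z. K +>\<^bsub>L\<^esub> unit_vec R z) u"
    using free_module_hom_eqI[OF T.module_axioms tensor_coset_hom u(1)] by simp
  also have "\<dots> \<in> H"
    using assms(2) by (intro lin_ext_in_submodule[OF T.module_axioms assms(1) _ u(1)])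
      (auto simp: pure_tensor_def)
  finally show "t \<in> H" .
qed

end

lemma
  fixes M :: "('a, 'b) module" and N :: "('a, 'c) module"
    and M' :: "('a, 'd) module" and N' :: "('a, 'e) module"
  assumes M: "module R M" and N: "module R N" and M': "module R M'" and N': "module R N'"
    and f: "f \<in> module_hom R M M'" and g: "g \<in> module_hom R N N'"
  shows tensor_map_hom: "tensor_map R M' N' f g \<in> module_hom R (tensor R M N) (tensor R M' N')"
    and tensor_map_pure_tensor: "x \<in> carrier M \<Longrightarrow> y \<in> carrier N \<Longrightarrow>
      tensor_map R M' N' f g (pure_tensor R M N x y) = pure_tensor R M' N' (f x) (g y)"
proof -
  let ?L = "free_module R (carrier M \<times> carrier N)" and ?K = "tensor_kernel R M N"
  let ?L' = "free_module R (carrier M' \<times> carrier N')" and ?K' = "tensor_kernel R M' N'"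
  let ?T' = "tensor R M' N'" and ?pt' = "pure_tensor R M' N'"
  let ?F = "lin_ext R ?L' (\<lambda>(x, y). unit_vec R (f x, g y))"
  interpret M: module R M by (rule M)
  interpret L: module R ?L by (rule module_free_module) (rule M.R.cring_axioms)
  interpret L': module R ?L' by (rule module_free_module) (rule M.R.cring_axioms)
  interpret T': module R ?T' by (rule module_tensor[OF M' N'])
  note fc = module_hom_closed[OF f] and gc = module_hom_closed[OF g]
  have c: "unit_vec R (f x, g y) \<in> carrier ?L'" if "x \<in> carrier M" "y \<in> carrier N" for x y
    using that fc gc by (intro unit_vec_closed M.R.cring_axioms) auto
  have F: "?F \<in> module_hom R ?L ?L'"
    using c by (intro lin_ext_hom L'.module_axioms) auto
  have K: "submodule ?K R ?L"
    by (rule submodule_tensor_kernel[OF M N])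
  have K': "submodule ?K' R ?L'"
    by (rule submodule_tensor_kernel[OF M' N'])
  \<comment> \<open>Followed by the projection to the target, \<open>?F\<close> is the linear
    extension of the bilinear map that takes \<open>(x, y)\<close> to the pure tensor of
    \<open>f x\<close> and \<open>g y\<close>. It therefore vanishes on \<open>?K\<close>.\<close>
  have FK: "?F u \<in> ?K'" if u: "u \<in> ?K" for u
  proof -
    have uL: "u \<in> carrier ?L"
      using u L.submoduleE(1)[OF K] by (rule rev_subsetD)
    have "?K' +>\<^bsub>?L'\<^esub> ?F u
        = lin_ext R ?T' (\<lambda>z. ?K' +>\<^bsub>?L'\<^esub> (case z of (x, y) \<Rightarrow> unit_vec R (f x, g y))) u"
      using c
      by (intro module_hom_lin_ext[OF L'.module_axioms T'.module_axioms
        tensor_coset_hom[OF M' N'] uL]) auto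
    also have "(\<lambda>z. ?K' +>\<^bsub>?L'\<^esub> (case z of (x, y) \<Rightarrow> unit_vec R (f x, g y)))
        = (\<lambda>(x, y). ?pt' (f x) (g y))"
      by (auto simp: pure_tensor_def)
    also have "lin_ext R ?T' (\<lambda>(x, y). ?pt' (f x) (g y)) u = \<zero>\<^bsub>?T'\<^esub>"
      by (rule lin_ext_tensor_kernel[OF M N T'.module_axioms _ _ _ _ _ u])
         (simp_all add: fc gc M' N' pure_tensor_closed pure_tensor_add_left pure_tensor_add_right
           pure_tensor_smult_left pure_tensor_smult_right module_hom_add[OF f] module_hom_add[OF g]
           module_hom_smult[OF f] module_hom_smult[OF g])
    finally have "?K' +>\<^bsub>?L'\<^esub> ?F u = ?K'"
      by (simp add: tensor_def)
    then show "?F u \<in> ?K'"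
      using coset_eq_self_iff[OF L'.module_axioms K'] module_hom_closed[OF F uL] by simp
  qed
  show "tensor_map R M' N' f g \<in> module_hom R (tensor R M N) ?T'"
    unfolding tensor_map_def Let_def tensor_def
    by (rule quot_map_hom[OF L.module_axioms K L'.module_axioms K' F FK])
  assume x: "x \<in> carrier M" and y: "y \<in> carrier N"
  have "tensor_map R M' N' f g (pure_tensor R M N x y) = ?K' +>\<^bsub>?L'\<^esub> ?F (unit_vec R (x, y))"
    unfolding tensor_map_def Let_def pure_tensor_def
    by (rule quot_map_coset[OF L.module_axioms K L'.module_axioms K' F FK])
       (auto simp: unit_vec_pair_closed[OF M N] x y)
  also have "?F (unit_vec R (x, y)) = unit_vec R (f x, g y)"
    using lin_ext_unit_vec[OF L'.module_axioms, of "\<lambda>(x, y). unit_vec R (f x, g y)" "(x, y)"] c x y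
    by simp
  finally show "tensor_map R M' N' f g (pure_tensor R M N x y) = ?pt' (f x) (g y)"
    by (simp add: pure_tensor_def)
qed

section \<open>Tensor products with cyclic modules\<close>

context
  fixes S :: "'a ring" and I :: "'a set"
  assumes S: "cring S" and I: "ideal I S"
begin

private abbreviation (input) "Q \<equiv> cyclic_module S I"
private abbreviation (input) "\<kappa> \<equiv> \<lambda>a. I +>\<^bsub>self_module S\<^esub> a"

interpretation S: cring S by (rule S)
interpretation I: ideal I S by (rule I)
interpretation SM: module S "self_module S" by (rule module_self_module[OF S])

lemma self_module_sel:
  "carrier (self_module S) = carrier S" "a \<oplus>\<^bsub>self_module S\<^esub> b = a \<oplus>\<^bsub>S\<^esub> b"
  "a \<odot>\<^bsub>self_module S\<^esub> b = a \<otimes>\<^bsub>S\<^esub> b"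
  by (auto simp: self_module_def)

lemma self_module_minus:
  assumes "a \<in> carrier S" "b \<in> carrier S"
  shows "a \<ominus>\<^bsub>self_module S\<^esub> b = a \<ominus>\<^bsub>S\<^esub> b"
proof -
  have "\<ominus>\<^bsub>self_module S\<^esub> b = \<ominus>\<^bsub>S\<^esub> b"
    by (rule SM.M.minus_equality) (use assms in \<open>auto simp: self_module_def S.l_neg\<close>)
  then show ?thesis
    by (simp add: a_minus_def self_module_sel)
qed

lemma module_cyclic_module: "module S Q"
  unfolding cyclic_module_def
  by (rule module_quot_module[OF SM.module_axioms submodule_self_module[OF S I]])

interpretation Q: module S Q by (rule module_cyclic_module)

lemma cyclic_module_carrier: "carrier Q = \<kappa> ` carrier S"
  by (simp add: cyclic_module_def self_module_sel)

lemma cyclic_module_zero: "\<zero>\<^bsub>Q\<^esub> = I"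
  by (simp add: cyclic_module_def)

lemma cyclic_coset_hom: "\<kappa> \<in> module_hom S (self_module S) Q"
  unfolding cyclic_module_def
  by (rule coset_map_hom[OF SM.module_axioms submodule_self_module[OF S I]])

lemma cyclic_coset_closed: "a \<in> carrier S \<Longrightarrow> \<kappa> a \<in> carrier Q"
  by (simp add: cyclic_module_carrier)

lemma cyclic_coset_add: "a \<in> carrier S \<Longrightarrow> b \<in> carrier S \<Longrightarrow> \<kappa> a \<oplus>\<^bsub>Q\<^esub> \<kappa> b = \<kappa> (a \<oplus>\<^bsub>S\<^esub> b)"
  using module_hom_add[OF cyclic_coset_hom, of a b] by (simp add: self_module_sel)

lemma cyclic_coset_smult: "a \<in> carrier S \<Longrightarrow> b \<in> carrier S \<Longrightarrow> a \<odot>\<^bsub>Q\<^esub> \<kappa> b = \<kappa> (a \<otimes>\<^bsub>S\<^esub> b)"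
  using module_hom_smult[OF cyclic_coset_hom, of a b] by (simp add: self_module_sel)

lemma cyclic_coset_eq_iff:
  "a \<in> carrier S \<Longrightarrow> b \<in> carrier S \<Longrightarrow> \<kappa> a = \<kappa> b \<longleftrightarrow> a \<ominus>\<^bsub>S\<^esub> b \<in> I"
  using coset_eq_iff[OF SM.module_axioms submodule_self_module[OF S I], of a b]
  by (simp add: self_module_sel self_module_minus)

lemma cyclic_coset_eq_zero_iff: "a \<in> carrier S \<Longrightarrow> \<kappa> a = \<zero>\<^bsub>Q\<^esub> \<longleftrightarrow> a \<in> I"
  using coset_eq_self_iff[OF SM.module_axioms submodule_self_module[OF S I], of a]
  by (simp add: self_module_sel cyclic_module_zero)

text \<open>Scalars move across the tensor sign: \<open>x\<close> tensor the class of
  \<open>a\<close> is \<open>a x\<close> tensor the class of one. Hence the image of the linear map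
  \<open>?h\<close> contains all pure tensors and is everything.\<close>

lemma tensor_cyclic_cases:
  assumes M: "module S M" and t: "t \<in> carrier (tensor S M Q)"
  obtains x where "x \<in> carrier M" "t = pure_tensor S M Q x (\<kappa> \<one>\<^bsub>S\<^esub>)"
proof -
  interpret M: module S M by (rule M)
  let ?h = "\<lambda>x. pure_tensor S M Q x (\<kappa> \<one>\<^bsub>S\<^esub>)"
  have one: "\<kappa> \<one>\<^bsub>S\<^esub> \<in> carrier Q"
    by (simp add: cyclic_coset_closed)
  have "carrier (tensor S M Q) \<subseteq> ?h ` carrier M"
  proof (rule tensor_subset_submodule[OF M module_cyclic_module])
    show "submodule (?h ` carrier M) S (tensor S M Q)"
      by (rule submodule_image[OF M module_tensor[OF M module_cyclic_module]
        pure_tensor_hom[OF M module_cyclic_module one]])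
    fix x y assume x: "x \<in> carrier M" and "y \<in> carrier Q"
    then obtain a where a: "a \<in> carrier S" "y = \<kappa> a"
      by (auto simp: cyclic_module_carrier)
    have y: "y = a \<odot>\<^bsub>Q\<^esub> \<kappa> \<one>\<^bsub>S\<^esub>"
      using a by (simp add: cyclic_coset_smult)
    have "pure_tensor S M Q x y = ?h (a \<odot>\<^bsub>M\<^esub> x)"
      unfolding y
      by (simp only: pure_tensor_smult_right[OF M module_cyclic_module a(1) x one]
        pure_tensor_smult_left[OF M module_cyclic_module a(1) x one])
    then show "pure_tensor S M Q x y \<in> ?h ` carrier M"
      using a x by blast
  qed
  then show ?thesis
    using t that by blast
qed

text \<open>This is the isomorphism of the tensor product with \<open>M / I M\<close>, reduced to
  its kernel. For the forward direction, \<open>(x, \<kappa> a)\<close> is sent to the class of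
  \<open>a x\<close> in \<open>M / I M\<close>; this map is bilinear and takes the given pure tensor
  to the class of \<open>x\<close>.\<close>

lemma pure_tensor_cyclic_eq_zero_iff:
  assumes M: "module S M" and x: "x \<in> carrier M"
  shows "pure_tensor S M Q x (\<kappa> \<one>\<^bsub>S\<^esub>) = \<zero>\<^bsub>tensor S M Q\<^esub> \<longleftrightarrow> x \<in> ideal_times S I M"
proof
  interpret M: module S M by (rule M)
  let ?L = "free_module S (carrier M \<times> carrier Q)" and ?K = "tensor_kernel S M Q"
  interpret L: module S ?L by (rule module_free_module) (rule S)
  interpret T: module S "tensor S M Q" by (rule module_tensor[OF M module_cyclic_module])
  have one: "\<kappa> \<one>\<^bsub>S\<^esub> \<in> carrier Q"
    by (simp add: cyclic_coset_closed)
  note K = submodule_tensor_kernel[OF M module_cyclic_module]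
  note h = pure_tensor_hom[OF M module_cyclic_module one]
  {
    let ?D = "quot_module M (ideal_times S I M)"
    have IM: "submodule (ideal_times S I M) S M"
      by (rule submodule_ideal_times[OF M]) (auto simp: I.a_subset)
    interpret D: module S ?D by (rule module_quot_module[OF M IM])
    note q = coset_map_hom[OF M IM]
    let ?q = "\<lambda>x. ideal_times S I M +>\<^bsub>M\<^esub> x"
    \<comment> \<open>A chosen representative turns the formula into a function on cosets. Fact
      \<open>\<beta>\<close> below shows that the choice does not matter: changing it alters
      \<open>a x\<close> by an element of \<open>I M\<close>.\<close>
    define rep where "rep y = (SOME a. a \<in> carrier S \<and> y = \<kappa> a)" for y
    have rep: "rep y \<in> carrier S" "y = \<kappa> (rep y)" if "y \<in> carrier Q" for y
      using that someI_ex[of "\<lambda>a. a \<in> carrier S \<and> y = \<kappa> a"] unfolding rep_def cyclic_module_carrier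
      by blast+
    define \<beta> where "\<beta> x y = ?q (rep y \<odot>\<^bsub>M\<^esub> x)" for x y
    have \<beta>: "\<beta> x (\<kappa> a) = ?q (a \<odot>\<^bsub>M\<^esub> x)" if x: "x \<in> carrier M" and a: "a \<in> carrier S" for x a
    proof -
      note r' = rep[OF cyclic_coset_closed[OF a]]
      have r: "rep (\<kappa> a) \<in> carrier S" "rep (\<kappa> a) \<ominus>\<^bsub>S\<^esub> a \<in> I"
        using r' cyclic_coset_eq_iff[OF r'(1) a] by auto
      have "rep (\<kappa> a) \<odot>\<^bsub>M\<^esub> x \<ominus>\<^bsub>M\<^esub> a \<odot>\<^bsub>M\<^esub> x = (rep (\<kappa> a) \<ominus>\<^bsub>S\<^esub> a) \<odot>\<^bsub>M\<^esub> x"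
        using r a x by (simp add: a_minus_def M.smult_l_distr M.smult_l_minus)
      then show ?thesis
        unfolding \<beta>_def using r a x ideal_timesI[OF r(2) x] by (subst coset_eq_iff[OF M IM]) auto
    qed
    note qadd = module_hom_add[OF q, symmetric] and qsm = module_hom_smult[OF q, symmetric]
    assume 0: "pure_tensor S M Q x (\<kappa> \<one>\<^bsub>S\<^esub>) = \<zero>\<^bsub>tensor S M Q\<^esub>"
    let ?u = "unit_vec S (x, \<kappa> \<one>\<^bsub>S\<^esub>)"
    have "?u \<in> ?K"
      using 0 coset_eq_self_iff[OF L.module_axioms K, of ?u]
        unit_vec_pair_closed[OF M module_cyclic_module x one]
      by (simp add: pure_tensor_def tensor_def)
    then have "lin_ext S ?D (\<lambda>(x, y). \<beta> x y) ?u = \<zero>\<^bsub>?D\<^esub>"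
    proof (rule lin_ext_tensor_kernel[OF M module_cyclic_module D.module_axioms, rotated -1])
      fix x y assume x: "x \<in> carrier M" and "y \<in> carrier Q"
      then obtain b where b: "b \<in> carrier S" "y = \<kappa> b"
        by (auto simp: cyclic_module_carrier)
      show "\<beta> x y \<in> carrier ?D"
        using x b by (simp add: \<beta>)
      show "\<beta> (x \<oplus>\<^bsub>M\<^esub> x') y = \<beta> x y \<oplus>\<^bsub>?D\<^esub> \<beta> x' y" if "x' \<in> carrier M" for x'
        using that x b by (simp add: \<beta> qadd M.smult_r_distr del: quot_module_sel)
      show "\<beta> (a \<odot>\<^bsub>M\<^esub> x) y = a \<odot>\<^bsub>?D\<^esub> \<beta> x y" if "a \<in> carrier S" for a
        using that x b by (simp add: \<beta> qsm M.smult_assoc1[symmetric] S.m_comm del: quot_module_sel)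
      show "\<beta> x (a \<odot>\<^bsub>Q\<^esub> y) = a \<odot>\<^bsub>?D\<^esub> \<beta> x y" if "a \<in> carrier S" for a
        using that x b by (simp add: \<beta> qsm cyclic_coset_smult M.smult_assoc1 del: quot_module_sel)
      fix y' assume "y' \<in> carrier Q"
      then obtain c where c: "c \<in> carrier S" "y' = \<kappa> c"
        by (auto simp: cyclic_module_carrier)
      show "\<beta> x (y \<oplus>\<^bsub>Q\<^esub> y') = \<beta> x y \<oplus>\<^bsub>?D\<^esub> \<beta> x y'"
        using c x b by (simp add: \<beta> qadd cyclic_coset_add M.smult_l_distr del: quot_module_sel)
    qed
    moreover have "lin_ext S ?D (\<lambda>(x, y). \<beta> x y) ?u = ?q x"
      using lin_ext_unit_vec[OF D.module_axioms, of "\<lambda>(x, y). \<beta> x y" "(x, \<kappa> \<one>\<^bsub>S\<^esub>)"] x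
      by (simp add: \<beta>)
    ultimately have "?q x = ideal_times S I M"
      by simp
    then show "x \<in> ideal_times S I M"
      using coset_eq_self_iff[OF M IM x] by simp
  next
    let ?H = "{x \<in> carrier M. pure_tensor S M Q x (\<kappa> \<one>\<^bsub>S\<^esub>) \<in> {\<zero>\<^bsub>tensor S M Q\<^esub>}}"
    have "submodule ?H S M"
      by (rule submodule_vimage[OF M T.module_axioms h T.submodule_zero])
    moreover have "a \<odot>\<^bsub>M\<^esub> y \<in> ?H" if "a \<in> I" "y \<in> carrier M" for a y
    proof -
      have a: "a \<in> carrier S" using that by simp
      note Q = module_cyclic_module
      have "pure_tensor S M Q (a \<odot>\<^bsub>M\<^esub> y) (\<kappa> \<one>\<^bsub>S\<^esub>) = pure_tensor S M Q y (a \<odot>\<^bsub>Q\<^esub> \<kappa> \<one>\<^bsub>S\<^esub>)"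
        using a that by (simp add: pure_tensor_smult_left[OF M Q] pure_tensor_smult_right[OF M Q] one)
      \<comment> \<open>Both sides are the zero coset because \<open>a\<close> lies in
        \<open>I\<close>. The scalar zero can then be pulled out of the tensor.\<close>
      also have "a \<odot>\<^bsub>Q\<^esub> \<kappa> \<one>\<^bsub>S\<^esub> = \<zero>\<^bsub>S\<^esub> \<odot>\<^bsub>Q\<^esub> \<kappa> \<one>\<^bsub>S\<^esub>"
        using a that one cyclic_coset_eq_zero_iff[OF a] cyclic_coset_eq_zero_iff[OF S.zero_closed]
        by (simp add: cyclic_coset_smult)
      also have "pure_tensor S M Q y \<dots> = \<zero>\<^bsub>tensor S M Q\<^esub>"
        using that one pure_tensor_closed[OF M Q]
        by (subst pure_tensor_smult_right[OF M Q]) auto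
      finally show ?thesis
        using a that by auto
    qed
    ultimately have "ideal_times S I M \<subseteq> ?H"
      unfolding ideal_times_def by (intro submodule_span_minimal) auto
    moreover assume "x \<in> ideal_times S I M"
    ultimately show "pure_tensor S M Q x (\<kappa> \<one>\<^bsub>S\<^esub>) = \<zero>\<^bsub>tensor S M Q\<^esub>"
      by blast
  }
qed

end

lemma
  fixes S :: "'a ring"
  assumes "cring S" "ideal I S" "ideal J S" "I \<subseteq> J"
  shows natural_map_hom: "natural_map S J \<in> module_hom S (cyclic_module S I) (cyclic_module S J)"
    and natural_map_coset: "a \<in> carrier S \<Longrightarrow>
      natural_map S J (I +>\<^bsub>self_module S\<^esub> a) = J +>\<^bsub>self_module S\<^esub> a"
proof -
  have id: "id \<in> module_hom S (self_module S) (self_module S)"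
    by (auto simp: module_hom_def)
  note * = module_self_module[OF assms(1)] submodule_self_module[OF assms(1,2)]
    module_self_module[OF assms(1)] submodule_self_module[OF assms(1,3)] id
  show "natural_map S J \<in> module_hom S (cyclic_module S I) (cyclic_module S J)"
    unfolding natural_map_def cyclic_module_def
    by (rule quot_map_hom[OF *]) (use assms(4) in auto)
  assume "a \<in> carrier S"
  then show "natural_map S J (I +>\<^bsub>self_module S\<^esub> a) = J +>\<^bsub>self_module S\<^esub> a"
    unfolding natural_map_def
    using quot_map_coset[OF *, of a] assms(4) by (auto simp: self_module_def)
qed

section \<open>Comparison of free resolutions\<close>

lemma module_hom_diff:
  assumes "module R M" "module R N" "f \<in> module_hom R M N" "g \<in> module_hom R M N"
  shows "(\<lambda>x. f x \<ominus>\<^bsub>N\<^esub> g x) \<in> module_hom R M N"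
proof -
  interpret M: module R M by fact
  interpret N: module R N by fact
  note c = module_hom_closed[OF assms(3)] module_hom_closed[OF assms(4)]
  show ?thesis
    by (rule module_homI)
       (simp_all add: c module_hom_add[OF assms(3)] module_hom_add[OF assms(4)]
         module_hom_smult[OF assms(3)] module_hom_smult[OF assms(4)] a_minus_def
         N.M.minus_add N.M.a_ac N.smult_r_distr N.smult_r_minus)
qed

locale free_res =
  fixes R :: "('a, 'm) ring_scheme" and P :: "nat \<Rightarrow> ('a, 'b) module" and \<delta> \<epsilon>
    and M :: "('a, 'c) module"
  assumes res: "free_resolution R P \<delta> \<epsilon> M" and M: "module R M"
begin

lemma free: "is_free R (P i)"
  and d_hom: "\<delta> i \<in> module_hom R (P (Suc i)) (P i)"
  and e_hom: "\<epsilon> \<in> module_hom R (P 0) M"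
  and e_surj: "\<epsilon> ` carrier (P 0) = carrier M"
  and exact_0: "\<delta> 0 ` carrier (P (Suc 0)) = {x \<in> carrier (P 0). \<epsilon> x = \<zero>\<^bsub>M\<^esub>}"
  and exact_Suc: "\<delta> (Suc i) ` carrier (P (Suc (Suc i))) =
    {x \<in> carrier (P (Suc i)). \<delta> i x = \<zero>\<^bsub>P i\<^esub>}"
  using res by (auto simp: free_resolution_def a_kernel_def')

lemma mod: "module R (P i)"
  using free unfolding is_free_def by blast

lemma e_d: "x \<in> carrier (P (Suc 0)) \<Longrightarrow> \<epsilon> (\<delta> 0 x) = \<zero>\<^bsub>M\<^esub>"
  using exact_0 by blast

lemma d_d: "x \<in> carrier (P (Suc (Suc i))) \<Longrightarrow> \<delta> i (\<delta> (Suc i) x) = \<zero>\<^bsub>P i\<^esub>"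
  using exact_Suc[of i] by blast

end

text \<open>Lift the identity of \<open>M\<close> degree by degree: each stage is an instance of
  projectivity, and dependent choice assembles the stages into one family.\<close>

lemma comparison_map:
  assumes "free_res R P \<delta> \<epsilon> M" "free_res R Q \<delta>' \<epsilon>' M"
  obtains \<phi> where "\<And>i. \<phi> i \<in> module_hom R (P i) (Q i)"
    and "\<And>x. x \<in> carrier (P 0) \<Longrightarrow> \<epsilon>' (\<phi> 0 x) = \<epsilon> x"
    and "\<And>i x. x \<in> carrier (P (Suc i)) \<Longrightarrow> \<delta>' i (\<phi> (Suc i) x) = \<phi> i (\<delta> i x)"
proof -
  interpret P: free_res R P \<delta> \<epsilon> M by fact
  interpret Q: free_res R Q \<delta>' \<epsilon>' M by fact
  \<comment> \<open>The second conjunct is the solvability condition for the next lift. Carrying it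
    in the invariant lets the induction step look at one degree only; the augmentation matters in
    degree zero alone.\<close>
  let ?A = "\<lambda>n \<phi>. \<phi> \<in> module_hom R (P n) (Q n) \<and>
    (\<forall>x\<in>carrier (P (Suc n)). \<phi> (\<delta> n x) \<in> \<delta>' n ` carrier (Q (Suc n))) \<and>
    (n = 0 \<longrightarrow> (\<forall>x\<in>carrier (P 0). \<epsilon>' (\<phi> x) = \<epsilon> x))"
  let ?B = "\<lambda>n \<phi> \<phi>'. \<forall>x\<in>carrier (P (Suc n)). \<delta>' n (\<phi>' x) = \<phi> (\<delta> n x)"
  have "\<exists>\<phi>. ?A 0 \<phi>"
  proof -
    obtain \<phi> where \<phi>: "\<phi> \<in> module_hom R (P 0) (Q 0)" "\<forall>x\<in>carrier (P 0). \<epsilon>' (\<phi> x) = \<epsilon> x"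
      using is_free_lift[OF P.free Q.mod P.M Q.e_hom P.e_hom] module_hom_closed[OF P.e_hom] Q.e_surj
      by blast
    have "\<phi> (\<delta> 0 x) \<in> \<delta>' 0 ` carrier (Q (Suc 0))" if x: "x \<in> carrier (P (Suc 0))" for x
      unfolding Q.exact_0
      using \<phi> P.e_d[OF x] module_hom_closed[OF P.d_hom x] module_hom_closed[OF \<phi>(1)] by simp
    then show ?thesis
      using \<phi> by blast
  qed
  moreover have "\<exists>\<phi>'. ?A (Suc n) \<phi>' \<and> ?B n \<phi> \<phi>'" if A: "?A n \<phi>" for n \<phi>
  proof -
    have \<phi>: "\<phi> \<in> module_hom R (P n) (Q n)" using A by blast
    have "\<exists>\<phi>' \<in> module_hom R (P (Suc n)) (Q (Suc n)). ?B n \<phi> \<phi>'"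
      by (rule is_free_lift[OF P.free Q.mod Q.mod Q.d_hom module_hom_compose[OF P.d_hom \<phi>]])
         (rule bspec[OF conjunct1[OF conjunct2[OF A]]])
    then obtain \<phi>' where \<phi>': "\<phi>' \<in> module_hom R (P (Suc n)) (Q (Suc n))" "?B n \<phi> \<phi>'"
      by blast
    have "\<phi>' (\<delta> (Suc n) x) \<in> \<delta>' (Suc n) ` carrier (Q (Suc (Suc n)))"
      if x: "x \<in> carrier (P (Suc (Suc n)))" for x
      unfolding Q.exact_Suc
      using \<phi>' P.d_d[OF x] module_hom_closed[OF P.d_hom x] module_hom_closed[OF \<phi>'(1)]
        module_hom_zero[OF P.mod Q.mod \<phi>] by simp
    then show ?thesis
      using \<phi>' by blast
  qed
  ultimately have "\<exists>\<phi>. \<forall>n. ?A n (\<phi> n) \<and> ?B n (\<phi> n) (\<phi> (Suc n))"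
    by (rule dependent_nat_choice)
  then obtain \<phi> where \<phi>: "\<forall>n. ?A n (\<phi> n) \<and> ?B n (\<phi> n) (\<phi> (Suc n))" ..
  show ?thesis
  proof (rule that)
    show "\<phi> n \<in> module_hom R (P n) (Q n)" for n
      using spec[OF \<phi>, of n] by simp
    show "\<epsilon>' (\<phi> 0 x) = \<epsilon> x" if "x \<in> carrier (P 0)" for x
      using spec[OF \<phi>, of 0] that by simp
    show "\<delta>' n (\<phi> (Suc n) x) = \<phi> n (\<delta> n x)" if "x \<in> carrier (P (Suc n))" for n x
      using spec[OF \<phi>, of n] that by simp
  qed
qed

context free_res
begin

text \<open>
  \<open>h\<close> is one component of a homotopy from \<open>\<theta>\<close> to the identity. Requiring only that the
  remaining term is a boundary lets the components be constructed one at a time.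
\<close>

lemma homotopy_identity:
  assumes \<theta>: "\<And>i. \<theta> i \<in> module_hom R (P i) (P i)"
    and \<theta>_e: "\<And>x. x \<in> carrier (P 0) \<Longrightarrow> \<epsilon> (\<theta> 0 x) = \<epsilon> x"
    and \<theta>_d: "\<And>i x. x \<in> carrier (P (Suc i)) \<Longrightarrow> \<delta> i (\<theta> (Suc i) x) = \<theta> i (\<delta> i x)"
  shows "\<exists>h \<in> module_hom R (P i) (P (Suc i)). \<forall>x \<in> carrier (P (Suc i)).
    (x \<ominus>\<^bsub>P (Suc i)\<^esub> \<theta> (Suc i) x) \<ominus>\<^bsub>P (Suc i)\<^esub> h (\<delta> i x)
      \<in> \<delta> (Suc i) ` carrier (P (Suc (Suc i)))"
proof (induction i)
  interpret M: module R M by (rule M)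
  case 0
  interpret P0: module R "P 0" by (rule mod)
  interpret P1: module R "P (Suc 0)" by (rule mod)
  note \<theta>c = module_hom_closed[OF \<theta>] and dc = module_hom_closed[OF d_hom]
  \<comment> \<open>Since \<open>\<theta> 0\<close> is compatible with the augmentation, the
    difference lies in the kernel of \<open>\<epsilon>\<close>, which is the image of
    \<open>\<delta> 0\<close>.\<close>
  have "x \<ominus>\<^bsub>P 0\<^esub> \<theta> 0 x \<in> \<delta> 0 ` carrier (P (Suc 0))" if "x \<in> carrier (P 0)" for x
    unfolding exact_0
    using that \<theta>_e \<theta>c module_hom_closed[OF e_hom]
    by (simp add: module_hom_minus[OF mod M e_hom] M.M.minus_self)
  then have "\<exists>h \<in> module_hom R (P 0) (P (Suc 0)). \<forall>x\<in>carrier (P 0). \<delta> 0 (h x) = x \<ominus>\<^bsub>P 0\<^esub> \<theta> 0 x"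
    by (rule is_free_lift[OF free mod mod d_hom module_hom_diff[OF mod mod module_hom_id \<theta>]])
  then obtain h where h: "h \<in> module_hom R (P 0) (P (Suc 0))"
    "\<forall>x\<in>carrier (P 0). \<delta> 0 (h x) = x \<ominus>\<^bsub>P 0\<^esub> \<theta> 0 x"
    by blast
  note hc = module_hom_closed[OF h(1)] and dm = module_hom_minus[OF mod mod d_hom]
  have "(x \<ominus>\<^bsub>P (Suc 0)\<^esub> \<theta> (Suc 0) x) \<ominus>\<^bsub>P (Suc 0)\<^esub> h (\<delta> 0 x)
      \<in> \<delta> (Suc 0) ` carrier (P (Suc (Suc 0)))" if x: "x \<in> carrier (P (Suc 0))" for x
    unfolding exact_Suc
    using x h(2) by (simp add: dm hc \<theta>c dc \<theta>_d P0.M.minus_self)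
  then show ?case
    using h(1) by blast
next
  case (Suc i)
  interpret P0: module R "P i" by (rule mod)
  interpret P1: module R "P (Suc i)" by (rule mod)
  interpret P2: module R "P (Suc (Suc i))" by (rule mod)
  note \<theta>c = module_hom_closed[OF \<theta>] and dc = module_hom_closed[OF d_hom]
    and dm = module_hom_minus[OF mod mod d_hom]
  obtain h where h: "h \<in> module_hom R (P i) (P (Suc i))"
    and hx: "\<forall>x \<in> carrier (P (Suc i)).
      (x \<ominus>\<^bsub>P (Suc i)\<^esub> \<theta> (Suc i) x) \<ominus>\<^bsub>P (Suc i)\<^esub> h (\<delta> i x)
        \<in> \<delta> (Suc i) ` carrier (P (Suc (Suc i)))"
    using Suc.IH by blast
  have f: "(\<lambda>x. (x \<ominus>\<^bsub>P (Suc i)\<^esub> \<theta> (Suc i) x) \<ominus>\<^bsub>P (Suc i)\<^esub> h (\<delta> i x))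
      \<in> module_hom R (P (Suc i)) (P (Suc i))"
    by (rule module_hom_diff[OF mod mod module_hom_diff[OF mod mod module_hom_id \<theta>]
      module_hom_compose[OF d_hom h]])
  have "\<exists>h' \<in> module_hom R (P (Suc i)) (P (Suc (Suc i))). \<forall>x\<in>carrier (P (Suc i)).
      \<delta> (Suc i) (h' x) = (x \<ominus>\<^bsub>P (Suc i)\<^esub> \<theta> (Suc i) x) \<ominus>\<^bsub>P (Suc i)\<^esub> h (\<delta> i x)"
    by (rule is_free_lift[OF free mod mod d_hom f]) (rule bspec[OF hx])
  then obtain h' where h': "h' \<in> module_hom R (P (Suc i)) (P (Suc (Suc i)))"
    "\<forall>x\<in>carrier (P (Suc i)).
      \<delta> (Suc i) (h' x) = (x \<ominus>\<^bsub>P (Suc i)\<^esub> \<theta> (Suc i) x) \<ominus>\<^bsub>P (Suc i)\<^esub> h (\<delta> i x)"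
    by blast
  note hc = module_hom_closed[OF h] module_hom_closed[OF h'(1)]
  \<comment> \<open>By exactness it suffices that the differential kills this element. Applying
    \<open>\<delta> (Suc i)\<close> to the \<open>h'\<close> term gives the previous expression at
    \<open>\<delta> (Suc i) x\<close>, whose \<open>h\<close> part vanishes by \<open>d_d\<close>;
    the rest cancels against the first bracket.\<close>
  have "(x \<ominus>\<^bsub>P (Suc (Suc i))\<^esub> \<theta> (Suc (Suc i)) x) \<ominus>\<^bsub>P (Suc (Suc i))\<^esub> h' (\<delta> (Suc i) x)
      \<in> \<delta> (Suc (Suc i)) ` carrier (P (Suc (Suc (Suc i))))"
    if x: "x \<in> carrier (P (Suc (Suc i)))" for x
    unfolding exact_Suc
    using x h'(2)
    by (simp add: dm hc \<theta>c dc \<theta>_d d_d module_hom_zero[OF mod mod h] P1.M.minus_self P1.M.minus_zero_right)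
  then show ?case
    using h'(1) by blast
qed

end

text \<open>Write \<open>z\<close> as the sum of \<open>z - \<psi> \<phi> z - h \<delta> z\<close>,
  \<open>h \<delta> z\<close> and \<open>\<psi> \<phi> z\<close>. The first is a boundary by the
  homotopy. The second lies in \<open>I P\<close> because \<open>h\<close> is linear and
  \<open>\<delta> z\<close> is in \<open>I P\<close>. The third is the image of a decomposition
  available in \<open>Q\<close>.\<close>

lemma small_cycles_transfer:
  fixes P :: "nat \<Rightarrow> ('a, 'b) module" and Q :: "nat \<Rightarrow> ('a, 'd) module"
  assumes "free_res R P \<delta> \<epsilon> M" "free_res R Q \<delta>' \<epsilon>' M"
    and "I \<subseteq> J" "J \<subseteq> carrier R"
    and Q: "\<And>z. z \<in> carrier (Q (Suc i)) \<Longrightarrow> \<delta>' i z \<in> ideal_times R I (Q i) \<Longrightarrow>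
      \<exists>w \<in> ideal_times R J (Q (Suc i)). \<exists>p \<in> carrier (Q (Suc (Suc i))).
        z = w \<oplus>\<^bsub>Q (Suc i)\<^esub> \<delta>' (Suc i) p"
    and z: "z \<in> carrier (P (Suc i))" "\<delta> i z \<in> ideal_times R I (P i)"
  shows "\<exists>w \<in> ideal_times R J (P (Suc i)). \<exists>p \<in> carrier (P (Suc (Suc i))).
    z = w \<oplus>\<^bsub>P (Suc i)\<^esub> \<delta> (Suc i) p"
proof -
  interpret P: free_res R P \<delta> \<epsilon> M by fact
  interpret Q: free_res R Q \<delta>' \<epsilon>' M by fact
  interpret P1: module R "P (Suc i)" by (rule P.mod)
  interpret P2: module R "P (Suc (Suc i))" by (rule P.mod)
  have I: "I \<subseteq> carrier R" using assms(3,4) by blast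
  obtain \<phi> where \<phi>: "\<And>i. \<phi> i \<in> module_hom R (P i) (Q i)"
    "\<And>x. x \<in> carrier (P 0) \<Longrightarrow> \<epsilon>' (\<phi> 0 x) = \<epsilon> x"
    "\<And>i x. x \<in> carrier (P (Suc i)) \<Longrightarrow> \<delta>' i (\<phi> (Suc i) x) = \<phi> i (\<delta> i x)"
    using comparison_map[OF assms(1,2)] by blast
  obtain \<psi> where \<psi>: "\<And>i. \<psi> i \<in> module_hom R (Q i) (P i)"
    "\<And>x. x \<in> carrier (Q 0) \<Longrightarrow> \<epsilon> (\<psi> 0 x) = \<epsilon>' x"
    "\<And>i x. x \<in> carrier (Q (Suc i)) \<Longrightarrow> \<delta> i (\<psi> (Suc i) x) = \<psi> i (\<delta>' i x)"
    using comparison_map[OF assms(2,1)] by blast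
  note \<phi>c = module_hom_closed[OF \<phi>(1)] and \<psi>c = module_hom_closed[OF \<psi>(1)]
  have "\<exists>h \<in> module_hom R (P i) (P (Suc i)). \<forall>x \<in> carrier (P (Suc i)).
    (x \<ominus>\<^bsub>P (Suc i)\<^esub> \<psi> (Suc i) (\<phi> (Suc i) x)) \<ominus>\<^bsub>P (Suc i)\<^esub> h (\<delta> i x)
      \<in> \<delta> (Suc i) ` carrier (P (Suc (Suc i)))"
    by (rule P.homotopy_identity[where \<theta> = "\<lambda>i x. \<psi> i (\<phi> i x)"])
       (simp_all add: module_hom_compose[OF \<phi>(1) \<psi>(1)] \<phi>(2,3) \<psi>(2,3) \<phi>c)
  then obtain h q where h: "h \<in> module_hom R (P i) (P (Suc i))"
    and q: "q \<in> carrier (P (Suc (Suc i)))"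
    and zq: "(z \<ominus>\<^bsub>P (Suc i)\<^esub> \<psi> (Suc i) (\<phi> (Suc i) z)) \<ominus>\<^bsub>P (Suc i)\<^esub> h (\<delta> i z) = \<delta> (Suc i) q"
    using z(1) by (metis (no_types, lifting) imageE)
  have "\<delta>' i (\<phi> (Suc i) z) \<in> ideal_times R I (Q i)"
    using ideal_times_hom[OF P.mod Q.mod \<phi>(1) I z(2)] \<phi>(3)[OF z(1)] by simp
  then obtain w p where w: "w \<in> ideal_times R J (Q (Suc i))" and p: "p \<in> carrier (Q (Suc (Suc i)))"
    and zw: "\<phi> (Suc i) z = w \<oplus>\<^bsub>Q (Suc i)\<^esub> \<delta>' (Suc i) p"
    using Q[OF \<phi>c[OF z(1)]] by blast
  have JP: "submodule (ideal_times R J (P (Suc i))) R (P (Suc i))"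
    by (rule submodule_ideal_times[OF P.mod assms(4)])
  have JQ: "submodule (ideal_times R J (Q (Suc i))) R (Q (Suc i))"
    by (rule submodule_ideal_times[OF Q.mod assms(4)])
  let ?a = "\<psi> (Suc i) w" and ?b = "h (\<delta> i z)"
  have a: "?a \<in> ideal_times R J (P (Suc i))"
    by (rule ideal_times_hom[OF Q.mod P.mod \<psi>(1) assms(4) w])
  have "?b \<in> ideal_times R I (P (Suc i))"
    by (rule ideal_times_hom[OF P.mod P.mod h I z(2)])
  then have b: "?b \<in> ideal_times R J (P (Suc i))"
    using assms(3) unfolding ideal_times_def submodule_span_def by blast
  have wc: "w \<in> carrier (Q (Suc i))"
    using w module.submoduleE(1)[OF Q.mod JQ] by blast
  have abc: "?a \<in> carrier (P (Suc i))" "?b \<in> carrier (P (Suc i))"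
    using a b P1.submoduleE(1)[OF JP] by blast+
  let ?p = "\<psi> (Suc (Suc i)) p"
  have pc: "?p \<in> carrier (P (Suc (Suc i)))" by (rule \<psi>c[OF p])
  note dc = module_hom_closed[OF P.d_hom] and dc' = module_hom_closed[OF Q.d_hom]
  have \<psi>\<phi>: "\<psi> (Suc i) (\<phi> (Suc i) z) = ?a \<oplus>\<^bsub>P (Suc i)\<^esub> \<delta> (Suc i) ?p"
    unfolding zw using module_hom_add[OF \<psi>(1) wc dc'[OF p]] \<psi>(3)[OF p] by simp
  \<comment> \<open>The parts lying in \<open>J P\<close> are collected in front and the boundaries
    behind.\<close>
  have "z = (?a \<oplus>\<^bsub>P (Suc i)\<^esub> ?b) \<oplus>\<^bsub>P (Suc i)\<^esub> (\<delta> (Suc i) ?p \<oplus>\<^bsub>P (Suc i)\<^esub> \<delta> (Suc i) q)"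
  proof -
    let ?c = "\<delta> (Suc i) ?p"
    have c: "?c \<in> carrier (P (Suc i))" by (rule dc[OF pc])
    have "(?a \<oplus>\<^bsub>P (Suc i)\<^esub> ?b) \<oplus>\<^bsub>P (Suc i)\<^esub> (?c \<oplus>\<^bsub>P (Suc i)\<^esub>
      ((z \<ominus>\<^bsub>P (Suc i)\<^esub> (?a \<oplus>\<^bsub>P (Suc i)\<^esub> ?c)) \<ominus>\<^bsub>P (Suc i)\<^esub> ?b)) =
      z \<oplus>\<^bsub>P (Suc i)\<^esub> ((?a \<oplus>\<^bsub>P (Suc i)\<^esub> \<ominus>\<^bsub>P (Suc i)\<^esub> ?a) \<oplus>\<^bsub>P (Suc i)\<^esub>
        ((?b \<oplus>\<^bsub>P (Suc i)\<^esub> \<ominus>\<^bsub>P (Suc i)\<^esub> ?b) \<oplus>\<^bsub>P (Suc i)\<^esub> (?c \<oplus>\<^bsub>P (Suc i)\<^esub> \<ominus>\<^bsub>P (Suc i)\<^esub> ?c)))"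
      using z(1) abc c by (simp only: a_minus_def P1.M.minus_add P1.M.a_ac P1.M.a_closed P1.M.a_inv_closed)
    also have "\<dots> = z"
      using z(1) abc c by (simp add: P1.M.r_neg)
    finally show ?thesis
      using zq \<psi>\<phi> by simp
  qed
  also have "\<delta> (Suc i) ?p \<oplus>\<^bsub>P (Suc i)\<^esub> \<delta> (Suc i) q
      = \<delta> (Suc i) (?p \<oplus>\<^bsub>P (Suc (Suc i))\<^esub> q)"
    using module_hom_add[OF P.d_hom pc q] by simp
  finally show ?thesis
    using P1.submoduleE(5)[OF JP a b] P2.M.a_closed[OF pc q] by blast
qed

section \<open>Maps on Tor\<close>

text \<open>The module of cycles is the chain module with a smaller carrier. Cosets depend on the
  addition only, so this change of carrier leaves them alone, and an element of \<open>B\<close>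
  represents the coset \<open>B\<close>.\<close>

lemma quot_map_zero:
  assumes C: "module R C" and B: "submodule B R C"
    and \<phi>: "\<And>x. x \<in> X \<Longrightarrow> \<phi> x \<in> B" and X: "X \<noteq> {}"
  shows "quot_map (C\<lparr>carrier := Z\<rparr>) B \<phi> X = B"
proof -
  have "B +>\<^bsub>C\<lparr>carrier := Z\<rparr>\<^esub> b = B" if "b \<in> B" for b
  proof -
    have "B +>\<^bsub>C\<lparr>carrier := Z\<rparr>\<^esub> b = B +>\<^bsub>C\<^esub> b"
      by (simp add: a_r_coset_def')
    also have "\<dots> = B"
      using that module.submoduleE(1)[OF C B] coset_eq_self_iff[OF C B] by blast
    finally show ?thesis .
  qed
  then have "(\<lambda>x. B +>\<^bsub>C\<lparr>carrier := Z\<rparr>\<^esub> \<phi> x) ` X = {B}"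
    using \<phi> X by auto
  then show ?thesis
    by (simp add: quot_map_def)
qed

text \<open>A cycle has the form \<open>z\<close> tensor \<open>1\<close> with
  \<open>\<delta> z\<close> in \<open>I P\<close>. In the splitting
  \<open>z = w + \<delta> p\<close> supplied by \<open>small\<close>, the first part becomes zero
  modulo \<open>J\<close> and the second becomes a boundary.\<close>

lemma Tor_map_zero:
  fixes S :: "'a ring" and P :: "nat \<Rightarrow> ('a, 'b) module"
  assumes S: "cring S" and I: "ideal I S" and J: "ideal J S" and IJ: "I \<subseteq> J"
    and mod: "\<And>i. module S (P i)" and d: "\<And>i. \<delta> i \<in> module_hom S (P (Suc i)) (P i)"
    and dd: "\<And>i x. x \<in> carrier (P (Suc (Suc i))) \<Longrightarrow> \<delta> i (\<delta> (Suc i) x) = \<zero>\<^bsub>P i\<^esub>"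
    and small: "\<And>z. z \<in> carrier (P (Suc i)) \<Longrightarrow> \<delta> i z \<in> ideal_times S I (P i) \<Longrightarrow>
      \<exists>w \<in> ideal_times S J (P (Suc i)). \<exists>p \<in> carrier (P (Suc (Suc i))).
        z = w \<oplus>\<^bsub>P (Suc i)\<^esub> \<delta> (Suc i) p"
    and t: "t \<in> carrier (Tor S P \<delta> (cyclic_module S I) (Suc i))"
  shows "Tor_map S P \<delta> (cyclic_module S J) (natural_map S J) (Suc i) t
    = \<zero>\<^bsub>Tor S P \<delta> (cyclic_module S J) (Suc i)\<^esub>"
proof -
  interpret S: cring S by fact
  let ?Q = "cyclic_module S I" and ?Q' = "cyclic_module S J"
  let ?one = "I +>\<^bsub>self_module S\<^esub> \<one>\<^bsub>S\<^esub>" and ?one' = "J +>\<^bsub>self_module S\<^esub> \<one>\<^bsub>S\<^esub>"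
  note mQ = module_cyclic_module[OF S I] and mQ' = module_cyclic_module[OF S J]
  note one = cyclic_coset_closed[OF S I S.one_closed] and one' = cyclic_coset_closed[OF S J S.one_closed]
  let ?T = "\<lambda>j. tensor S (P j) ?Q" and ?T' = "\<lambda>j. tensor S (P j) ?Q'"
  let ?D = "tensor_diff S P \<delta> ?Q" and ?D' = "tensor_diff S P \<delta> ?Q'"
  let ?pt = "\<lambda>j x. pure_tensor S (P j) ?Q x ?one" and ?pt' = "\<lambda>j x. pure_tensor S (P j) ?Q' x ?one'"
  have mT: "module S (?T j)" and mT': "module S (?T' j)" for j
    by (rule module_tensor[OF mod mQ], rule module_tensor[OF mod mQ'])
  have id: "id \<in> module_hom S N N" for N :: "('a, 'x) module"
    by (auto simp: module_hom_def)
  have D: "?D j \<in> module_hom S (?T (Suc j)) (?T j)" "?D' j \<in> module_hom S (?T' (Suc j)) (?T' j)" for j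
    unfolding tensor_diff_def
    by (rule tensor_map_hom[OF mod mQ mod mQ d id], rule tensor_map_hom[OF mod mQ' mod mQ' d id])
  have Dpt: "?D j (?pt (Suc j) x) = ?pt j (\<delta> j x)" if "x \<in> carrier (P (Suc j))" for j x
    unfolding tensor_diff_def using tensor_map_pure_tensor[OF mod mQ mod mQ d id that one] by simp
  have Dpt': "?D' j (?pt' (Suc j) x) = ?pt' j (\<delta> j x)" if "x \<in> carrier (P (Suc j))" for j x
    unfolding tensor_diff_def using tensor_map_pure_tensor[OF mod mQ' mod mQ' d id that one'] by simp
  have pt_hom: "?pt j \<in> module_hom S (P j) (?T j)" "?pt' j \<in> module_hom S (P j) (?T' j)" for j
    by (rule pure_tensor_hom[OF mod mQ one], rule pure_tensor_hom[OF mod mQ' one'])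
  have DD: "?D j (?D (Suc j) x) = \<zero>\<^bsub>?T j\<^esub>" if x: "x \<in> carrier (?T (Suc (Suc j)))" for j x
  proof -
    obtain y where y: "y \<in> carrier (P (Suc (Suc j)))" "x = ?pt (Suc (Suc j)) y"
      by (rule tensor_cyclic_cases[OF S I mod x])
    then show ?thesis
      using Dpt module_hom_closed[OF d] dd module_hom_zero[OF mod mT pt_hom(1)] by simp
  qed
  let ?Z = "a_kernel (?T (Suc i)) (?T i) (?D i)" and ?B = "boundaries ?T ?D (Suc i)"
  let ?Z' = "a_kernel (?T' (Suc i)) (?T' i) (?D' i)" and ?B' = "boundaries ?T' ?D' (Suc i)"
  interpret T: module S "?T (Suc i)" by (rule mT)
  have cyc: "cycles ?T ?D (Suc i) = (?T (Suc i))\<lparr>carrier := ?Z\<rparr>"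
    "cycles ?T' ?D' (Suc i) = (?T' (Suc i))\<lparr>carrier := ?Z'\<rparr>"
    by (auto simp: cycles_def)
  have B: "submodule ?B S (?T (Suc i))" "submodule ?B' S (?T' (Suc i))"
    unfolding boundaries_def by (rule submodule_image[OF mT mT D(1)], rule submodule_image[OF mT' mT' D(2)])
  have BZ: "?B \<subseteq> ?Z"
    unfolding boundaries_def a_kernel_def' using DD module_hom_closed[OF D(1)] by auto
  have Z: "submodule ?Z S (?T (Suc i))"
    using submodule_vimage[OF mT mT D(1) module.submodule_zero[OF mT]] by (simp add: a_kernel_def')
  let ?\<phi> = "tensor_map S (P (Suc i)) ?Q' id (natural_map S J)"
  have key: "?\<phi> c \<in> ?B'" if c: "c \<in> ?Z" for c
  proof -
    have cT: "c \<in> carrier (?T (Suc i))" and "?D i c = \<zero>\<^bsub>?T i\<^esub>"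
      using c by (auto simp: a_kernel_def')
    obtain z where z: "z \<in> carrier (P (Suc i))" "c = ?pt (Suc i) z"
      by (rule tensor_cyclic_cases[OF S I mod cT])
    then have "?pt i (\<delta> i z) = \<zero>\<^bsub>?T i\<^esub>"
      using Dpt \<open>?D i c = _\<close> by simp
    then have "\<delta> i z \<in> ideal_times S I (P i)"
      using pure_tensor_cyclic_eq_zero_iff[OF S I mod module_hom_closed[OF d z(1)]] by simp
    then obtain w p where w: "w \<in> ideal_times S J (P (Suc i))" and p: "p \<in> carrier (P (Suc (Suc i)))"
      and zw: "z = w \<oplus>\<^bsub>P (Suc i)\<^esub> \<delta> (Suc i) p"
      using small[OF z(1)] by blast
    have "J \<subseteq> carrier S"
      using J by (simp add: additive_subgroup.a_subset ideal.axioms(1))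
    then have wc: "w \<in> carrier (P (Suc i))"
      using w module.submoduleE(1)[OF mod submodule_ideal_times[OF mod]] by blast
    have "?pt' (Suc i) w = \<zero>\<^bsub>?T' (Suc i)\<^esub>"
      using pure_tensor_cyclic_eq_zero_iff[OF S J mod wc] w by simp
    moreover have "?pt' (Suc i) z = ?pt' (Suc i) w \<oplus>\<^bsub>?T' (Suc i)\<^esub> ?D' (Suc i) (?pt' (Suc (Suc i)) p)"
      unfolding zw Dpt'[OF p] by (rule module_hom_add[OF pt_hom(2) wc module_hom_closed[OF d p]])
    moreover have c1: "?pt' (Suc (Suc i)) p \<in> carrier (?T' (Suc (Suc i)))"
      by (rule module_hom_closed[OF pt_hom(2) p])
    moreover have "?D' (Suc i) (?pt' (Suc (Suc i)) p) \<in> carrier (?T' (Suc i))"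
      by (rule module_hom_closed[OF D(2) c1])
    ultimately have "?pt' (Suc i) z \<in> ?B'"
      unfolding boundaries_def
      using mT'[of "Suc i"] by (simp add: abelian_monoid.l_zero module_def abelian_group_def)
    moreover have "?\<phi> c = ?pt' (Suc i) z"
      unfolding z(2)
      using tensor_map_pure_tensor[OF mod mQ mod mQ' id natural_map_hom[OF S I J IJ] z(1) one]
        natural_map_coset[OF S I J IJ S.one_closed] by simp
    ultimately show ?thesis by simp
  qed
  obtain c where c: "c \<in> ?Z" "t = ?B +>\<^bsub>?T (Suc i)\<^esub> c"
    using t unfolding Tor_def homology_def cyc by (auto simp: a_r_coset_def')
  \<comment> \<open>\<open>quot_map\<close> evaluates at every representative in \<open>t\<close>.
    All of them are cycles, so \<open>key\<close> covers the whole coset at once.\<close>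
  have "t \<subseteq> ?Z"
    unfolding c(2) a_r_coset_def'
    using c(1) BZ Z unfolding T.submodule_iff by (auto simp: subset_iff)
  moreover have "t \<noteq> {}"
    unfolding c(2) a_r_coset_def' using T.submoduleE(2)[OF B(1)] by auto
  ultimately have "quot_map ((?T' (Suc i))\<lparr>carrier := ?Z'\<rparr>) ?B' ?\<phi> t = ?B'"
    using key by (intro quot_map_zero[OF mT' B(2)]) auto
  then show ?thesis
    unfolding Tor_map_def Tor_def homology_def cyc by simp
qed

section \<open>The Koszul complex and its contraction\<close>

lemma (in ideal) ideal_finsum: "f \<in> A \<rightarrow> I \<Longrightarrow> (\<Oplus>x\<in>A. f x) \<in> I"
proof (induction A rule: infinite_finite_induct)
  case (insert x A)
  then have "f \<in> A \<rightarrow> carrier R" "f x \<in> carrier R"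
    by (auto simp: Pi_iff)
  then show ?case
    using insert by (simp add: finsum_insert)
qed auto

text \<open>The terms at \<open>(v, w)\<close> and \<open>(w, v)\<close> cancel in pairs. The
  diagonal is left out, so characteristic two needs no separate treatment. In the induction a new
  index \<open>c\<close> brings one row and one column, which are negatives of each other.\<close>

lemma (in abelian_group) finsum_antisymmetric:
  assumes "finite A" "\<And>v w. v \<in> A \<Longrightarrow> w \<in> A \<Longrightarrow> g v w \<in> carrier G"
    and "\<And>v w. v \<in> A \<Longrightarrow> w \<in> A \<Longrightarrow> v \<noteq> w \<Longrightarrow> g w v = \<ominus> g v w"
  shows "(\<Oplus>v\<in>A. \<Oplus>w\<in>A - {v}. g v w) = \<zero>"
  using assms
proof (induction A rule: finite_induct)
  case (insert c A)
  note g = insert.prems(1)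
  have IH: "(\<Oplus>v\<in>A. \<Oplus>w\<in>A - {v}. g v w) = \<zero>"
  proof (rule insert.IH)
    show "g v w \<in> carrier G" if "v \<in> A" "w \<in> A" for v w
      using that by (intro g) auto
    show "g w v = \<ominus> g v w" if "v \<in> A" "w \<in> A" "v \<noteq> w" for v w
      using that by (intro insert.prems(2)) auto
  qed
  have "(\<Oplus>w\<in>insert c A - {v}. g v w) = \<ominus> g c v \<oplus> (\<Oplus>w\<in>A - {v}. g v w)" if v: "v \<in> A" for v
  proof -
    have "insert c A - {v} = insert c (A - {v})"
      using v insert.hyps by auto
    moreover have "(\<Oplus>w\<in>insert c (A - {v}). g v w) = g v c \<oplus> (\<Oplus>w\<in>A - {v}. g v w)"
      using v insert.hyps g by (intro finsum_insert) auto
    moreover have "g v c = \<ominus> g c v"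
      using v insert.hyps by (intro insert.prems(2)) auto
    ultimately show ?thesis
      by simp
  qed
  then have "(\<Oplus>v\<in>A. \<Oplus>w\<in>insert c A - {v}. g v w) = (\<Oplus>v\<in>A. \<ominus> g c v \<oplus> (\<Oplus>w\<in>A - {v}. g v w))"
    using g by (intro finsum_cong') (auto intro!: finsum_closed a_closed)
  also have "\<dots> = (\<Oplus>v\<in>A. \<ominus> g c v)"
    using g IH by (subst finsum_addf) (auto intro!: finsum_closed)
  finally have A: "(\<Oplus>v\<in>A. \<Oplus>w\<in>insert c A - {v}. g v w) = (\<Oplus>v\<in>A. \<ominus> g c v)" .
  have "insert c A - {c} = A"
    using insert.hyps by auto
  then have "(\<Oplus>v\<in>insert c A. \<Oplus>w\<in>insert c A - {v}. g v w)
      = (\<Oplus>w\<in>A. g c w) \<oplus> (\<Oplus>v\<in>A. \<Oplus>w\<in>insert c A - {v}. g v w)"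
    using insert.hyps g by (subst finsum_insert) (auto intro!: finsum_closed)
  also have "\<dots> = (\<Oplus>w\<in>A. g c w \<oplus> \<ominus> g c w)"
    unfolding A using g by (intro finsum_addf[symmetric]) auto
  also have "\<dots> = (\<Oplus>w\<in>A. \<zero>)"
    using g by (intro finsum_cong') (auto simp: r_neg)
  finally show ?case
    by simp
qed simp

text \<open>
  In the application \<open>E t\<close> sets \<open>y\<^sub>1, \<dots>, y\<^bsub>t-1\<^esub>\<close> to zero and \<open>D r\<close> is the operator \<open>d\<^sup>r\<close> with
  respect to the order \<open>y\<^sub>1, \<dots>, y\<^sub>n\<close> of the variables.
\<close>

locale difference_operators = cring R for R :: "'a ring" (structure) +
  fixes n :: nat and y :: "nat \<Rightarrow> 'a" and D E :: "nat \<Rightarrow> 'a \<Rightarrow> 'a"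
  assumes y_closed: "r \<in> {1..n} \<Longrightarrow> y r \<in> carrier R"
    and y_cancel: "r \<in> {1..n} \<Longrightarrow> a \<in> carrier R \<Longrightarrow> b \<in> carrier R \<Longrightarrow> y r \<otimes> a = y r \<otimes> b \<Longrightarrow> a = b"
    and E_closed: "t \<in> {1..Suc n} \<Longrightarrow> a \<in> carrier R \<Longrightarrow> E t a \<in> carrier R"
    and E_add: "t \<in> {1..Suc n} \<Longrightarrow> a \<in> carrier R \<Longrightarrow> b \<in> carrier R \<Longrightarrow> E t (a \<oplus> b) = E t a \<oplus> E t b"
    and E_mult: "t \<in> {1..Suc n} \<Longrightarrow> a \<in> carrier R \<Longrightarrow> b \<in> carrier R \<Longrightarrow> E t (a \<otimes> b) = E t a \<otimes> E t b"
    and E_1: "a \<in> carrier R \<Longrightarrow> E 1 a = a"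
    and E_y: "t \<in> {1..Suc n} \<Longrightarrow> r \<in> {1..n} \<Longrightarrow> E t (y r) = (if t \<le> r then y r else \<zero>)"
    and D_closed: "r \<in> {1..n} \<Longrightarrow> a \<in> carrier R \<Longrightarrow> D r a \<in> carrier R"
    and y_D: "r \<in> {1..n} \<Longrightarrow> a \<in> carrier R \<Longrightarrow> y r \<otimes> D r a \<oplus> E (Suc r) a = E r a"
begin

text \<open>Since \<open>y r\<close> can be cancelled, the relation \<open>y_D\<close> determines
  \<open>D r a\<close>. The rules for zero, sums and products below are obtained by checking this
  relation for the proposed value.\<close>

lemma D_eqI:
  assumes "r \<in> {1..n}" "a \<in> carrier R" "b \<in> carrier R" "y r \<otimes> b \<oplus> E (Suc r) a = E r a"
  shows "D r a = b"
proof -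
  have c: "y r \<in> carrier R" "D r a \<in> carrier R" "E (Suc r) a \<in> carrier R"
    using assms by (auto intro: y_closed D_closed E_closed)
  have "y r \<otimes> D r a \<oplus> E (Suc r) a = y r \<otimes> b \<oplus> E (Suc r) a"
    using y_D[OF assms(1,2)] assms(4) by simp
  then have "y r \<otimes> D r a = y r \<otimes> b"
    using c assms(3) by (simp only: add.right_cancel m_closed)
  then show ?thesis
    by (rule y_cancel[OF assms(1) c(2) assms(3)])
qed

lemma D_add:
  assumes "r \<in> {1..n}" "a \<in> carrier R" "b \<in> carrier R"
  shows "D r (a \<oplus> b) = D r a \<oplus> D r b"
proof (rule D_eqI)
  note c = y_closed[OF assms(1)] D_closed[OF assms(1)] E_closed
  have "y r \<otimes> (D r a \<oplus> D r b) \<oplus> E (Suc r) (a \<oplus> b)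
      = (y r \<otimes> D r a \<oplus> E (Suc r) a) \<oplus> (y r \<otimes> D r b \<oplus> E (Suc r) b)"
    using assms by (simp add: c E_add r_distr a_ac)
  then show "y r \<otimes> (D r a \<oplus> D r b) \<oplus> E (Suc r) (a \<oplus> b) = E r (a \<oplus> b)"
    using assms by (simp add: y_D E_add)
qed (use assms D_closed in auto)

text \<open>\<open>y r \<otimes> D r\<close> is the difference of the multiplicative maps
  \<open>E r\<close> and \<open>E (Suc r)\<close>. The difference of the two products is split by
  inserting the mixed term \<open>E r a \<otimes> E (Suc r) b\<close>.\<close>

lemma D_mult:
  assumes "r \<in> {1..n}" "a \<in> carrier R" "b \<in> carrier R"
  shows "D r (a \<otimes> b) = E r a \<otimes> D r b \<oplus> D r a \<otimes> E (Suc r) b"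
proof (rule D_eqI)
  have c: "y r \<in> carrier R" "D r a \<in> carrier R" "D r b \<in> carrier R"
    "E r a \<in> carrier R" "E (Suc r) a \<in> carrier R" "E (Suc r) b \<in> carrier R"
    using assms by (auto intro: y_closed D_closed E_closed)
  have "y r \<otimes> (E r a \<otimes> D r b \<oplus> D r a \<otimes> E (Suc r) b) \<oplus> E (Suc r) a \<otimes> E (Suc r) b
      = E r a \<otimes> (y r \<otimes> D r b) \<oplus> (y r \<otimes> D r a \<oplus> E (Suc r) a) \<otimes> E (Suc r) b"
    using c by (simp add: r_distr l_distr m_ac a_ac)
  also have "\<dots> = E r a \<otimes> (y r \<otimes> D r b) \<oplus> E r a \<otimes> E (Suc r) b"
    by (simp only: y_D[OF assms(1,2)])
  also have "\<dots> = E r a \<otimes> (y r \<otimes> D r b \<oplus> E (Suc r) b)"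
    using c by (simp add: r_distr)
  finally show "y r \<otimes> (E r a \<otimes> D r b \<oplus> D r a \<otimes> E (Suc r) b) \<oplus> E (Suc r) (a \<otimes> b) = E r (a \<otimes> b)"
    using assms by (simp add: y_D E_mult)
qed (use assms D_closed E_closed in auto)

lemma E_zero: "t \<in> {1..Suc n} \<Longrightarrow> E t \<zero> = \<zero>"
  using E_add[of t \<zero> \<zero>] E_closed[of t \<zero>] by simp

lemma D_zero: "r \<in> {1..n} \<Longrightarrow> D r \<zero> = \<zero>"
  by (rule D_eqI) (simp_all add: E_zero y_closed)

lemma D_minus:
  assumes "r \<in> {1..n}" "a \<in> carrier R"
  shows "D r (\<ominus> a) = \<ominus> D r a"
proof -
  have "D r (\<ominus> a) \<oplus> D r a = \<zero>"
    using D_add[of r "\<ominus> a" a] assms D_zero by (simp add: l_neg)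
  then show ?thesis
    using assms D_closed by (simp add: minus_equality)
qed

lemma D_finsum:
  assumes "r \<in> {1..n}" "f \<in> A \<rightarrow> carrier R"
  shows "D r (\<Oplus>x\<in>A. f x) = (\<Oplus>x\<in>A. D r (f x))"
  using assms(2)
proof (induction A rule: infinite_finite_induct)
  case (insert x A)
  then show ?case
    using assms(1) by (auto simp: finsum_insert Pi_iff D_add D_closed)
qed (use assms(1) in \<open>simp_all add: D_zero\<close>)

text \<open>A later variable passes through \<open>D r\<close>, the variable \<open>y r\<close>
  itself is divided out, and an earlier one has already been set to zero. These three cases drive
  the contraction.\<close>

lemma D_y_mult:
  assumes r: "r \<in> {1..n}" and v: "v \<in> {1..n}" and a: "a \<in> carrier R"
  shows "D r (y v \<otimes> a) = (if r < v then y v \<otimes> D r a else if r = v then E r a else \<zero>)"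
proof -
  have "D r (y v) = (if r = v then \<one> else \<zero>)"
    using r v by (intro D_eqI; cases r v rule: linorder_cases) (simp_all add: y_closed E_y)
  then show ?thesis
    using r v a y_D[OF r a]
    by (auto simp: D_mult y_closed E_y D_closed E_closed)
qed

text \<open>A telescope: each term is \<open>E v a\<close> minus \<open>E (Suc v) a\<close>, and it
  starts at \<open>E 1 a = a\<close>.\<close>

lemma y_D_sum_below:
  assumes "a \<in> carrier R" "t \<in> {1..Suc n}"
  shows "(\<Oplus>v\<in>{1..<t}. y v \<otimes> D v a) \<oplus> E t a = a"
  using assms(2)
proof (induction t)
  case (Suc t)
  show ?case
  proof (cases "t = 0")
    case True
    then show ?thesis
      using E_1[OF assms(1)] assms(1) by simp
  next
    case False
    then have t: "t \<in> {1..n}" using Suc.prems by simp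
    have c: "y v \<otimes> D v a \<in> carrier R" if "v \<in> {1..<Suc t}" for v
      using that t assms(1) by (simp add: y_closed D_closed)
    have "{1..<Suc t} = insert t {1..<t}"
      using t by auto
    then have "(\<Oplus>v\<in>{1..<Suc t}. y v \<otimes> D v a) = y t \<otimes> D t a \<oplus> (\<Oplus>v\<in>{1..<t}. y v \<otimes> D v a)"
      using c by (simp add: finsum_insert Pi_iff)
    then have "(\<Oplus>v\<in>{1..<Suc t}. y v \<otimes> D v a) \<oplus> E (Suc t) a
        = (\<Oplus>v\<in>{1..<t}. y v \<otimes> D v a) \<oplus> (y t \<otimes> D t a \<oplus> E (Suc t) a)"
      using c t assms(1) by (simp add: a_ac Pi_iff E_closed)
    then show ?thesis
      using t assms(1) Suc.IH by (simp add: y_D)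
  qed
qed simp

text \<open>Descend from \<open>Suc n\<close> by the relation \<open>y_D\<close>, which adds a
  multiple of \<open>D r a\<close> at each step. At \<open>t = 1\<close> the conclusion is that
  \<open>a\<close> itself lies in \<open>J\<close>.\<close>

lemma E_mem_ideal:
  assumes "ideal J R" "a \<in> carrier R" "E (Suc n) a \<in> J" "\<And>r. r \<in> {1..n} \<Longrightarrow> D r a \<in> J" "t \<in> {1..Suc n}"
  shows "E t a \<in> J"
proof -
  interpret J: ideal J R by fact
  have "t \<le> Suc n" using assms(5) by simp
  then show ?thesis
  proof (induction rule: inc_induct)
    case base
    then show ?case using assms(3) .
  next
    case (step r)
    then have r: "r \<in> {1..n}" using assms(5) by auto
    have "y r \<otimes> D r a \<oplus> E (Suc r) a \<in> J"
      using step r assms(4) by (intro J.a_closed J.I_l_closed y_closed) auto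
    then show ?case
      using y_D[OF r assms(2)] by simp
  qed
qed

text \<open>The conditions defining \<open>?A\<close> are stable under multiplication although
  \<open>D r\<close> is not linear: in the twisted Leibniz rule the second factor
  \<open>E (Suc r) a\<close> lies in \<open>J\<close> by \<open>E_mem_ideal\<close>. Hence
  \<open>?A\<close> is an ideal containing the generators.\<close>

lemma D_genideal:
  assumes "F \<subseteq> carrier R" "ideal J R" "\<And>f. f \<in> F \<Longrightarrow> E (Suc n) f = \<zero>"
    and "\<And>r f. r \<in> {1..n} \<Longrightarrow> f \<in> F \<Longrightarrow> D r f \<in> J"
    and a: "a \<in> Idl F"
  shows "E (Suc n) a = \<zero>" and "r \<in> {1..n} \<Longrightarrow> D r a \<in> J" and "a \<in> J"
proof -
  interpret J: ideal J R by fact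
  let ?A = "{a \<in> carrier R. E (Suc n) a = \<zero> \<and> (\<forall>r\<in>{1..n}. D r a \<in> J)}"
  have mult: "b \<otimes> a \<in> ?A" if a: "a \<in> ?A" and b: "b \<in> carrier R" for a b
  proof -
    have "E (Suc r) a \<in> J" if "r \<in> {1..n}" for r
      by (rule E_mem_ideal[OF assms(2)]) (use a that in auto)
    then have "D r (b \<otimes> a) \<in> J" if "r \<in> {1..n}" for r
      using a b that
      by (simp add: D_mult E_closed D_closed J.a_closed J.I_l_closed)
    moreover have "E (Suc n) (b \<otimes> a) = \<zero>"
      using a b E_closed[of "Suc n" b] by (simp add: E_mult)
    ultimately show ?thesis
      using a b by simp
  qed
  have A: "ideal ?A R"
  proof (rule idealI)
    show "subgroup ?A (add_monoid R)"
    proof (rule add.subgroupI)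
      show "?A \<noteq> {}"
        using E_zero[of "Suc n"] D_zero by (auto intro!: exI[of _ \<zero>])
      show "\<ominus> a \<in> ?A" if "a \<in> ?A" for a
        using mult[OF that, of "\<ominus> \<one>"] that by (simp add: l_minus)
      show "a \<oplus> b \<in> ?A" if "a \<in> ?A" "b \<in> ?A" for a b
        using that by (simp add: E_add D_add)
    qed simp
    show "b \<otimes> a \<in> ?A" if "a \<in> ?A" "b \<in> carrier R" for a b
      by (rule mult[OF that])
    then show "a \<otimes> b \<in> ?A" if "a \<in> ?A" "b \<in> carrier R" for a b
      using mult[OF that] that m_comm[of b a] by simp
  qed (rule ring_axioms)
  have "Idl F \<subseteq> ?A"
    using assms(1,3,4) by (intro genideal_minimal[OF A]) auto
  then have aA: "a \<in> ?A" using a by blast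
  then show "E (Suc n) a = \<zero>" "r \<in> {1..n} \<Longrightarrow> D r a \<in> J"
    by auto
  show "a \<in> J"
    using E_mem_ideal[OF assms(2), of a 1] aA E_1 by auto
qed

text \<open>The sign that arises when \<open>e\<^sub>v\<close> is moved past the smaller factors of
  \<open>e\<^sub>T\<close> to its sorted place.\<close>

definition koszul_sign :: "nat \<Rightarrow> nat set \<Rightarrow> 'a" where
  "koszul_sign v T = (if even (card {w \<in> T. w < v}) then \<one> else \<ominus> \<one>)"

definition koszul :: "nat \<Rightarrow> ('a, nat set \<Rightarrow> 'a) module" where
  "koszul i = free_module R {T. T \<subseteq> {1..n} \<and> card T = i}"

text \<open>The usual Koszul differential read off at the coefficient of \<open>e\<^sub>T\<close>:
  each index set with one more element \<open>v\<close> contributes once. The formula is the same in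
  all degrees, so one function serves the whole complex.\<close>

definition koszul_d :: "(nat set \<Rightarrow> 'a) \<Rightarrow> nat set \<Rightarrow> 'a" where
  "koszul_d u T = (if T \<subseteq> {1..n}
     then \<Oplus>v\<in>{1..n} - T. koszul_sign v T \<otimes> (y v \<otimes> u (insert v T)) else \<zero>)"

text \<open>In terms of basis elements, \<open>f e\<^sub>T\<close> is sent to the sum of \<open>D\<^sub>r f e\<^sub>r \<and> e\<^sub>T\<close> over \<open>r < Min T\<close>.\<close>

definition koszul_s :: "(nat set \<Rightarrow> 'a) \<Rightarrow> nat set \<Rightarrow> 'a" where
  "koszul_s u T = (if T \<subseteq> {1..n} \<and> T \<noteq> {} then D (Min T) (u (T - {Min T})) else \<zero>)"

lemma koszul_sign_closed: "koszul_sign v T \<in> carrier R"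
  by (simp add: koszul_sign_def)

lemma koszul_sign_insert:
  assumes "finite T" "v \<notin> T"
  shows "koszul_sign w (insert v T) = (if v < w then \<ominus> koszul_sign w T else koszul_sign w T)"
proof -
  have "{x \<in> insert v T. x < w} = (if v < w then insert v {x \<in> T. x < w} else {x \<in> T. x < w})"
    by auto
  then show ?thesis
    using assms by (simp add: koszul_sign_def)
qed

lemma mem_koszul:
  "u \<in> carrier (koszul i) \<longleftrightarrow>
     (\<forall>T. u T \<in> carrier R) \<and> (\<forall>T. u T \<noteq> \<zero> \<longrightarrow> T \<subseteq> {1..n} \<and> card T = i)"
proof -
  have "finite {T. u T \<noteq> \<zero>}" if "{T. u T \<noteq> \<zero>} \<subseteq> {T. T \<subseteq> {1..n} \<and> card T = i}"
    using that by (rule finite_subset) auto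
  then show ?thesis
    unfolding koszul_def mem_free_module by auto
qed

lemma koszul_sel [simp]:
  "\<zero>\<^bsub>koszul i\<^esub> = (\<lambda>T. \<zero>)"
  "u \<oplus>\<^bsub>koszul i\<^esub> v = (\<lambda>T. u T \<oplus> v T)"
  "a \<odot>\<^bsub>koszul i\<^esub> u = (\<lambda>T. a \<otimes> u T)"
  by (simp_all add: koszul_def)

lemma module_koszul: "module R (koszul i)"
  unfolding koszul_def by (rule module_free_module) (rule cring_axioms)

lemma koszul_d_term_closed:
  "a \<in> carrier R \<Longrightarrow> v \<in> {1..n} \<Longrightarrow> koszul_sign v T \<otimes> (y v \<otimes> a) \<in> carrier R"
  by (intro m_closed koszul_sign_closed y_closed)

lemma koszul_d_hom: "koszul_d \<in> module_hom R (koszul (Suc i)) (koszul i)"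
proof (rule module_homI)
  note t = koszul_d_term_closed
  fix u assume u: "u \<in> carrier (koszul (Suc i))"
  then have uc: "\<And>T. u T \<in> carrier R" by (simp add: mem_koszul)
  show "koszul_d u \<in> carrier (koszul i)"
    unfolding mem_koszul
  proof (intro conjI allI impI)
    fix T
    show "koszul_d u T \<in> carrier R"
      unfolding koszul_d_def using t[OF uc] by (auto intro!: finsum_closed)
    assume *: "koszul_d u T \<noteq> \<zero>"
    then show T: "T \<subseteq> {1..n}"
      by (auto simp: koszul_d_def split: if_splits)
    \<comment> \<open>A nonzero coefficient needs a nonzero term, and that term lives on a set with
      \<open>Suc i\<close> elements.\<close>
    have "\<exists>v\<in>{1..n} - T. u (insert v T) \<noteq> \<zero>"
    proof (rule ccontr)
      assume "\<not> ?thesis"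
      then have "(\<Oplus>v\<in>{1..n} - T. koszul_sign v T \<otimes> (y v \<otimes> u (insert v T))) = (\<Oplus>v\<in>{1..n} - T. \<zero>)"
        by (intro finsum_cong') (simp_all add: y_closed koszul_sign_closed)
      then show False using * T by (simp add: koszul_d_def)
    qed
    then obtain v where "v \<notin> T" "card (insert v T) = Suc i"
      using u unfolding mem_koszul by blast
    then show "card T = i"
      using finite_subset[OF T] by simp
  qed
  show "koszul_d (a \<odot>\<^bsub>koszul (Suc i)\<^esub> u) = a \<odot>\<^bsub>koszul i\<^esub> koszul_d u" if a: "a \<in> carrier R" for a
  proof
    fix T
    show "koszul_d (a \<odot>\<^bsub>koszul (Suc i)\<^esub> u) T = (a \<odot>\<^bsub>koszul i\<^esub> koszul_d u) T"
      using a uc t[OF uc]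
      by (auto simp: koszul_d_def finsum_rdistr Pi_iff koszul_sign_closed y_closed m_lcomm
        intro!: finsum_cong')
  qed
  fix w assume "w \<in> carrier (koszul (Suc i))"
  then have wc: "\<And>T. w T \<in> carrier R" by (simp add: mem_koszul)
  show "koszul_d (u \<oplus>\<^bsub>koszul (Suc i)\<^esub> w) = koszul_d u \<oplus>\<^bsub>koszul i\<^esub> koszul_d w"
  proof
    fix T
    show "koszul_d (u \<oplus>\<^bsub>koszul (Suc i)\<^esub> w) T = (koszul_d u \<oplus>\<^bsub>koszul i\<^esub> koszul_d w) T"
    proof (cases "T \<subseteq> {1..n}")
      case True
      have "(\<Oplus>v\<in>{1..n} - T. koszul_sign v T \<otimes> (y v \<otimes> (u (insert v T) \<oplus> w (insert v T))))
          = (\<Oplus>v\<in>{1..n} - T. koszul_sign v T \<otimes> (y v \<otimes> u (insert v T)) \<oplus>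
              koszul_sign v T \<otimes> (y v \<otimes> w (insert v T)))"
        using uc wc by (intro finsum_cong') (auto simp: koszul_sign_closed y_closed r_distr)
      also have "\<dots> = (\<Oplus>v\<in>{1..n} - T. koszul_sign v T \<otimes> (y v \<otimes> u (insert v T))) \<oplus>
          (\<Oplus>v\<in>{1..n} - T. koszul_sign v T \<otimes> (y v \<otimes> w (insert v T)))"
        using t[OF uc] t[OF wc] by (intro finsum_addf) auto
      finally show ?thesis
        using True by (simp add: koszul_d_def)
    qed (simp add: koszul_d_def)
  qed
qed

lemma koszul_d_d:
  assumes "u \<in> carrier (koszul (Suc (Suc i)))"
  shows "koszul_d (koszul_d u) = (\<lambda>T. \<zero>)"
proof
  fix T
  have uc: "\<And>T. u T \<in> carrier R" using assms by (simp add: mem_koszul)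
  show "koszul_d (koszul_d u) T = \<zero>"
  proof (cases "T \<subseteq> {1..n}")
    case True
    then have fin: "finite T" by (rule finite_subset) simp
    let ?C = "{1..n} - T"
    let ?g = "\<lambda>v w. (koszul_sign v T \<otimes> koszul_sign w (insert v T)) \<otimes> ((y v \<otimes> y w) \<otimes> u (insert v (insert w T)))"
    have g: "?g v w \<in> carrier R" if "v \<in> ?C" "w \<in> ?C" for v w
      using that uc by (simp add: koszul_sign_closed y_closed)
    have "koszul_d (koszul_d u) T
        = (\<Oplus>v\<in>?C. koszul_sign v T \<otimes> (y v \<otimes> (\<Oplus>w\<in>?C - {v}. koszul_sign w (insert v T) \<otimes> (y w \<otimes> u (insert w (insert v T))))))"
    proof -
      have "{1..n} - insert v T = ?C - {v}" for v by auto
      then show ?thesis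
        unfolding koszul_d_def[of "koszul_d u"]
        using True uc by (auto simp: koszul_d_def koszul_sign_closed y_closed Pi_iff intro!: finsum_cong')
    qed
    also have "\<dots> = (\<Oplus>v\<in>?C. \<Oplus>w\<in>?C - {v}. ?g v w)"
    proof (rule finsum_cong')
      fix v assume v: "v \<in> ?C"
      have "koszul_sign v T \<otimes> (y v \<otimes> (\<Oplus>w\<in>?C - {v}. koszul_sign w (insert v T) \<otimes> (y w \<otimes> u (insert w (insert v T)))))
        = (\<Oplus>w\<in>?C - {v}. koszul_sign v T \<otimes> (y v \<otimes> (koszul_sign w (insert v T) \<otimes> (y w \<otimes> u (insert w (insert v T))))))"
        using v uc by (simp add: finsum_rdistr Pi_iff koszul_sign_closed y_closed)
      also have "\<dots> = (\<Oplus>w\<in>?C - {v}. ?g v w)"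
        using v uc g
        by (intro finsum_cong') (auto simp: koszul_sign_closed y_closed m_ac insert_commute)
      finally show "koszul_sign v T \<otimes> (y v \<otimes> (\<Oplus>w\<in>?C - {v}. koszul_sign w (insert v T) \<otimes> (y w \<otimes> u (insert w (insert v T)))))
        = (\<Oplus>w\<in>?C - {v}. ?g v w)" .
    qed (use g in auto)
    also have "\<dots> = \<zero>"
    proof (rule finsum_antisymmetric)
      fix v w assume v: "v \<in> ?C" and w: "w \<in> ?C" and ne: "v \<noteq> w"
      \<comment> \<open>Exactly one of \<open>v < w\<close> and \<open>w < v\<close> holds, so
        exactly one of the two inserted indices flips the sign of the other.\<close>
      have "koszul_sign w T \<otimes> koszul_sign v (insert w T) = \<ominus> (koszul_sign v T \<otimes> koszul_sign w (insert v T))"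
        using v w ne fin by (auto simp: koszul_sign_insert koszul_sign_closed m_comm r_minus l_minus)
      moreover have "(y w \<otimes> y v) \<otimes> u (insert w (insert v T)) = (y v \<otimes> y w) \<otimes> u (insert v (insert w T))"
        using v w by (simp add: insert_commute m_comm y_closed)
      ultimately show "?g w v = \<ominus> ?g v w"
        using v w uc by (simp add: l_minus koszul_sign_closed y_closed)
    qed (use g in auto)
    finally show ?thesis .
  qed (simp add: koszul_d_def)
qed

section \<open>The contracting homotopy\<close>

lemma koszul_s_closed:
  assumes "u \<in> carrier (koszul i)"
  shows "koszul_s u \<in> carrier (koszul (Suc i))"
  unfolding mem_koszul
proof (intro conjI allI impI)
  fix T
  have Min: "Min T \<in> T" "Min T \<in> {1..n}" if "T \<subseteq> {1..n}" "T \<noteq> {}"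
  proof -
    show "Min T \<in> T"
      using that finite_subset[of T "{1..n}"] by (intro Min_in) auto
    then show "Min T \<in> {1..n}"
      using that by blast
  qed
  show "koszul_s u T \<in> carrier R"
    using assms D_closed[OF Min(2)] by (cases "T \<subseteq> {1..n} \<and> T \<noteq> {}") (auto simp: koszul_s_def mem_koszul)
  assume *: "koszul_s u T \<noteq> \<zero>"
  then have T: "T \<subseteq> {1..n}" "T \<noteq> {}"
    by (auto simp: koszul_s_def split: if_splits)
  then show "T \<subseteq> {1..n}" by simp
  have fin: "finite T" using T finite_subset by auto
  have "u (T - {Min T}) \<noteq> \<zero>"
    using * T Min[OF T] D_zero by (auto simp: koszul_s_def)
  then have "card (T - {Min T}) = i"
    using assms by (simp add: mem_koszul)
  then show "card T = Suc i"
    using Min[OF T] fin by (metis card_Suc_Diff1)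
qed

text \<open>Here the telescope runs through all variables and stops at \<open>E (Suc n)\<close>.
  This defect is what the augmentation sees; it vanishes on the ideal of the variables.\<close>

lemma koszul_contraction_0:
  assumes "u \<in> carrier (koszul 0)"
  shows "koszul_d (koszul_s u) {} \<oplus> E (Suc n) (u {}) = u {}"
proof -
  have uc: "u {} \<in> carrier R" using assms by (simp add: mem_koszul)
  have "koszul_d (koszul_s u) {} = (\<Oplus>v\<in>{1..n}. y v \<otimes> D v (u {}))"
    using uc by (auto simp: koszul_d_def koszul_s_def koszul_sign_def D_closed y_closed intro!: finsum_cong')
  then show ?thesis
    using y_D_sum_below[OF uc, of "Suc n"] by (simp add: atLeastLessThanSuc_atLeastAtMost)
qed

text \<open>Compare coefficients at a nonempty \<open>T\<close> with minimum \<open>t\<close>. In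
  \<open>d s u\<close> the indices below \<open>t\<close> give the telescope up to \<open>t\<close>.
  In \<open>s d u\<close> the index \<open>t\<close> gives \<open>E t (u T)\<close>, which completes
  it, and indices below \<open>t\<close> give zero. Indices above \<open>t\<close> occur in both
  with opposite signs.\<close>

lemma koszul_contraction:
  assumes "u \<in> carrier (koszul (Suc i))"
  shows "koszul_s (koszul_d u) \<oplus>\<^bsub>koszul (Suc i)\<^esub> koszul_d (koszul_s u) = u"
proof
  fix T
  have uc: "\<And>T. u T \<in> carrier R" using assms by (simp add: mem_koszul)
  consider "\<not> T \<subseteq> {1..n}" | "T = {}" | "T \<subseteq> {1..n}" "T \<noteq> {}" by blast
  then show "(koszul_s (koszul_d u) \<oplus>\<^bsub>koszul (Suc i)\<^esub> koszul_d (koszul_s u)) T = u T"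
  proof cases
    case 1
    then have "u T = \<zero>" using assms by (auto simp: mem_koszul)
    then show ?thesis using 1 by (simp add: koszul_d_def koszul_s_def)
  next
    case 2
    then have "u T = \<zero>" using assms by (auto simp: mem_koszul)
    \<comment> \<open>All terms come from \<open>D v (u {})\<close>, and \<open>u {}\<close>
      vanishes in positive degree.\<close>
    moreover have "koszul_d (koszul_s u) {} = (\<Oplus>v\<in>{1..n}. \<zero>)"
    proof -
      have "koszul_d (koszul_s u) {} = (\<Oplus>v\<in>{1..n}. koszul_sign v {} \<otimes> (y v \<otimes> koszul_s u {v}))"
        by (simp add: koszul_d_def)
      also have "\<dots> = (\<Oplus>v\<in>{1..n}. \<zero>)"
        using 2 \<open>u T = \<zero>\<close>
        by (intro finsum_cong') (simp_all add: koszul_s_def D_zero y_closed koszul_sign_closed)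
      finally show ?thesis .
    qed
    ultimately show ?thesis using 2 by (simp add: koszul_s_def)
  next
    case 3
    have fin: "finite T" using 3 finite_subset by auto
    define t where "t = Min T"
    have t: "t \<in> T" "t \<in> {1..n}" and t_min: "\<And>w. w \<in> T \<Longrightarrow> t \<le> w"
      using 3 fin by (auto simp: t_def subset_iff)
    define T0 where "T0 = T - {t}"
    have T: "T = insert t T0" "t \<notin> T0" "finite T0" "T0 \<subseteq> {1..n}"
      using t fin 3 by (auto simp: T0_def)
    \<comment> \<open>Nothing below the minimum \<open>t\<close> belongs to \<open>T\<close>, so
      \<open>?A\<close> and \<open>?B\<close> exhaust the complement of \<open>T\<close>, and
      passing to \<open>T0\<close> adds only \<open>t\<close>.\<close>
    let ?A = "{1..<t}" and ?B = "{t<..n} - T"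
    let ?g = "\<lambda>v. koszul_sign v T \<otimes> (y v \<otimes> D t (u (insert v T0)))"
    have AB: "v \<in> {1..n} \<and> v \<notin> T" if "v \<in> ?A \<union> ?B" for v
      using that t t_min by fastforce
    have nT: "{1..n} - T = ?A \<union> ?B"
    proof
      show "{1..n} - T \<subseteq> ?A \<union> ?B"
      proof
        fix v assume v: "v \<in> {1..n} - T"
        then have "v \<noteq> t" using t by auto
        then show "v \<in> ?A \<union> ?B" using v by (cases "v < t") auto
      qed
    qed (use AB in blast)
    have nT0: "{1..n} - T0 = insert t (?A \<union> ?B)"
      using t unfolding nT[symmetric] T0_def by blast
    have g: "?g v \<in> carrier R" if "v \<in> ?B" for v
      using that t uc AB by (intro m_closed koszul_sign_closed y_closed D_closed) auto
    have yD: "y v \<otimes> D v (u T) \<in> carrier R" if "v \<in> ?A" for v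
      using that AB uc by (intro m_closed y_closed D_closed) auto
    have sum_d_s: "koszul_d (koszul_s u) T = (\<Oplus>v\<in>?A. y v \<otimes> D v (u T)) \<oplus> (\<Oplus>v\<in>?B. ?g v)"
    proof -
      let ?h = "\<lambda>v. koszul_sign v T \<otimes> (y v \<otimes> koszul_s u (insert v T))"
      \<comment> \<open>No element of \<open>T\<close> precedes \<open>v\<close>, so the sign is
        one. Being the new minimum, \<open>v\<close> is removed again by \<open>s\<close>, which
        leaves \<open>u T\<close>.\<close>
      have hA: "?h v = y v \<otimes> D v (u T)" if v: "v \<in> ?A" for v
      proof -
        have "{w \<in> T. w < v} = {}" using v t_min by fastforce
        then have "koszul_sign v T = \<one>" by (simp only: koszul_sign_def) simp
        moreover have "Min (insert v T) = v"
          using v t_min fin 3 by (intro Min_eqI) fastforce+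
        moreover have "insert v T - {v} = T" "insert v T \<subseteq> {1..n}" using AB[of v] v 3 by auto
        ultimately show ?thesis
          using v yD[OF v] by (simp add: koszul_s_def)
      qed
      \<comment> \<open>The minimum is still \<open>t\<close>, so \<open>s\<close> removes
        \<open>t\<close> and keeps \<open>v\<close>.\<close>
      have hB: "?h v = ?g v" if v: "v \<in> ?B" for v
      proof -
        have "Min (insert v T) = t"
          using v t t_min fin by (intro Min_eqI) fastforce+
        moreover have "insert v T - {t} = insert v T0" "insert v T \<subseteq> {1..n}"
          using v AB[of v] 3 by (auto simp: T0_def)
        ultimately show ?thesis
          by (simp add: koszul_s_def)
      qed
      have "koszul_d (koszul_s u) T = (\<Oplus>v\<in>?A \<union> ?B. ?h v)"
        unfolding nT[symmetric] using 3 by (simp add: koszul_d_def)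
      also have "\<dots> = (\<Oplus>v\<in>?A. ?h v) \<oplus> (\<Oplus>v\<in>?B. ?h v)"
        using yD g by (intro finsum_Un_disjoint) (auto simp: hA hB)
      also have "(\<Oplus>v\<in>?A. ?h v) = (\<Oplus>v\<in>?A. y v \<otimes> D v (u T))"
        using yD by (intro finsum_cong') (auto simp: hA)
      also have "(\<Oplus>v\<in>?B. ?h v) = (\<Oplus>v\<in>?B. ?g v)"
        using g by (intro finsum_cong') (auto simp: hB)
      finally show ?thesis .
    qed
    have sum_s_d: "koszul_s (koszul_d u) T = E t (u T) \<oplus> \<ominus> (\<Oplus>v\<in>?B. ?g v)"
    proof -
      let ?h = "\<lambda>v. D t (koszul_sign v T0 \<otimes> (y v \<otimes> u (insert v T0)))"
      \<comment> \<open>Signs are plus or minus one, so additivity of \<open>D t\<close> suffices to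
        pull them out.\<close>
      have Dsign: "D t (koszul_sign v T' \<otimes> a) = koszul_sign v T' \<otimes> D t a" if "a \<in> carrier R" for v T' a
        using that t(2) by (auto simp: koszul_sign_def D_closed l_minus D_minus)
      have ht: "?h t = E t (u T)"
      proof -
        have "{w \<in> T0. w < t} = {}" using t_min by (fastforce simp: T0_def)
        then have "koszul_sign t T0 = \<one>" by (simp only: koszul_sign_def) simp
        then show ?thesis
          using t uc by (simp add: D_y_mult y_closed flip: T(1))
      qed
      have hA: "?h v = \<zero>" if v: "v \<in> ?A" for v
        using v AB[of v] t uc by (simp add: Dsign y_closed D_y_mult koszul_sign_closed)
      \<comment> \<open>Since \<open>t < v\<close>, deleting \<open>t\<close> from \<open>T\<close>
        flips the sign at \<open>v\<close>, while \<open>D t\<close> passes through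
        \<open>y v\<close>.\<close>
      have hB: "?h v = \<ominus> ?g v" if v: "v \<in> ?B" for v
      proof -
        have "koszul_sign v T = \<ominus> koszul_sign v T0"
          using v T by (simp add: koszul_sign_insert)
        then show ?thesis
          using v AB[of v] t uc
          by (simp add: Dsign y_closed D_y_mult koszul_sign_closed l_minus D_closed)
      qed
      have c: "koszul_sign v T0 \<otimes> (y v \<otimes> u (insert v T0)) \<in> carrier R" if "v \<in> {1..n}" for v
        using koszul_d_term_closed[OF uc that] .
      have "koszul_s (koszul_d u) T = D t (koszul_d u T0)"
        using 3 by (simp add: koszul_s_def t_def T0_def)
      also have "koszul_d u T0 = (\<Oplus>v\<in>insert t (?A \<union> ?B). koszul_sign v T0 \<otimes> (y v \<otimes> u (insert v T0)))"
        unfolding nT0[symmetric] using T(4) by (simp add: koszul_d_def)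
      also have "D t \<dots> = (\<Oplus>v\<in>insert t (?A \<union> ?B). ?h v)"
        using c t AB by (intro D_finsum) blast+
      also have "\<dots> = ?h t \<oplus> (\<Oplus>v\<in>?A \<union> ?B. ?h v)"
        using t c AB D_closed[OF t(2)] by (intro finsum_insert) auto
      also have "(\<Oplus>v\<in>?A \<union> ?B. ?h v) = (\<Oplus>v\<in>?A. ?h v) \<oplus> (\<Oplus>v\<in>?B. ?h v)"
        using t c AB D_closed[OF t(2)] by (intro finsum_Un_disjoint) auto
      also have "(\<Oplus>v\<in>?A. ?h v) = (\<Oplus>v\<in>?A. \<zero>)"
        by (intro finsum_cong') (auto simp: hA)
      also have "(\<Oplus>v\<in>?B. ?h v) = (\<Oplus>v\<in>?B. \<ominus> ?g v)"
        using g by (intro finsum_cong') (auto simp: hB)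
      also have "(\<Oplus>v\<in>?B. \<ominus> ?g v) = \<ominus> (\<Oplus>v\<in>?B. ?g v)"
      proof -
        have "(\<Oplus>v\<in>?B. \<ominus> ?g v) \<oplus> (\<Oplus>v\<in>?B. ?g v) = (\<Oplus>v\<in>?B. \<ominus> ?g v \<oplus> ?g v)"
          using g by (intro finsum_addf[symmetric]) auto
        also have "\<dots> = (\<Oplus>v\<in>?B. \<zero>)"
          using g by (intro finsum_cong') (auto simp: l_neg)
        finally show ?thesis
          using g by (intro minus_equality[symmetric]) (auto intro!: finsum_closed)
      qed
      finally show ?thesis
        using g ht by (simp add: finsum_closed Pi_iff)
    qed
    have c: "E t (u T) \<in> carrier R" "(\<Oplus>v\<in>?B. ?g v) \<in> carrier R" "(\<Oplus>v\<in>?A. y v \<otimes> D v (u T)) \<in> carrier R"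
      using g yD t uc by (auto intro!: finsum_closed E_closed)
    have "(koszul_s (koszul_d u) \<oplus>\<^bsub>koszul (Suc i)\<^esub> koszul_d (koszul_s u)) T
        = ((\<Oplus>v\<in>?A. y v \<otimes> D v (u T)) \<oplus> E t (u T)) \<oplus> ((\<Oplus>v\<in>?B. ?g v) \<oplus> \<ominus> (\<Oplus>v\<in>?B. ?g v))"
      using c by (simp only: koszul_sel sum_d_s sum_s_d a_ac a_closed a_inv_closed)
    also have "\<dots> = u T"
      using c y_D_sum_below[OF uc[of T], of t] t uc by (simp add: r_neg)
    finally show ?thesis .
  qed
qed

section \<open>Exactness of the Koszul complex and cycles modulo an ideal\<close>

abbreviation koszul_ideal :: "'a set" where
  "koszul_ideal \<equiv> Idl (y ` {1..n})"

definition koszul_e :: "(nat set \<Rightarrow> 'a) \<Rightarrow> 'a set" where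
  "koszul_e u = koszul_ideal +>\<^bsub>self_module R\<^esub> u {}"

lemma ideal_koszul_ideal: "ideal koszul_ideal R"
  by (rule genideal_ideal) (auto simp: y_closed)

lemma koszul_ideal_E: "a \<in> koszul_ideal \<Longrightarrow> E (Suc n) a = \<zero>"
proof -
  assume a: "a \<in> koszul_ideal"
  show ?thesis
    \<comment> \<open>With the whole ring in place of \<open>J\<close>, the conditions on
      \<open>D\<close> are trivial and only the statement on \<open>E (Suc n)\<close>
      remains.\<close>
    by (rule D_genideal(1)[OF _ oneideal _ _ a]) (auto simp: y_closed E_y D_closed)
qed

lemma koszul_0_eq: "u \<in> carrier (koszul 0) \<Longrightarrow> T \<noteq> {} \<Longrightarrow> u T = \<zero>"
  unfolding mem_koszul using finite_subset[of T "{1..n}"] by auto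

text \<open>On the ideal of the variables the correction \<open>E (Suc n)\<close> vanishes, so
  \<open>koszul_s u\<close> is a preimage of \<open>u\<close>. Conversely every term of a boundary
  is a multiple of some \<open>y v\<close>.\<close>

lemma koszul_d_image_0:
  "koszul_d ` carrier (koszul (Suc 0)) = {u \<in> carrier (koszul 0). u {} \<in> koszul_ideal}"
proof (intro equalityI subsetI)
  interpret K: ideal koszul_ideal R by (rule ideal_koszul_ideal)
  fix u assume "u \<in> koszul_d ` carrier (koszul (Suc 0))"
  then obtain w where w: "w \<in> carrier (koszul (Suc 0))" "u = koszul_d w" by blast
  have wc: "\<And>T. w T \<in> carrier R" using w by (simp add: mem_koszul)
  have "y v \<in> koszul_ideal" if "v \<in> {1..n}" for v
    using that by (intro genideal_self[THEN subsetD]) (auto simp: y_closed)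
  then have "koszul_sign v {} \<otimes> (y v \<otimes> w {v}) \<in> koszul_ideal" if "v \<in> {1..n}" for v
    using that by (intro K.I_l_closed[OF K.I_r_closed[OF _ wc] koszul_sign_closed])
  then have "(\<Oplus>v\<in>{1..n}. koszul_sign v {} \<otimes> (y v \<otimes> w {v})) \<in> koszul_ideal"
    by (intro K.ideal_finsum Pi_I)
  then have "u {} \<in> koszul_ideal"
    by (simp add: w(2) koszul_d_def)
  then show "u \<in> {u \<in> carrier (koszul 0). u {} \<in> koszul_ideal}"
    using module_hom_closed[OF koszul_d_hom w(1)] w(2) by simp
next
  fix u assume "u \<in> {u \<in> carrier (koszul 0). u {} \<in> koszul_ideal}"
  then have u: "u \<in> carrier (koszul 0)" "u {} \<in> koszul_ideal" by auto
  note s = koszul_s_closed[OF u(1)]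
  note ds = module_hom_closed[OF koszul_d_hom s]
  have "koszul_d (koszul_s u) {} \<in> carrier R"
    using ds by (simp add: mem_koszul)
  then have "koszul_d (koszul_s u) {} = u {}"
    using koszul_contraction_0[OF u(1)] koszul_ideal_E[OF u(2)] by simp
  then have "u T = koszul_d (koszul_s u) T" for T
    using koszul_0_eq[OF u(1), of T] koszul_0_eq[OF ds, of T] by (cases "T = {}") auto
  then have "u = koszul_d (koszul_s u)" by blast
  then show "u \<in> koszul_d ` carrier (koszul (Suc 0))"
    using s by (rule image_eqI)
qed

text \<open>For a cycle the summand \<open>s d u\<close> is \<open>s\<close> of zero, hence zero,
  and the contraction leaves \<open>u = d s u\<close>.\<close>

lemma koszul_d_image_Suc:
  "koszul_d ` carrier (koszul (Suc (Suc i))) = {u \<in> carrier (koszul (Suc i)). koszul_d u = (\<lambda>T. \<zero>)}"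
proof (intro equalityI subsetI)
  fix u assume "u \<in> koszul_d ` carrier (koszul (Suc (Suc i)))"
  then show "u \<in> {u \<in> carrier (koszul (Suc i)). koszul_d u = (\<lambda>T. \<zero>)}"
    using koszul_d_d module_hom_closed[OF koszul_d_hom] by auto
next
  fix u assume "u \<in> {u \<in> carrier (koszul (Suc i)). koszul_d u = (\<lambda>T. \<zero>)}"
  then have u: "u \<in> carrier (koszul (Suc i))" "koszul_d u = (\<lambda>T. \<zero>)" by auto
  note s = koszul_s_closed[OF u(1)]
  have ds: "koszul_d (koszul_s u) T \<in> carrier R" for T
    using module_hom_closed[OF koszul_d_hom s] by (simp add: mem_koszul)
  have "Min T \<in> {1..n}" if "T \<subseteq> {1..n}" "T \<noteq> {}" for T
    using that Min_in[OF finite_subset[OF that(1)]] by blast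
  then have "koszul_s (koszul_d u) T = \<zero>" for T
    unfolding u(2) koszul_s_def using D_zero by simp
  then have "koszul_d (koszul_s u) T = u T" for T
    using fun_cong[OF koszul_contraction[OF u(1)], of T] ds by simp
  then have "u = koszul_d (koszul_s u)" by (simp add: fun_eq_iff)
  then show "u \<in> koszul_d ` carrier (koszul (Suc (Suc i)))"
    using s by (rule image_eqI)
qed

lemma koszul_resolution: "free_res R koszul (\<lambda>i. koszul_d) koszul_e (cyclic_module R koszul_ideal)"
proof (rule free_res.intro)
  let ?Q = "cyclic_module R koszul_ideal"
  note I = ideal_koszul_ideal and cr = cring_axioms
  show "module R ?Q"
    by (rule module_cyclic_module[OF cr I])
  have c: "u {} \<in> carrier R" if "u \<in> carrier (koszul 0)" for u
    using that by (simp add: mem_koszul)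
  have e: "koszul_e \<in> module_hom R (koszul 0) ?Q"
    by (rule module_homI)
       (simp_all add: koszul_e_def c cyclic_coset_closed[OF cr I] cyclic_coset_add[OF cr I]
         cyclic_coset_smult[OF cr I] del: One_nat_def)
  have ker: "a_kernel (koszul 0) ?Q koszul_e = {u \<in> carrier (koszul 0). u {} \<in> koszul_ideal}"
    unfolding a_kernel_def' koszul_e_def using c cyclic_coset_eq_zero_iff[OF cr I] by auto
  have "carrier ?Q \<subseteq> koszul_e ` carrier (koszul 0)"
  proof
    fix q assume "q \<in> carrier ?Q"
    then obtain a where a: "a \<in> carrier R" "q = koszul_ideal +>\<^bsub>self_module R\<^esub> a"
      by (auto simp: cyclic_module_carrier[OF cr I] simp del: One_nat_def)
    have "(\<lambda>T. if T = {} then a else \<zero>) \<in> carrier (koszul 0)"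
      using a by (auto simp: mem_koszul)
    then show "q \<in> koszul_e ` carrier (koszul 0)"
      by (rule rev_image_eqI) (simp add: koszul_e_def a)
  qed
  then have surj: "koszul_e ` carrier (koszul 0) = carrier ?Q"
    using module_hom_closed[OF e] by auto
  show "free_resolution R koszul (\<lambda>i. koszul_d) koszul_e ?Q"
    unfolding free_resolution_def
  proof (intro conjI allI)
    show "is_free R (koszul i)" for i
      unfolding koszul_def by (rule is_free_free_module[OF cr])
    show "koszul_d ` carrier (koszul 1) = a_kernel (koszul 0) ?Q koszul_e"
      unfolding ker using koszul_d_image_0 by simp
    show "koszul_d ` carrier (koszul (Suc (Suc i))) = a_kernel (koszul (Suc i)) (koszul i) koszul_d" for i
      by (simp add: a_kernel_def' koszul_d_image_Suc)
  qed (use e surj koszul_d_hom in auto)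
qed

text \<open>As \<open>s\<close> is not linear, membership in \<open>I\<close> and \<open>J\<close>
  times the complex must be followed through coefficients: those of \<open>s d z\<close> are values
  of \<open>D\<close> on coefficients of \<open>d z\<close>.\<close>

lemma koszul_small_cycles:
  assumes I: "ideal I R" and J: "ideal J R"
    and D: "\<And>r a. r \<in> {1..n} \<Longrightarrow> a \<in> I \<Longrightarrow> D r a \<in> J"
    and z: "z \<in> carrier (koszul (Suc i))" "koszul_d z \<in> ideal_times R I (koszul i)"
  shows "\<exists>w \<in> ideal_times R J (koszul (Suc i)). \<exists>p \<in> carrier (koszul (Suc (Suc i))).
    z = w \<oplus>\<^bsub>koszul (Suc i)\<^esub> koszul_d p"
proof -
  interpret I: ideal I R by (rule I)
  interpret J: ideal J R by (rule J)
  interpret K: module R "koszul i" by (rule module_koszul)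
  interpret K': module R "koszul (Suc i)" by (rule module_koszul)
  \<comment> \<open>The chains with all coefficients in \<open>I\<close> form a submodule containing
    every product of an element of \<open>I\<close> with a chain.\<close>
  let ?H = "{u \<in> carrier (koszul i). \<forall>T. u T \<in> I}"
  have "submodule ?H R (koszul i)"
    unfolding K.submodule_iff
  proof (intro conjI ballI)
    show "u \<oplus>\<^bsub>koszul i\<^esub> v \<in> ?H" if "u \<in> ?H" "v \<in> ?H" for u v
      using that K.M.a_closed[of u v] by auto
    show "a \<odot>\<^bsub>koszul i\<^esub> u \<in> ?H" if "a \<in> carrier R" "u \<in> ?H" for a u
      using that K.smult_closed[of a u] by (auto intro: I.I_l_closed)
    show "\<zero>\<^bsub>koszul i\<^esub> \<in> ?H"
      using K.M.zero_closed by auto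
  qed auto
  moreover have "a \<odot>\<^bsub>koszul i\<^esub> u \<in> ?H" if "a \<in> I" "u \<in> carrier (koszul i)" for a u
    using that K.smult_closed[of a u] by (auto simp: mem_koszul intro: I.I_r_closed)
  ultimately have "ideal_times R I (koszul i) \<subseteq> ?H"
    unfolding ideal_times_def by (intro submodule_span_minimal) auto
  then have dz: "koszul_d z \<in> carrier (koszul i)" "\<And>T. koszul_d z T \<in> I"
    using z(2) by auto
  let ?w = "koszul_s (koszul_d z)"
  have w: "?w \<in> carrier (koszul (Suc i))"
    by (rule koszul_s_closed[OF dz(1)])
  have wJ: "?w T \<in> J" for T
  proof (cases "T \<subseteq> {1..n} \<and> T \<noteq> {}")
    case True
    then have "Min T \<in> {1..n}"
      using Min_in[OF finite_subset[of T "{1..n}"]] by blast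
    then show ?thesis
      using True dz(2) D by (simp add: koszul_s_def)
  qed (auto simp: koszul_s_def)
  let ?X = "{T. T \<subseteq> {1..n} \<and> card T = Suc i}"
  \<comment> \<open>Expansion in the basis turns coefficients in \<open>J\<close> into membership in
    \<open>J\<close> times the module.\<close>
  have "?w = lin_ext R (koszul (Suc i)) (unit_vec R) ?w"
    using lin_ext_unit_vec_self[OF cring_axioms, of ?w ?X] w by (simp add: koszul_def)
  also have "\<dots> \<in> ideal_times R J (koszul (Suc i))"
    unfolding lin_ext_def
  proof (rule submodule_finsum[OF module_koszul submodule_ideal_times[OF module_koszul]], rule J.a_subset, rule Pi_I)
    fix T assume "T \<in> {T. ?w T \<noteq> \<zero>}"
    then have "T \<in> ?X" using w by (simp add: mem_koszul)
    then have "unit_vec R T \<in> carrier (koszul (Suc i))"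
      unfolding koszul_def by (rule unit_vec_closed[OF cring_axioms])
    then show "?w T \<odot>\<^bsub>koszul (Suc i)\<^esub> unit_vec R T \<in> ideal_times R J (koszul (Suc i))"
      by (rule ideal_timesI[OF wJ])
  qed
  finally have "?w \<in> ideal_times R J (koszul (Suc i))" .
  then show ?thesis
    using koszul_contraction[OF z(1)] koszul_s_closed[OF z(1)] by (intro bexI[of _ ?w] bexI[of _ "koszul_s z"]) auto
qed

text \<open>The argument over any ring with difference operators, so that power series and
  polynomials need no separate treatment. The condition \<open>EF\<close> stands for vanishing
  constant terms.\<close>

theorem Tor_map_cyclic_zero:
  assumes F: "F \<subseteq> carrier R" and J: "ideal J R"
    and EF: "\<And>f. f \<in> F \<Longrightarrow> E (Suc n) f = \<zero>"
    and DF: "\<And>r f. r \<in> {1..n} \<Longrightarrow> f \<in> F \<Longrightarrow> D r f \<in> J"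
    and res: "free_resolution R P \<delta> \<epsilon> (cyclic_module R koszul_ideal)"
    and t: "t \<in> carrier (Tor R P \<delta> (cyclic_module R (Idl F)) (Suc i))"
  shows "Tor_map R P \<delta> (cyclic_module R J) (natural_map R J) (Suc i) t
    = \<zero>\<^bsub>Tor R P \<delta> (cyclic_module R J) (Suc i)\<^esub>"
proof -
  interpret P: free_res R P \<delta> \<epsilon> "cyclic_module R koszul_ideal"
    by (rule free_res.intro[OF res module_cyclic_module[OF cring_axioms ideal_koszul_ideal]])
  have I: "ideal (Idl F) R" by (rule genideal_ideal[OF F])
  have IJ: "Idl F \<subseteq> J"
    using D_genideal(3)[OF F J EF DF] by blast
  have Jc: "J \<subseteq> carrier R"
    using J by (simp add: additive_subgroup.a_subset ideal.axioms(1))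
  show ?thesis
  proof (rule Tor_map_zero[OF cring_axioms I J IJ P.mod P.d_hom P.d_d _ t])
    show "\<exists>w \<in> ideal_times R J (P (Suc i)). \<exists>p \<in> carrier (P (Suc (Suc i))).
        z = w \<oplus>\<^bsub>P (Suc i)\<^esub> \<delta> (Suc i) p"
      if "z \<in> carrier (P (Suc i))" "\<delta> i z \<in> ideal_times R (Idl F) (P i)" for z
      by (rule small_cycles_transfer[OF P.free_res_axioms koszul_resolution IJ Jc
            koszul_small_cycles[OF I J D_genideal(2)[OF F J EF DF]] that])
  qed
qed

end

section \<open>Power series\<close>

text \<open>The product of both rings as a bare function of coefficients. Its laws hold for all
  coefficient functions, whatever their support, and are proved once outside any carrier.\<close>

definition series_mult :: "(nat multiset \<Rightarrow> 'k::field) \<Rightarrow> (nat multiset \<Rightarrow> 'k) \<Rightarrow> nat multiset \<Rightarrow> 'k" where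
  "series_mult f g m = (\<Sum>a | a \<subseteq># m. f a * g (m - a))"

definition series_one :: "nat multiset \<Rightarrow> 'k::field" where
  "series_one m = (if m = {#} then 1 else 0)"

lemma finite_submultisets: "finite {a. a \<subseteq># m}"
proof (induction m)
  case (add x m)
  have "{a. a \<subseteq># add_mset x m} \<subseteq> {a. a \<subseteq># m} \<union> add_mset x ` {a. a \<subseteq># m}"
  proof
    fix a assume "a \<in> {a. a \<subseteq># add_mset x m}"
    then have a: "a \<subseteq># add_mset x m" by simp
    show "a \<in> {a. a \<subseteq># m} \<union> add_mset x ` {a. a \<subseteq># m}"
    proof (cases "x \<in># a")
      case True
      then obtain b where "a = add_mset x b" by (meson multi_member_split)
      then show ?thesis using a by auto
    next
      case False
      then have "a \<subseteq># m"
        using a by (metis diff_single_trivial subset_eq_diff_conv add_mset_add_single)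
      then show ?thesis by simp
    qed
  qed
  then show ?case
    using add.IH by (meson finite_UnI finite_imageI finite_subset)
qed simp

lemma series_mult_commute: "series_mult f g = series_mult g f"
proof
  fix m :: "nat multiset"
  have "m - (m - a) = a" if "a \<subseteq># m" for a
    using that by (auto simp: mset_subset_eq_exists_conv)
  then show "series_mult f g m = series_mult g f m"
    unfolding series_mult_def
    by (intro sum.reindex_bij_witness[of _ "\<lambda>a. m - a" "\<lambda>a. m - a"]) (auto simp: mult.commute)
qed

lemma series_mult_assoc: "series_mult (series_mult f g) h = series_mult f (series_mult g h)"
proof
  fix m
  have "series_mult (series_mult f g) h m
      = (\<Sum>(a, b) \<in> Sigma {a. a \<subseteq># m} (\<lambda>a. {b. b \<subseteq># a}). f b * g (a - b) * h (m - a))"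
    unfolding series_mult_def by (simp add: sum.Sigma finite_submultisets sum_distrib_right)
  \<comment> \<open>Chains of submultisets \<open>b \<subseteq># a \<subseteq># m\<close> correspond
    to ordered splittings of \<open>m\<close> into three parts, with
    \<open>c = a - b\<close>.\<close>
  also have "\<dots> = (\<Sum>(b, c) \<in> Sigma {b. b \<subseteq># m} (\<lambda>b. {c. c \<subseteq># m - b}). f b * (g c * h (m - b - c)))"
  proof (rule sum.reindex_bij_witness[of _ "\<lambda>(b, c). (b + c, b)" "\<lambda>(a, b). (b, a - b)"])
    fix p assume "p \<in> Sigma {a. a \<subseteq># m} (\<lambda>a. {b. b \<subseteq># a})"
    then obtain a b where p: "p = (a, b)" "a \<subseteq># m" "b \<subseteq># a" by auto
    then obtain c where a: "a = b + c" by (auto simp: mset_subset_eq_exists_conv)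
    obtain d where m: "m = b + c + d" using p a by (auto simp: mset_subset_eq_exists_conv)
    show "(case case p of (a, b) \<Rightarrow> (b, a - b) of (b, c) \<Rightarrow> (b + c, b)) = p"
      and "(case p of (a, b) \<Rightarrow> (b, a - b)) \<in> Sigma {b. b \<subseteq># m} (\<lambda>b. {c. c \<subseteq># m - b})"
      and "(case case p of (a, b) \<Rightarrow> (b, a - b) of (b, c) \<Rightarrow> f b * (g c * h (m - b - c)))
        = (case p of (a, b) \<Rightarrow> f b * g (a - b) * h (m - a))"
      unfolding p a m by (simp_all add: add.assoc)
  next
    fix q assume "q \<in> Sigma {b. b \<subseteq># m} (\<lambda>b. {c. c \<subseteq># m - b})"
    then obtain b c where q: "q = (b, c)" "b \<subseteq># m" "c \<subseteq># m - b" by auto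
    then obtain e where m: "m = b + e" by (auto simp: mset_subset_eq_exists_conv)
    then obtain d where e: "e = c + d" using q by (auto simp: mset_subset_eq_exists_conv)
    show "(case case q of (b, c) \<Rightarrow> (b + c, b) of (a, b) \<Rightarrow> (b, a - b)) = q"
      and "(case q of (b, c) \<Rightarrow> (b + c, b)) \<in> Sigma {a. a \<subseteq># m} (\<lambda>a. {b. b \<subseteq># a})"
      unfolding q m e by (simp_all add: add.assoc)
  qed
  also have "\<dots> = series_mult f (series_mult g h) m"
    unfolding series_mult_def by (simp add: sum.Sigma finite_submultisets sum_distrib_left)
  finally show "series_mult (series_mult f g) h m = series_mult f (series_mult g h) m" .
qed

lemma series_mult_one: "series_mult series_one f = f"
proof
  fix m
  have "series_mult series_one f m = (\<Sum>a\<in>{{#}}. series_one a * f (m - a))"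
    unfolding series_mult_def
    by (rule sum.mono_neutral_right) (auto simp: finite_submultisets series_one_def)
  then show "series_mult series_one f m = f m"
    by (simp add: series_one_def)
qed

lemma series_mult_add: "series_mult (\<lambda>m. f m + g m) h = (\<lambda>m. series_mult f h m + series_mult g h m)"
  by (auto simp: series_mult_def sum.distrib distrib_right)

lemma series_mult_var: "series_mult (var r) f m = (if r \<in># m then f (m - {#r#}) else 0)"
proof -
  have "series_mult (var r) f m = (\<Sum>a\<in>{{#r#}} \<inter> {a. a \<subseteq># m}. var r a * f (m - a))"
    unfolding series_mult_def
    by (rule sum.mono_neutral_right) (auto simp: finite_submultisets var_def)
  then show ?thesis
    by (simp add: var_def)
qed

lemma series_mult_nonzero:
  assumes "series_mult f g m \<noteq> 0"
  obtains a b where "m = a + b" "f a \<noteq> 0" "g b \<noteq> 0"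
proof -
  obtain a where "a \<subseteq># m" "f a * g (m - a) \<noteq> 0"
    using assms unfolding series_mult_def by (metis (mono_tags, lifting) mem_Collect_eq sum.neutral)
  then show ?thesis
    using that[of a "m - a"] by simp
qed

text \<open>The equation \<open>f g = 1\<close> solved for the coefficient at \<open>m\<close>: the
  term with \<open>a = {#}\<close> is isolated, so the remaining ones involve only the smaller
  monomials \<open>m - a\<close>.\<close>

function series_inverse :: "(nat multiset \<Rightarrow> 'k::field) \<Rightarrow> nat multiset \<Rightarrow> 'k" where
  "series_inverse f m = (if m = {#} then 1 / f {#}
     else - (\<Sum>a\<in>{a. a \<subseteq># m \<and> a \<noteq> {#}}. f a * series_inverse f (m - a)) / f {#})"
  by auto
termination
  by (relation "Wellfounded.measure (\<lambda>(f, m). size m)")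
     (auto simp: size_Diff_submset nonempty_has_size dest: size_mset_mono)

declare series_inverse.simps [simp del]

lemma series_mult_inverse:
  assumes "f {#} \<noteq> 0"
  shows "series_mult f (series_inverse f) = series_one"
proof
  fix m :: "nat multiset"
  have "{a. a \<subseteq># m} = insert {#} {a. a \<subseteq># m \<and> a \<noteq> {#}}"
    by auto
  moreover have "finite {a. a \<subseteq># m \<and> a \<noteq> {#}}"
    by (rule finite_subset[OF _ finite_submultisets[of m]]) auto
  ultimately have "series_mult f (series_inverse f) m
      = f {#} * series_inverse f m + (\<Sum>a\<in>{a. a \<subseteq># m \<and> a \<noteq> {#}}. f a * series_inverse f (m - a))"
    unfolding series_mult_def by simp
  also have "\<dots> = series_one m"
  proof (cases "m = {#}")
    case True
    then have "{a. a \<subseteq># m \<and> a \<noteq> {#}} = {}" by auto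
    with True show ?thesis
      using assms by (simp add: series_inverse.simps series_one_def)
  qed (use assms in \<open>simp add: series_inverse.simps[of f m] series_one_def\<close>)
  finally show "series_mult f (series_inverse f) m = series_one m" .
qed

text \<open>This keeps the inverse within the given variables: a nonzero coefficient at
  \<open>m\<close> arises from nonzero coefficients at some \<open>a\<close> and
  \<open>m - a\<close>, both supported in \<open>A\<close>.\<close>

lemma series_inverse_support:
  assumes "\<And>m. f m \<noteq> 0 \<Longrightarrow> set_mset m \<subseteq> A" "series_inverse f m \<noteq> 0"
  shows "set_mset m \<subseteq> A"
  using assms(2)
proof (induction "size m" arbitrary: m rule: less_induct)
  case less
  show ?case
  proof (cases "m = {#}")
    case False
    then obtain a where a: "a \<subseteq># m" "a \<noteq> {#}" "f a * series_inverse f (m - a) \<noteq> 0"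
      using less.prems unfolding series_inverse.simps[of f m]
      by (metis (mono_tags, lifting) div_0 mem_Collect_eq minus_zero sum.neutral)
    then have "size (m - a) < size m"
      using size_mset_mono[OF a(1)] by (simp add: size_Diff_submset nonempty_has_size)
    then have "set_mset (m - a) \<subseteq> A"
      using less.hyps a(3) by simp
    moreover have "m = a + (m - a)" using a(1) by simp
    ultimately show ?thesis
      using assms(1)[of a] a(3) by (metis Un_least mult_zero_left set_mset_union)
  qed simp
qed

text \<open>
  For a permutation \<open>\<sigma>\<close> with inverse \<open>\<rho>\<close>, the variable \<open>x\<^sub>j\<close> has position \<open>\<rho> j\<close> in the order
  \<open>x\<^bsub>\<sigma>(1)\<^esub>, \<dots>, x\<^bsub>\<sigma>(n)\<^esub>\<close>.
\<close>

definition series_E :: "(nat \<Rightarrow> nat) \<Rightarrow> nat \<Rightarrow> (nat multiset \<Rightarrow> 'k::field) \<Rightarrow> nat multiset \<Rightarrow> 'k" where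
  "series_E \<rho> t f m = (if \<exists>j\<in>#m. \<rho> j < t then 0 else f m)"

text \<open>If \<open>m\<close> contains a variable that is set to zero, so does one part of every
  splitting of \<open>m\<close>; otherwise no part does.\<close>

lemma series_E_mult: "series_E \<rho> t (series_mult f g) = series_mult (series_E \<rho> t f) (series_E \<rho> t g)"
proof
  fix m
  show "series_E \<rho> t (series_mult f g) m = series_mult (series_E \<rho> t f) (series_E \<rho> t g) m"
  proof (cases "\<exists>j\<in>#m. \<rho> j < t")
    case True
    have "series_E \<rho> t f a * series_E \<rho> t g (m - a) = 0" if "a \<subseteq># m" for a
    proof -
      have "m = a + (m - a)" using that by simp
      then have "(\<exists>j\<in>#a. \<rho> j < t) \<or> (\<exists>j\<in>#m - a. \<rho> j < t)"
        using True by (metis Un_iff set_mset_union)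
      then show ?thesis by (auto simp: series_E_def)
    qed
    then have "series_mult (series_E \<rho> t f) (series_E \<rho> t g) m = 0"
      unfolding series_mult_def by (intro sum.neutral) auto
    then show ?thesis
      using True by (simp add: series_E_def)
  next
    case False
    then have "series_E \<rho> t f a = f a \<and> series_E \<rho> t g (m - a) = g (m - a)" if "a \<subseteq># m" for a
      using mset_subset_eqD[OF that] in_diffD[of _ m a] by (auto simp: series_E_def)
    then have "series_mult (series_E \<rho> t f) (series_E \<rho> t g) m = series_mult f g m"
      unfolding series_mult_def by (intro sum.cong) auto
    then show ?thesis
      using False by (simp add: series_E_def)
  qed
qed

text \<open>The two rings share their operations and differ in the carrier, so finiteness of the
  support is the one additional closure condition for polynomials.\<close>

locale series_ring =
  fixes n :: nat and S :: "(nat multiset \<Rightarrow> 'k::field) ring"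
  assumes S: "S = power_series_ring n \<or> S = polynomial_ring n"
begin

lemma S_sel [simp]: "mult S = series_mult" "one S = series_one" "zero S = (\<lambda>m. 0)"
  "add S = (\<lambda>f g m. f m + g m)"
  using S by (auto simp: power_series_ring_def polynomial_ring_def series_mult_def series_one_def fun_eq_iff)

lemma support: "f \<in> carrier S \<Longrightarrow> f m \<noteq> 0 \<Longrightarrow> set_mset m \<subseteq> {1..n}"
  using S by (elim disjE) (simp_all add: power_series_ring_def polynomial_ring_def)

lemma closedI:
  assumes "\<And>m. h m \<noteq> 0 \<Longrightarrow> set_mset m \<subseteq> {1..n}"
    and "S = polynomial_ring n \<Longrightarrow> finite {m. h m \<noteq> 0}"
  shows "h \<in> carrier S"
  using S assms by (auto simp: power_series_ring_def polynomial_ring_def)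

lemma finite_support: "S = polynomial_ring n \<Longrightarrow> f \<in> carrier S \<Longrightarrow> finite {m. f m \<noteq> 0}"
  by (simp add: polynomial_ring_def)

text \<open>An injective \<open>\<tau>\<close> embeds the support of \<open>h\<close> into that of
  \<open>f\<close>, so finiteness survives. Negation, truncation, permutation and division by a
  variable are all of this kind.\<close>

lemma closed_transform:
  assumes "f \<in> carrier S" "inj \<tau>" "\<And>m. h m \<noteq> 0 \<Longrightarrow> f (\<tau> m) \<noteq> 0"
    and "\<And>m. set_mset (\<tau> m) \<subseteq> {1..n} \<Longrightarrow> set_mset m \<subseteq> {1..n}"
  shows "h \<in> carrier S"
proof (rule closedI)
  show "set_mset m \<subseteq> {1..n}" if "h m \<noteq> 0" for m
    using assms(4)[OF support[OF assms(1) assms(3)[OF that]]] .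
  assume "S = polynomial_ring n"
  then have "finite (\<tau> -` {m. f m \<noteq> 0})"
    using finite_support assms(1,2) by (intro finite_vimageI) auto
  then show "finite {m. h m \<noteq> 0}"
    by (rule rev_finite_subset) (use assms(3) in auto)
qed

lemma const_closed: "(\<lambda>m. if m = {#} then c else 0) \<in> carrier S"
  by (rule closedI) (auto split: if_splits)

lemma one_closed: "series_one \<in> carrier S"
  unfolding series_one_def[abs_def] by (rule const_closed)

lemma zero_closed: "(\<lambda>m. 0) \<in> carrier S"
  by (rule closedI) auto

lemma var_closed: "r \<in> {1..n} \<Longrightarrow> var r \<in> carrier S"
  by (rule closedI) (auto simp: var_def split: if_splits)

lemma uminus_closed: "f \<in> carrier S \<Longrightarrow> (\<lambda>m. - f m) \<in> carrier S"
  by (rule closed_transform[of f id]) auto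

lemma add_closed:
  assumes "f \<in> carrier S" "g \<in> carrier S"
  shows "(\<lambda>m. f m + g m) \<in> carrier S"
proof (rule closedI)
  show "set_mset m \<subseteq> {1..n}" if "f m + g m \<noteq> 0" for m
    using that support[OF assms(1), of m] support[OF assms(2), of m] by (cases "f m = 0") simp_all
  assume "S = polynomial_ring n"
  then have "finite ({m. f m \<noteq> 0} \<union> {m. g m \<noteq> 0})"
    using finite_support assms by auto
  then show "finite {m. f m + g m \<noteq> 0}"
    by (rule rev_finite_subset) auto
qed

lemma mult_closed:
  assumes "f \<in> carrier S" "g \<in> carrier S"
  shows "series_mult f g \<in> carrier S"
proof (rule closedI)
  show "set_mset m \<subseteq> {1..n}" if "series_mult f g m \<noteq> 0" for m
  proof (rule series_mult_nonzero[OF that])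
    fix a b assume "m = a + b" "f a \<noteq> 0" "g b \<noteq> 0"
    then show ?thesis
      using support[OF assms(1), of a] support[OF assms(2), of b] by simp
  qed
  assume "S = polynomial_ring n"
  then have "finite ((\<lambda>(a, b). a + b) ` ({m. f m \<noteq> 0} \<times> {m. g m \<noteq> 0}))"
    using finite_support assms by auto
  then show "finite {m. series_mult f g m \<noteq> 0}"
    by (rule rev_finite_subset) (auto elim!: series_mult_nonzero)
qed

lemma cring_S: "cring S"
proof (rule cringI)
  show "abelian_group S"
  proof (rule abelian_groupI)
    show "\<exists>g\<in>carrier S. g \<oplus>\<^bsub>S\<^esub> f = \<zero>\<^bsub>S\<^esub>" if "f \<in> carrier S" for f
      using uminus_closed[OF that] by (intro bexI[of _ "\<lambda>m. - f m"]) auto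
  qed (auto simp: add_closed zero_closed add_ac)
  show "comm_monoid S"
    by (rule comm_monoidI)
       (simp_all add: mult_closed one_closed series_mult_assoc series_mult_one, rule series_mult_commute)
qed (simp add: series_mult_add)

lemma a_minus_S:
  assumes "f \<in> carrier S" "g \<in> carrier S"
  shows "f \<ominus>\<^bsub>S\<^esub> g = (\<lambda>m. f m - g m)"
proof -
  interpret S: cring S by (rule cring_S)
  have "\<ominus>\<^bsub>S\<^esub> g = (\<lambda>m. - g m)"
    by (rule S.minus_equality) (use assms uminus_closed in auto)
  then show ?thesis
    by (simp add: a_minus_def)
qed

section \<open>The operators on power series and polynomials\<close>

lemma series_E_closed: "f \<in> carrier S \<Longrightarrow> series_E \<rho> t f \<in> carrier S"
  by (rule closed_transform[of f id]) (auto simp: series_E_def split: if_splits)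

text \<open>Multiplication by \<open>var r\<close> shifts coefficients along
  \<open>add_mset r\<close>. Reading the defining equation at \<open>add_mset r m\<close> therefore
  yields both the value of the quotient and its uniqueness.\<close>

lemma d_op_eq:
  assumes "r \<in> {1..n}" "f \<in> carrier S"
  shows "d_op S r f = (\<lambda>m. if \<exists>i\<in>#m. i < r then 0 else f (add_mset r m))"
proof -
  let ?g = "\<lambda>m. if \<exists>i\<in>#m. i < r then 0 else f (add_mset r m)"
  have zb: "zero_below s f = series_E id s f" for s
    by (auto simp: zero_below_def series_E_def)
  \<comment> \<open>The difference keeps exactly the monomials whose smallest variable is the
    \<open>r\<close>-th, so it is divisible by that variable.\<close>
  have rhs: "zero_below r f \<ominus>\<^bsub>S\<^esub> zero_below (Suc r) f
      = (\<lambda>m. if r \<in># m \<and> \<not> (\<exists>i\<in>#m. i < r) then f m else 0)"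
    unfolding zb
    by (subst a_minus_S) (auto simp: series_E_closed assms(2) series_E_def less_Suc_eq fun_eq_iff)
  show ?thesis
    unfolding d_op_def
  proof (rule the_equality)
    have "?g \<in> carrier S"
      by (rule closed_transform[OF assms(2), of "add_mset r"]) (auto simp: inj_def split: if_splits)
    moreover have "(if r \<in># m then ?g (m - {#r#}) else 0)
        = (if r \<in># m \<and> \<not> (\<exists>i\<in>#m. i < r) then f m else 0)" for m
    proof (cases "r \<in># m")
      case True
      then obtain m' where "m = add_mset r m'" by (meson multi_member_split)
      then show ?thesis by auto
    qed simp
    ultimately show "?g \<in> carrier S \<and> var r \<otimes>\<^bsub>S\<^esub> ?g = zero_below r f \<ominus>\<^bsub>S\<^esub> zero_below (Suc r) f"
      unfolding rhs by (auto simp: series_mult_var fun_eq_iff)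
  next
    fix g assume "g \<in> carrier S \<and> var r \<otimes>\<^bsub>S\<^esub> g = zero_below r f \<ominus>\<^bsub>S\<^esub> zero_below (Suc r) f"
    then have g: "series_mult (var r) g = (\<lambda>m. if r \<in># m \<and> \<not> (\<exists>i\<in>#m. i < r) then f m else 0)"
      unfolding rhs by simp
    show "g = ?g"
    proof
      fix m
      have "g m = series_mult (var r) g (add_mset r m)"
        by (simp add: series_mult_var)
      then show "g m = ?g m"
        unfolding g by auto
    qed
  qed
qed

lemma perm_act_closed:
  assumes "f \<in> carrier S" "\<tau> permutes {1..n}"
  shows "perm_act \<tau> f \<in> carrier S"
proof (rule closed_transform[OF assms(1), of "image_mset (inv_into UNIV \<tau>)"])
  have inv: "inv_into UNIV \<tau> permutes {1..n}"
    by (rule permutes_inv[OF assms(2)])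
  have "image_mset \<tau> (image_mset (inv_into UNIV \<tau>) m) = m" for m
    using permutes_inverses(1)[OF assms(2)] by (simp add: multiset.map_comp comp_def)
  then show "inj (image_mset (inv_into UNIV \<tau>))"
    by (metis injI)
  show "set_mset m \<subseteq> {1..n}" if "set_mset (image_mset (inv_into UNIV \<tau>) m) \<subseteq> {1..n}" for m
    using that permutes_in_image[OF inv] by auto
qed (simp add: perm_act_def)

text \<open>The two permutation actions cancel on \<open>m\<close> and turn the extra variable
  \<open>r\<close> into \<open>\<sigma> r\<close>; the comparison with \<open>r\<close> is made on
  positions.\<close>

lemma d_perm_eq:
  assumes \<sigma>: "\<sigma> permutes {1..n}" and r: "r \<in> {1..n}" and f: "f \<in> carrier S"
  shows "d_perm S \<sigma> r f = (\<lambda>m. if \<exists>j\<in>#m. inv_into UNIV \<sigma> j < r then 0 else f (add_mset (\<sigma> r) m))"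
proof
  fix m
  let ?\<rho> = "inv_into UNIV \<sigma>"
  have \<rho>: "?\<rho> permutes {1..n}" by (rule permutes_inv[OF \<sigma>])
  have "inv_into UNIV ?\<rho> = \<sigma>"
    using \<sigma> by (simp add: inv_inv_eq permutes_bij)
  moreover have "image_mset \<sigma> (image_mset ?\<rho> m) = m"
    using permutes_inverses(1)[OF \<sigma>] by (simp add: multiset.map_comp comp_def)
  ultimately show "d_perm S \<sigma> r f m = (if \<exists>j\<in>#m. ?\<rho> j < r then 0 else f (add_mset (\<sigma> r) m))"
    using perm_act_closed[OF f \<rho>] r by (simp add: d_perm_def d_op_eq perm_act_def)
qed

lemma difference_operators_series:
  assumes \<sigma>: "\<sigma> permutes {1..n}"
  shows "difference_operators S n (\<lambda>r. var (\<sigma> r)) (d_perm S \<sigma>) (series_E (inv_into UNIV \<sigma>))"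
proof -
  let ?\<rho> = "inv_into UNIV \<sigma>"
  have \<sigma>n: "\<sigma> r \<in> {1..n}" if "r \<in> {1..n}" for r
    using that permutes_in_image[OF \<sigma>] by blast
  have \<rho>n: "?\<rho> r \<in> {1..n}" if "r \<in> {1..n}" for r
    using that permutes_in_image[OF permutes_inv[OF \<sigma>]] by blast
  have \<rho>\<sigma>: "?\<rho> (\<sigma> r) = r" for r
    using permutes_inverses(2)[OF \<sigma>] .
  have \<sigma>\<rho>: "\<sigma> (?\<rho> r) = r" for r
    using permutes_inverses(1)[OF \<sigma>] .
  interpret S: cring S by (rule cring_S)
  show ?thesis
  proof (intro difference_operators.intro difference_operators_axioms.intro cring_S)
    fix r f g assume r: "r \<in> {1..n}" and eq: "var (\<sigma> r) \<otimes>\<^bsub>S\<^esub> f = var (\<sigma> r) \<otimes>\<^bsub>S\<^esub> g"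
    show "f = g"
    proof
      fix m
      show "f m = g m"
        using fun_cong[OF eq, of "add_mset (\<sigma> r) m"] by (simp add: series_mult_var)
    qed
  next
    fix f assume f: "f \<in> carrier S"
    show "series_E ?\<rho> 1 f = f"
    proof
      fix m
      \<comment> \<open>Variables that occur have positions in \<open>{1..n}\<close>, so none
        precedes the first.\<close>
      have "\<not> (\<exists>j\<in>#m. ?\<rho> j < 1)" if "f m \<noteq> 0"
        using support[OF f that] \<rho>n by fastforce
      then show "series_E ?\<rho> 1 f m = f m"
        by (cases "f m = 0") (auto simp: series_E_def)
    qed
  next
    fix t r assume "r \<in> {1..n}"
    show "series_E ?\<rho> t (var (\<sigma> r)) = (if t \<le> r then var (\<sigma> r) else \<zero>\<^bsub>S\<^esub>)"
      by (auto simp: series_E_def var_def fun_eq_iff \<rho>\<sigma>)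
  next
    fix r f assume r: "r \<in> {1..n}" and f: "f \<in> carrier S"
    note d = d_perm_eq[OF \<sigma> r f]
    show "d_perm S \<sigma> r f \<in> carrier S"
      unfolding d
      by (rule closed_transform[OF f, of "add_mset (\<sigma> r)"]) (auto simp: inj_def split: if_splits)
    have eq_iff: "?\<rho> j = r \<longleftrightarrow> j = \<sigma> r" for j
      using \<rho>\<sigma> \<sigma>\<rho> by metis
    show "var (\<sigma> r) \<otimes>\<^bsub>S\<^esub> d_perm S \<sigma> r f \<oplus>\<^bsub>S\<^esub> series_E ?\<rho> (Suc r) f = series_E ?\<rho> r f"
    proof
      fix m
      show "(var (\<sigma> r) \<otimes>\<^bsub>S\<^esub> d_perm S \<sigma> r f \<oplus>\<^bsub>S\<^esub> series_E ?\<rho> (Suc r) f) m = series_E ?\<rho> r f m"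
      \<comment> \<open>A monomial containing the \<open>r\<close>-th variable is removed by
        \<open>E (Suc r)\<close> and comes from the product; on any other monomial the product
        vanishes and the two truncations agree.\<close>
      proof (cases "\<sigma> r \<in># m")
        case True
        then obtain m' where "m = add_mset (\<sigma> r) m'" by (meson multi_member_split)
        then show ?thesis
          by (auto simp: d series_mult_var series_E_def \<rho>\<sigma> less_Suc_eq)
      next
        case False
        then have "(\<exists>j\<in>#m. ?\<rho> j < Suc r) \<longleftrightarrow> (\<exists>j\<in>#m. ?\<rho> j < r)"
          by (auto simp: less_Suc_eq eq_iff)
        then show ?thesis
          using False by (simp add: series_mult_var series_E_def)
      qed
    qed
  qed (use \<sigma>n in \<open>auto simp: var_closed series_E_closed series_E_mult series_E_def\<close>)
qed

text \<open>A nonzero constant term would produce a unit in \<open>I\<close>: for power series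
  \<open>f\<close> itself is invertible, and for a graded ideal the degree zero part of
  \<open>f\<close> is a nonzero constant in \<open>I\<close>.\<close>

lemma proper_ideal_constant_term:
  assumes I: "ideal I S" "I \<noteq> carrier S" and g: "S = power_series_ring n \<or> graded I" and f: "f \<in> I"
  shows "f {#} = 0"
proof (rule ccontr)
  assume nz: "f {#} \<noteq> 0"
  interpret I: ideal I S by fact
  have fS: "f \<in> carrier S" using f by simp
  have "series_one \<in> I"
  proof (cases "S = power_series_ring n")
    case False
    have "homogeneous_part 0 f \<in> I"
      using g False f unfolding graded_def by blast
    moreover have "homogeneous_part 0 f = (\<lambda>m. if m = {#} then f {#} else 0)"
      by (auto simp: homogeneous_part_def)
    ultimately have h: "(\<lambda>m. if m = {#} then f {#} else 0) \<in> I" by simp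
    have "series_mult (\<lambda>m. if m = {#} then 1 / f {#} else 0) (\<lambda>m. if m = {#} then f {#} else 0) = series_one"
    proof
      fix m :: "nat multiset"
      have "series_mult (\<lambda>m. if m = {#} then 1 / f {#} else 0) (\<lambda>m. if m = {#} then f {#} else 0) m
          = (\<Sum>a\<in>{{#}}. (if a = {#} then 1 / f {#} else 0) * (if m - a = {#} then f {#} else 0))"
        unfolding series_mult_def by (rule sum.mono_neutral_right) (auto simp: finite_submultisets)
      then show "series_mult (\<lambda>m. if m = {#} then 1 / f {#} else 0) (\<lambda>m. if m = {#} then f {#} else 0) m = series_one m"
        using nz by (simp add: series_one_def)
    qed
    then show ?thesis
      using I.I_l_closed[OF h const_closed[of "1 / f {#}"]] by simp
  next
    case True
    have "set_mset m \<subseteq> {1..n}" if "series_inverse f m \<noteq> 0" for m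
      using support[OF fS] that by (rule series_inverse_support)
    then have "series_inverse f \<in> carrier S"
      by (simp add: True power_series_ring_def)
    then show ?thesis
      using I.I_r_closed[OF f] series_mult_inverse[of f] nz by force
  qed
  then show False
    using I.one_imp_carrier I(2) by simp
qed

end

theorem corollary2p2:
  fixes S :: "(nat multiset \<Rightarrow> 'k::field) ring"
    and I F J :: "(nat multiset \<Rightarrow> 'k) set"
    and \<sigma> :: "nat \<Rightarrow> nat"
    and P :: "nat \<Rightarrow> (nat multiset \<Rightarrow> 'k, 'b) module"
    and \<delta> :: "nat \<Rightarrow> 'b \<Rightarrow> 'b"
    and \<epsilon> :: "'b \<Rightarrow> (nat multiset \<Rightarrow> 'k) set"
    and n i :: nat
  assumes "S = power_series_ring n \<or> (S = polynomial_ring n \<and> graded I)"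
    and "ideal I S" and "I \<noteq> carrier S"
    and "F \<subseteq> carrier S" and "I = Idl\<^bsub>S\<^esub> F"
    and "\<sigma> permutes {1..n}"
    and "J = d_ideal S n \<sigma> F"
    and "free_resolution S P \<delta> \<epsilon> (residue_field_module S n)"
    and "i \<ge> 1"
  shows "\<forall>t \<in> carrier (Tor S P \<delta> (cyclic_module S I) i).
           Tor_map S P \<delta> (cyclic_module S J) (natural_map S J) i t
             = \<zero>\<^bsub>Tor S P \<delta> (cyclic_module S J) i\<^esub>"
proof
  interpret series_ring n S
    using assms(1) by unfold_locales blast
  interpret difference_operators S n "\<lambda>r. var (\<sigma> r)" "d_perm S \<sigma>" "series_E (inv_into UNIV \<sigma>)"
    by (rule difference_operators_series[OF assms(6)])
  fix t assume t: "t \<in> carrier (Tor S P \<delta> (cyclic_module S I) i)"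
  obtain j where i: "i = Suc j"
    using assms(9) by (cases i) auto
  have gens: "{d_perm S \<sigma> r f | r f. r \<in> {1..n} \<and> f \<in> F} \<subseteq> carrier S"
    using assms(4) D_closed by blast
  have J: "ideal J S"
    unfolding assms(7) d_ideal_def by (rule genideal_ideal[OF gens])
  have DF: "d_perm S \<sigma> r f \<in> J" if "r \<in> {1..n}" "f \<in> F" for r f
    unfolding assms(7) d_ideal_def using genideal_self[OF gens] that by blast
  \<comment> \<open>\<open>series_E\<close> with bound \<open>Suc n\<close> leaves only the constant
    term, since every variable has a position at most \<open>n\<close>; properness of
    \<open>I\<close> makes that term zero.\<close>
  have EF: "series_E (inv_into UNIV \<sigma>) (Suc n) f = \<zero>\<^bsub>S\<^esub>" if f: "f \<in> F" for f
  proof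
    fix m
    have "f \<in> I"
      unfolding assms(5) using genideal_self[OF assms(4)] f by blast
    then have "f {#} = 0"
      by (rule proper_ideal_constant_term[OF assms(2,3), rotated]) (use assms(1) in blast)
    moreover have "\<exists>j\<in>#m. inv_into UNIV \<sigma> j < Suc n" if nz: "f m \<noteq> 0" "m \<noteq> {#}"
    proof -
      obtain k where k: "k \<in># m" using nz(2) by blast
      then have "k \<in> {1..n}"
        using support[of f m] assms(4) f nz(1) by blast
      then have "inv_into UNIV \<sigma> k \<in> {1..n}"
        using permutes_in_image[OF permutes_inv[OF assms(6)]] by blast
      then show ?thesis
        using k by (intro bexI[of _ k]) auto
    qed
    ultimately show "series_E (inv_into UNIV \<sigma>) (Suc n) f m = \<zero>\<^bsub>S\<^esub> m"
      by (auto simp: series_E_def)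
  qed
  \<comment> \<open>Reordering does not change the set of variables, so the Koszul complex in the
    permuted order resolves the same residue field.\<close>
  have "(\<lambda>r. var (\<sigma> r)) ` {1..n} = (var ` {1..n} :: (nat multiset \<Rightarrow> 'k) set)"
    using permutes_image[OF assms(6)] by (metis image_image)
  then have res: "free_resolution S P \<delta> \<epsilon> (cyclic_module S koszul_ideal)"
    using assms(8) by (simp only: residue_field_module_def)
  show "Tor_map S P \<delta> (cyclic_module S J) (natural_map S J) i t
      = \<zero>\<^bsub>Tor S P \<delta> (cyclic_module S J) i\<^esub>"
    unfolding i by (rule Tor_map_cyclic_zero[OF assms(4) J EF DF res t[unfolded i assms(5)]])
qed

end
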